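(* Let $m\ge 1$ be an integer and let $(\Gamma,\gamma)$ be a 2-vertex connected twist graph (with coefficients in $\mathbb{Z}/m\mathbb{Z}$) on $n+1$ vertices, with no loops and with $\varphi_\gamma$ surjective. Suppose that $\Gamma$ is not a cycle, not the graph $\Theta_5$, not the graph $\Theta_7$, and not any graph obtained from one of these three by replacing edges with multiple parallel edges. Let $v$ be a vertex of $\Gamma$ (the empty vertex). Then the group $G\subseteq S(m,n)$ of solvable ordered pairs $(\vec{x},\sigma)$ is: - $\{(\vec{x},\sigma)\in S(m,n) \mid \sigma\in A_n\}$ if $\Gamma$ is bipartite; - $\{(\vec{x},\sigma)\in S(m,n) \mid \sum_{i=1}^n x_i\equiv \mathrm{sign}(\sigma) \pmod 2\}$ if $m$ is even and $(\Gamma,\gamma)$ is twist bipartite; - $S(m,n)$ otherwise.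
   Context: Graphs are finite and may have multiple parallel edges. A graph is 2-vertex connected if it has at least three vertices, is connected, and remains connected after deleting any one vertex. For an oriented edge $e$, $\overline{e}$ is the same edge with opposite orientation. A 1-chain $\gamma$ on $\Gamma$ with coefficients in $\mathbb{Z}/m\mathbb{Z}$ assigns $\gamma_e\in\mathbb{Z}/m\mathbb{Z}$ to each oriented edge $e$ with $\gamma_{\overline{e}}=-\gamma_e$. A twist graph is a pair $(\Gamma,\gamma)$ with $\Gamma$ a graph and $\gamma$ such a 1-chain. $H_1(\Gamma,\mathbb{Z}/m\mathbb{Z})$ is the group of 1-chains $\omega$ with $\sum_{e\to w}\omega_e=0$ for every vertex $w$ (sum over oriented edges with head $w$). The homomorphism $\varphi_\gamma:H_1(\Gamma,\mathbb{Z}/m\mathbb{Z})\to\mathbb{Z}/m\mathbb{Z}$ is $\varphi_\gamma(\omega)=\sum_{e\in E(\Gamma)}\gamma_e\omega_e$ (each edge taken once, with either orientation). $(\Gamma,\gamma)$ is twist bipartite if $m$ is even and the vertices can be 2-colored so that the endpoints of $e$ have different colors when $\gamma_e$ is even and the same color when $\gamma_e$ is odd. $\Theta_5$ is the graph consisting of two vertices joined by three internally disjoint paths of length 2 (i.e. $K_{2,3}$). $\Theta_7$ is the graph on 7 vertices consisting of two vertices joined by three internally disjoint paths of lengths 3, 3 and 2 (a hexagon with a pair of opposite vertices joined by a path of length 2 through a seventh vertex). For a finite set $X$, the generalized symmetric group on $X$ is $(\mathbb{Z}/m\mathbb{Z})^X\rtimes \mathrm{Sym}(X)$, with product $(\vec{x},\sigma)(\vec{y},\tau)=(\vec{x}+\sigma\cdot\vec{y},\sigma\tau)$,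 where $(\sigma\cdot\vec{y})_w=\vec{y}_{\sigma^{-1}(w)}$ and permutations compose right to left. For $|X|=n$ it is denoted $S(m,n)$. $\mathrm{sign}(\sigma)\in\mathbb{Z}/2\mathbb{Z}$ is $0$ for even and $1$ for odd permutations. For an oriented edge $e$, let $\sigma_e$ be the permutation of $V(\Gamma)$ transposing the head and tail of $e$, and let $\vec{x}(e)\in(\mathbb{Z}/m\mathbb{Z})^{V(\Gamma)}$ have entry $\gamma_e$ at the tail of $e$ and $0$ elsewhere. For a path $p=e_1e_2\cdots e_k$ (the head of $e_i$ is the tail of $e_{i+1}$), set $(\vec{x}(p),\sigma_p)=(\vec{x}(e_k),\sigma_{e_k})\cdots(\vec{x}(e_1),\sigma_{e_1})$, computed in the generalized symmetric group on $V(\Gamma)$. If $p$ is a closed path starting and ending at $v$, then $\sigma_p(v)=v$ and $\vec{x}(p)_v=0$, so $(\vec{x}(p),\sigma_p)$ is regarded as an element of $S(m,n)$, the generalized symmetric group on the $n$-element set $V(\Gamma)\smallsetminus\{v\}$. This depends only on the homotopy class of $p$ and gives a homomorphism (for the convention that concatenated paths correspond to products in reversed order) on $\pi_1(\Gamma,v)$; its image $G=\{(\vec{x}(p),\sigma_p): p \text{ a closed path at } v\}$ is the group of solvable ordered pairs. *)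

theory Defs
  imports
    "Graph_Theory.Graph_Theory"
    "HOL-Algebra.Elementary_Groups"
    "HOL-Combinatorics.Permutations"
    "HOL-Number_Theory.Cong"
begin

text \<open>
  A multigraph is a \<^locale>\<open>bidirected_digraph\<close>: its arcs are the oriented edges, and the
  fixed-point-free involution \<^term>\<open>bar\<close> on arcs reverses the orientation. An unoriented edge is
  an orbit of \<^term>\<open>bar\<close>. Elements of the integers modulo \<^term>\<open>m\<close> are represented by the
  integers in \<open>{0..<m}\<close>, that is, by the carrier of \<^term>\<open>integer_mod_group m\<close>.
\<close>

definition two_vertex_connected :: "('v, 'e) pre_digraph \<Rightarrow> bool" where
  "two_vertex_connected G \<longleftrightarrow>
     card (verts G) \<ge> 3 \<and> connected G \<and>
     (\<forall>u \<in> verts G. connected (pre_digraph.del_vert G u))"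

text \<open>Chains are set to 0 outside the arcs, so that they are determined by their values on arcs.\<close>

definition chains :: "nat \<Rightarrow> ('v, 'e) pre_digraph \<Rightarrow> ('e \<Rightarrow> 'e) \<Rightarrow> ('e \<Rightarrow> int) set" where
  "chains m G bar =
     {\<omega>. (\<forall>e \<in> arcs G. \<omega> e \<in> carrier (integer_mod_group m) \<and>
                        \<omega> (bar e) = inv\<^bsub>integer_mod_group m\<^esub> (\<omega> e)) \<and>
          (\<forall>e. e \<notin> arcs G \<longrightarrow> \<omega> e = 0)}"

definition twist_graph ::
  "nat \<Rightarrow> ('v, 'e) pre_digraph \<Rightarrow> ('e \<Rightarrow> 'e) \<Rightarrow> ('e \<Rightarrow> int) \<Rightarrow> bool" where
  "twist_graph m G bar \<gamma> \<longleftrightarrow>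
     fin_digraph G \<and> bidirected_digraph G bar \<and> \<gamma> \<in> chains m G bar"

definition H1 :: "nat \<Rightarrow> ('v, 'e) pre_digraph \<Rightarrow> ('e \<Rightarrow> 'e) \<Rightarrow> ('e \<Rightarrow> int) set" where
  "H1 m G bar =
     {\<omega> \<in> chains m G bar. \<forall>w \<in> verts G. [(\<Sum>e \<in> in_arcs G w. \<omega> e) = 0] (mod int m)}"

definition uedges :: "('v, 'e) pre_digraph \<Rightarrow> ('e \<Rightarrow> 'e) \<Rightarrow> 'e set set" where
  "uedges G bar = (\<lambda>e. {e, bar e}) ` arcs G"

text \<open>The orientation chosen for each edge is immaterial, see \<open>edge_term_independent\<close> below.\<close>

definition phi ::
  "nat \<Rightarrow> ('v, 'e) pre_digraph \<Rightarrow> ('e \<Rightarrow> 'e) \<Rightarrow> ('e \<Rightarrow> int) \<Rightarrow> ('e \<Rightarrow> int) \<Rightarrow> int" where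
  "phi m G bar \<gamma> \<omega> =
     (\<Sum>E \<in> uedges G bar. let e = (SOME e. e \<in> E) in \<gamma> e * \<omega> e) mod int m"

lemma edge_term_independent:
  assumes "bidirected_digraph G bar" "\<gamma> \<in> chains m G bar" "\<omega> \<in> chains m G bar"
    and "E \<in> uedges G bar" "e \<in> E" "e' \<in> E"
  shows "[\<gamma> e * \<omega> e = \<gamma> e' * \<omega> e'] (mod int m)"
proof -
  interpret bidirected_digraph G bar by fact
  have key: "[\<gamma> (bar a) * \<omega> (bar a) = \<gamma> a * \<omega> a] (mod int m)" if "a \<in> arcs G" for a
    using assms(2,3) that
    by (auto simp: chains_def cong_def mod_mult_eq)
  show ?thesis
    using assms(4-6) key by (auto simp: uedges_def intro: cong_sym)
qed

definition bipartite :: "('v, 'e) pre_digraph \<Rightarrow> bool" where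
  "bipartite G \<longleftrightarrow> (\<exists>c :: 'v \<Rightarrow> bool. \<forall>e \<in> arcs G. c (tail G e) \<noteq> c (head G e))"

definition twist_bipartite :: "nat \<Rightarrow> ('v, 'e) pre_digraph \<Rightarrow> ('e \<Rightarrow> int) \<Rightarrow> bool" where
  "twist_bipartite m G \<gamma> \<longleftrightarrow>
     even m \<and>
     (\<exists>c :: 'v \<Rightarrow> bool. \<forall>e \<in> arcs G.
        (even (\<gamma> e) \<longrightarrow> c (tail G e) \<noteq> c (head G e)) \<and>
        (odd (\<gamma> e) \<longrightarrow> c (tail G e) = c (head G e)))"

definition cycle_graph :: "nat \<Rightarrow> nat pair_pre_digraph" where
  "cycle_graph k =
     mk_symmetric (with_proj \<lparr>pverts = {..<k}, parcs = (\<lambda>i. (i, Suc i mod k)) ` {..<k}\<rparr>)"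

definition theta5 :: "nat pair_pre_digraph" where
  "theta5 = mk_symmetric (with_proj
     \<lparr>pverts = {..<5}, parcs = {(0,2),(2,1), (0,3),(3,1), (0,4),(4,1)}\<rparr>)"

definition theta7 :: "nat pair_pre_digraph" where
  "theta7 = mk_symmetric (with_proj
     \<lparr>pverts = {..<7}, parcs = {(0,2),(2,3),(3,1), (0,4),(4,5),(5,1), (0,6),(6,1)}\<rparr>)"

text \<open>
  Up to isomorphism, \<^term>\<open>G\<close> is the simple graph \<^term>\<open>H\<close> or arises from it by replacing edges
  with (one or more) parallel edges. As \<^term>\<open>H\<close> has no parallel edges, this means that a
  bijection of the vertices matches the adjacency relations.
\<close>

definition is_multi_of :: "('v, 'e) pre_digraph \<Rightarrow> 'u pair_pre_digraph \<Rightarrow> bool" where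
  "is_multi_of G H \<longleftrightarrow>
     (\<exists>f. bij_betw f (pverts H) (verts G) \<and> arcs_ends G = map_prod f f ` parcs H)"

text \<open>
  The generalized symmetric group on \<^term>\<open>X\<close>. Vectors are 0 and permutations are the identity
  outside \<^term>\<open>X\<close>, so for \<open>Y \<subseteq> X\<close> the group on \<open>Y\<close> is literally contained in the
  one on \<^term>\<open>X\<close>: a pair on \<^term>\<open>X\<close> that has entry 0 at \<^term>\<open>v\<close> and fixes \<^term>\<open>v\<close>
  is an element of the group on \<open>X - {v}\<close>.
\<close>

definition gen_sym_group :: "nat \<Rightarrow> 'v set \<Rightarrow> (('v \<Rightarrow> int) \<times> ('v \<Rightarrow> 'v)) monoid" where
  "gen_sym_group m X =
     \<lparr>carrier = {(x, \<sigma>). (\<forall>w \<in> X. x w \<in> carrier (integer_mod_group m)) \<and>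
                          (\<forall>w. w \<notin> X \<longrightarrow> x w = 0) \<and> \<sigma> permutes X},
      monoid.mult = (\<lambda>(x, \<sigma>) (y, \<tau>).
        (\<lambda>w. x w \<otimes>\<^bsub>integer_mod_group m\<^esub> y (inv_into UNIV \<sigma> w), \<sigma> \<circ> \<tau>)),
      one = (\<lambda>w. 0, id)\<rparr>"

definition perm_sign :: "('v \<Rightarrow> 'v) \<Rightarrow> int" where
  "perm_sign \<sigma> = (if evenperm \<sigma> then 0 else 1)"

definition edge_elem ::
  "('v, 'e) pre_digraph \<Rightarrow> ('e \<Rightarrow> int) \<Rightarrow> 'e \<Rightarrow> ('v \<Rightarrow> int) \<times> ('v \<Rightarrow> 'v)" where
  "edge_elem G \<gamma> e =
     ((\<lambda>w. if w = tail G e then \<gamma> e else 0), Transposition.transpose (tail G e) (head G e))"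

primrec path_elem ::
  "nat \<Rightarrow> ('v, 'e) pre_digraph \<Rightarrow> ('e \<Rightarrow> int) \<Rightarrow> 'e list \<Rightarrow> ('v \<Rightarrow> int) \<times> ('v \<Rightarrow> 'v)" where
  "path_elem m G \<gamma> [] = \<one>\<^bsub>gen_sym_group m (verts G)\<^esub>"
| "path_elem m G \<gamma> (e # p) =
     path_elem m G \<gamma> p \<otimes>\<^bsub>gen_sym_group m (verts G)\<^esub> edge_elem G \<gamma> e"

definition solvable_pairs ::
  "nat \<Rightarrow> ('v, 'e) pre_digraph \<Rightarrow> ('e \<Rightarrow> int) \<Rightarrow> 'v \<Rightarrow> (('v \<Rightarrow> int) \<times> ('v \<Rightarrow> 'v)) set" where
  "solvable_pairs m G \<gamma> v = {path_elem m G \<gamma> p | p. pre_digraph.awalk G v p v}"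

end

theory Submission
  imports Defs "HOL-Combinatorics.Cycles"
begin

text \<open>
  Wilson's theorem describes the permutation parts. If two cycles share a path, the commutator of
  their rotations is a 3-cycle or a product of two transpositions, and products of shifted copies of
  the latter give 3-cycles in every theta graph except \<open>\<Theta>\<^sub>7\<close>. The maximal sets of tokens all of whose
  3-cycles occur are blocks of the group, so attaching ears one by one spreads the 3-cycles
  over the whole graph. A longest cycle together with a chord or an ear provides the theta graph to
  start from.

  For the vectors, let a non-Hamiltonian cycle have twist \<open>s\<close> and let \<open>S\<close> be its set of tokens. A
  suitable power of its rotation is the vector \<open>s\<close> on \<open>S\<close> with trivial permutation, and comparing it
  with its conjugates by 3-cycles gives all vectors \<open>s (e\<^sub>i - e\<^sub>j)\<close>. A Hamiltonian cycle has a chord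
  and is a sum of two shorter cycles. Hence the scalars that occur contain \<open>\<phi>\<^sub>\<gamma>(H\<^sub>1)\<close>, and all vectors of
  sum 0 are in the group. Commutators show that every even permutation occurs with a vector of
  sum 0, so that a pair is determined by its sum and sign, which are the twist and the
  length parity of a closed walk.
\<close>

section \<open>Groups containing 3-cycles\<close>

text \<open>The exclusion of \<open>\<Theta>\<^sub>5\<close> belongs to the vectors, not to the
  permutations. It contains a 4-cycle, whose rotation is already a 3-cycle, so all even permutations
  of its four tokens occur. But being a commutator is what forces a vector of sum 0, and the
  commutators in \<open>A_4\<close> only fill the Klein four-group. Bipartite graphs admit no odd
  permutations, so the argument needs five tokens there; on fewer, the only bipartite graphs are the
  square and \<open>\<Theta>\<^sub>5\<close>. If an odd permutation occurs, all transpositions do,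
  and every 3-cycle is a commutator of two of them. Cycles are an obstacle for the vectors too: a
  rotation of all tokens leaves no token outside to compare with. No duality between
  \<open>H_1\<close> and chains is invoked. If the twists of all closed walks lie in a subgroup,
  then a potential makes \<gamma> a coboundary modulo this subgroup, so \<phi>_\<gamma> takes its
  values there, and surjectivity puts 1 into it. Vectors, sums and subgroups are lifted to the
  integers and compared modulo \<open>m\<close>.\<close>

definition cyc3 :: "'v \<Rightarrow> 'v \<Rightarrow> 'v \<Rightarrow> 'v \<Rightarrow> 'v" where
  "cyc3 a b c = Transposition.transpose a b \<circ> Transposition.transpose b c"

lemma cyc3_apply:
  assumes "a \<noteq> b" "a \<noteq> c" "b \<noteq> c"
  shows "cyc3 a b c x = (if x = a then b else if x = b then c else if x = c then a else x)"
  using assms by (auto simp: cyc3_def Transposition.transpose_def)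

lemma cyc3_rotate:
  assumes "a \<noteq> b" "a \<noteq> c" "b \<noteq> c"
  shows "cyc3 a b c = cyc3 b c a"
  using assms by (auto simp: fun_eq_iff cyc3_apply)

lemma inv_cyc3: "inv_into UNIV (cyc3 a b c) = cyc3 c b a"
  by (simp add: cyc3_def o_inv_distrib transpose_commute)

text \<open>For distinct points, \<open>cyc3 a b c\<close> sends \<open>a\<close> to
  \<open>b\<close> to \<open>c\<close> to \<open>a\<close>. As a product of two transpositions it is
  conjugated factor by factor, so the points may coincide here and in
  \<open>inv_cyc3\<close>.\<close>

lemma conj_cyc3:
  assumes "bij g"
  shows "g \<circ> cyc3 a b c \<circ> inv_into UNIV g = cyc3 (g a) (g b) (g c)"
proof -
  have "g (inv_into UNIV g x) = x" "inv_into UNIV g x = y \<longleftrightarrow> x = g y" for x y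
    using assms by (auto simp: bij_is_surj surj_f_inv_f bij_is_inj)
  then show ?thesis
    using assms by (auto simp: fun_eq_iff cyc3_def Transposition.transpose_def bij_is_inj inj_eq)
qed

lemma cyc3_permutes: "a \<in> B \<Longrightarrow> b \<in> B \<Longrightarrow> c \<in> B \<Longrightarrow> cyc3 a b c permutes B"
  by (simp add: cyc3_def permutes_compose permutes_swap_id)

lemma evenperm_cyc3: "a \<noteq> b \<Longrightarrow> b \<noteq> c \<Longrightarrow> evenperm (cyc3 a b c)"
  by (simp add: cyc3_def evenperm_comp permutation_swap_id evenperm_swap)

text \<open>Instantiated twice: with the permutations of all closed walks at a vertex, and with
  those among them that occur together with a vector of sum 0.\<close>

locale perm_group =
  fixes X :: "'v set" and H :: "('v \<Rightarrow> 'v) set"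
  assumes finite_X: "finite X"
    and permutes: "g \<in> H \<Longrightarrow> g permutes X"
    and id_mem: "id \<in> H"
    and comp_mem: "g \<in> H \<Longrightarrow> h \<in> H \<Longrightarrow> g \<circ> h \<in> H"
    and inv_mem: "g \<in> H \<Longrightarrow> inv_into UNIV g \<in> H"
begin

text \<open>The condition is empty for fewer than three points, which is why the lemmas on unions
  and blocks carry cardinality assumptions.\<close>

definition full :: "'v set \<Rightarrow> bool" where
  "full B \<longleftrightarrow>
     (\<forall>a \<in> B. \<forall>b \<in> B. \<forall>c \<in> B. a \<noteq> b \<longrightarrow> a \<noteq> c \<longrightarrow> b \<noteq> c \<longrightarrow> cyc3 a b c \<in> H)"

lemma fullD:
  "full B \<Longrightarrow> a \<in> B \<Longrightarrow> b \<in> B \<Longrightarrow> c \<in> B \<Longrightarrow> a \<noteq> b \<Longrightarrow> a \<noteq> c \<Longrightarrow> b \<noteq> c \<Longrightarrow> cyc3 a b c \<in> H"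
  unfolding full_def by blast

lemma full_subset: "full B \<Longrightarrow> C \<subseteq> B \<Longrightarrow> full C"
  unfolding full_def by blast

lemma bij_mem: "g \<in> H \<Longrightarrow> bij g"
  using permutes permutes_bij by blast

lemma conj_mem:
  assumes "g \<in> H" "cyc3 a b c \<in> H"
  shows "cyc3 (g a) (g b) (g c) \<in> H"
  using assms conj_cyc3[OF bij_mem[OF assms(1)]] comp_mem inv_mem by metis

lemma rev_mem: "cyc3 a b c \<in> H \<Longrightarrow> cyc3 c b a \<in> H"
  using inv_mem inv_cyc3 by metis

lemma rotate_mem: "cyc3 a b c \<in> H \<Longrightarrow> a \<noteq> b \<Longrightarrow> a \<noteq> c \<Longrightarrow> b \<noteq> c \<Longrightarrow> cyc3 b c a \<in> H"
  using cyc3_rotate by metis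

lemma swap_mem: "cyc3 a b c \<in> H \<Longrightarrow> a \<noteq> b \<Longrightarrow> a \<noteq> c \<Longrightarrow> b \<noteq> c \<Longrightarrow> cyc3 b a c \<in> H"
  using rev_mem rotate_mem by metis

lemma full_triple:
  assumes "cyc3 a b c \<in> H" "a \<noteq> b" "a \<noteq> c" "b \<noteq> c"
  shows "full {a, b, c}"
  unfolding full_def using assms rotate_mem swap_mem by (smt (verit) insert_iff singletonD)

lemma full_image:
  assumes "g \<in> H" "full B"
  shows "full (g ` B)"
  unfolding full_def
  by (smt (verit) assms conj_mem full_def image_iff)

text \<open>Conjugating \<open>(a b z)\<close> by \<open>(a b w)\<close> gives
  \<open>(b w z)\<close>, and inversion exchanges the two points of \<open>B\<close>. These moves
  lead from the pair \<open>x, y\<close> to every pair in \<open>B\<close>.\<close>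

lemma full_insert:
  assumes B: "full B"
    and xy: "x \<in> B" "y \<in> B" "x \<noteq> y" "z \<notin> B" and c: "cyc3 x y z \<in> H"
  shows "full (insert z B)"
proof -
  have neq: "a \<noteq> z" "z \<noteq> a" if "a \<in> B" for a
    using that xy(4) by auto
  have step: "cyc3 b w z \<in> H"
    if "cyc3 a b z \<in> H" "a \<in> B" "b \<in> B" "w \<in> B" "a \<noteq> b" "w \<noteq> a" "w \<noteq> b" for a b w
  proof -
    have "cyc3 a b w \<in> H"
      using B that unfolding full_def by auto
    from conj_mem[OF this that(1)] show ?thesis
      using that neq[OF \<open>a \<in> B\<close>] neq[OF \<open>b \<in> B\<close>] neq[OF \<open>w \<in> B\<close>] by (simp add: cyc3_apply)
  qed
  have sym: "cyc3 b a z \<in> H" if "cyc3 a b z \<in> H" "a \<in> B" "b \<in> B" "a \<noteq> b" for a b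
    using swap_mem[OF that(1)] that neq by metis
  have pairs: "cyc3 a b z \<in> H" if ab: "a \<in> B" "b \<in> B" "a \<noteq> b" for a b
  proof -
    have from_y: "cyc3 y w z \<in> H" if "w \<in> B" "w \<noteq> y" for w
      using step[OF c xy(1,2) that(1) xy(3)] sym[OF c xy(1-3)] that by metis
    show ?thesis
    proof (cases "a = y \<or> b = y")
      case True
      then show ?thesis using from_y sym ab xy by metis
    next
      case False
      then show ?thesis
        using step[OF sym[OF from_y[of a]], of b] step[OF from_y[of a], of b] ab xy by metis
    qed
  qed
  show ?thesis
    unfolding full_def
  proof (intro ballI impI)
    fix a b d
    assume m: "a \<in> insert z B" "b \<in> insert z B" "d \<in> insert z B" and d: "a \<noteq> b" "a \<noteq> d" "b \<noteq> d"
    show "cyc3 a b d \<in> H"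
      by (metis (no_types, lifting) B d full_def insertE m pairs rotate_mem)
  qed
qed

lemma full_cyc3_join:
  assumes B: "full B" and card: "card B \<ge> 3"
    and x: "x \<in> B" and c: "cyc3 x y z \<in> H" and d: "x \<noteq> y" "x \<noteq> z" "y \<noteq> z"
  shows "full (insert y (insert z B))"
proof -
  have fin: "finite B"
    using card card.infinite by fastforce
  consider "y \<in> B" "z \<in> B" | "y \<in> B" "z \<notin> B" | "y \<notin> B" "z \<in> B" | "y \<notin> B" "z \<notin> B"
    by blast
  then show ?thesis
  proof cases
    case 1
    then show ?thesis using B by (simp add: insert_absorb)
  next
    case 2
    then show ?thesis using full_insert[OF B x 2(1) d(1) 2(2) c] by (simp add: insert_absorb)
  next
    case 3
    have "cyc3 z x y \<in> H"
      using rotate_mem c d by metis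
    then show ?thesis
      using full_insert[OF B 3(2) x d(2)[symmetric] 3(1)] 3 by (simp add: insert_absorb)
  next
    case 4
    have "card (B - {x}) \<ge> 2"
      using card x fin by (simp add: card_Diff_singleton)
    then have "\<not> (\<forall>a \<in> B - {x}. \<forall>b \<in> B - {x}. a = b)"
      using card_le_Suc0_iff_eq[of "B - {x}"] fin by simp
    then obtain a b where ab: "a \<in> B - {x}" "b \<in> B - {x}" "a \<noteq> b"
      by blast
    have neq: "a \<noteq> y" "a \<noteq> z" "x \<noteq> a"
      using ab 4 by auto
    \<comment> \<open>Conjugation by \<open>(x a b)\<close> replaces \<open>x\<close> by
      \<open>a\<close> in \<open>(x y z)\<close>. The quotient of the two cycles is
      \<open>(x a z)\<close>, which has only one point outside \<open>B\<close>.\<close>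
    have "cyc3 x a b \<in> H"
      using B x ab by (auto simp: full_def)
    moreover have "cyc3 x a b x = a" "cyc3 x a b y = y" "cyc3 x a b z = z"
      using ab d 4 by (subst cyc3_apply; auto)+
    ultimately have "cyc3 a y z \<in> H"
      using conj_mem[OF _ c] by metis
    then have "cyc3 z y a \<circ> cyc3 x y z \<in> H"
      using c comp_mem rev_mem by blast
    also have "cyc3 z y a \<circ> cyc3 x y z = cyc3 x a z"
      using ab d 4 neq by (auto simp: fun_eq_iff cyc3_apply)
    finally have z: "full (insert z B)"
      using full_insert[OF B x _ neq(3) 4(2)] ab by blast
    have "cyc3 z x y \<in> H"
      using rotate_mem c d by metis
    from full_insert[OF z _ _ _ _ this] show ?thesis
      using x d 4 by auto
  qed
qed

text \<open>The points of \<open>C\<close> are added to \<open>B\<close> one at a time. The new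
  point \<open>y\<close>, the common point \<open>x\<close> and any third point \<open>z\<close> of
  \<open>C\<close> form a 3-cycle that meets the current set in \<open>x\<close>, wherever
  \<open>z\<close> lies.\<close>

lemma full_Un:
  assumes "full B" "full C" "card B \<ge> 3" "B \<inter> C \<noteq> {}" "finite C"
    and C3: "card C \<ge> 3"
  shows "full (B \<union> C)"
proof -
  obtain x where x: "x \<in> B" "x \<in> C"
    using assms(4) by blast
  have fB: "finite B"
    using assms(3) card.infinite by fastforce
  have "full (B \<union> D)" if "D \<subseteq> C" "finite D" for D
    using that(2,1)
  proof (induction D)
    case empty
    then show ?case using assms by simp
  next
    case (insert y D)
    then have IH: "full (B \<union> D)" "card (B \<union> D) \<ge> 3" "y \<in> C"
      using assms(3) card_mono[of "B \<union> D" B] fB by auto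
    have "\<not> C \<subseteq> {x, y}"
      using C3 card_mono[of "{x, y}" C] card_insert_le_m1[of 2 "{y}" x] by auto
    then obtain z where z: "z \<in> C" "z \<noteq> x" "z \<noteq> y"
      by blast
    show ?case
    proof (cases "y = x")
      case True
      then show ?thesis using IH x by (simp add: insert_absorb)
    next
      case False
      then have "cyc3 x y z \<in> H"
        using fullD[OF assms(2) x(2) IH(3) z(1)] z by auto
      then have "full (insert y (insert z (B \<union> D)))"
        using full_cyc3_join[OF IH(1,2)] x z False by auto
      then show ?thesis
        by (rule full_subset) auto
    qed
  qed
  then show ?thesis using assms(5) by blast
qed

text \<open>A maximal set supporting all 3-cycles is a block of the action.\<close>

lemma full_maximal:
  assumes "full B" "card B \<ge> 3" "B \<subseteq> X"
  obtains M where "B \<subseteq> M" "M \<subseteq> X" "full M"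
    "\<forall>g \<in> H. g ` M \<inter> M \<noteq> {} \<longrightarrow> g ` M = M"
proof -
  have "finite {M. B \<subseteq> M \<and> M \<subseteq> X \<and> full M}"
    using finite_X by (auto intro: finite_subset[of _ "Pow X"])
  moreover have "B \<in> {M. B \<subseteq> M \<and> M \<subseteq> X \<and> full M}"
    using assms by auto
  ultimately obtain M where M: "M \<in> {M. B \<subseteq> M \<and> M \<subseteq> X \<and> full M}"
    and max: "\<And>N. N \<in> {M. B \<subseteq> M \<and> M \<subseteq> X \<and> full M} \<Longrightarrow> M \<subseteq> N \<Longrightarrow> N = M"
    by (metis (no_types, lifting) finite_has_maximal2)
  have fM: "finite M"
    using M finite_X finite_subset by auto
  have cM: "card M \<ge> 3"
    using M assms(2) card_mono[OF fM, of B] by auto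
  have "g ` M = M" if g: "g \<in> H" "g ` M \<inter> M \<noteq> {}" for g
  proof -
    have inj: "inj_on g M"
      using bij_mem[OF g(1)] bij_is_inj inj_on_subset by blast
    \<comment> \<open>The image of \<open>M\<close> is full and overlaps \<open>M\<close>, so the
      union is full and maximality absorbs it.\<close>
    have "full (M \<union> g ` M)"
      using full_Un[of M "g ` M"] M full_image[OF g(1)] cM g fM card_image[OF inj] by auto
    moreover have "g ` M \<subseteq> X"
      using M permutes_image[OF permutes[OF g(1)]] by blast
    ultimately have "M \<union> g ` M = M"
      using max[of "M \<union> g ` M"] M by auto
    then show ?thesis
      using card_image[OF inj] card_subset_eq[OF fM, of "g ` M"] by auto
  qed
  then show thesis
    using M by (intro that[of M]) auto
qed

text \<open>With \<open>b = \<sigma> a\<close>, a 3-cycle that sends \<open>b\<close> back to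
  \<open>a\<close> turns \<open>a\<close> into a fixed point, and no fixed point is lost if its
  third point \<open>c\<close> is itself moved. Such a \<open>c\<close> exists, since otherwise
  \<sigma> would be the transposition of \<open>a\<close> and \<open>b\<close>, which is
  odd.\<close>

lemma full_imp_alternating:
  assumes full: "full X" and "\<sigma> permutes X" "evenperm \<sigma>"
  shows "\<sigma> \<in> H"
  using assms(2,3)
proof (induction "card {x. \<sigma> x \<noteq> x}" arbitrary: \<sigma> rule: less_induct)
  case less
  let ?S = "{x. \<sigma> x \<noteq> x}"
  have S: "?S \<subseteq> X" "finite ?S"
    using less.prems(1) finite_X by (auto simp: permutes_def intro: finite_subset)
  have inj: "inj \<sigma>"
    using less.prems(1) permutes_inj by blast
  show ?case
  proof (cases "\<sigma> = id")
    case True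
    then show ?thesis using id_mem by simp
  next
    case False
    then obtain a where a: "\<sigma> a \<noteq> a"
      by (auto simp: fun_eq_iff)
    let ?b = "\<sigma> a"
    have b: "\<sigma> ?b \<noteq> ?b"
      using a inj by (auto simp: inj_def)
    have "\<exists>c. c \<noteq> a \<and> c \<noteq> ?b \<and> \<sigma> c \<noteq> c"
    proof (rule ccontr)
      assume *: "\<not> ?thesis"
      have "\<sigma> (\<sigma> ?b) \<noteq> \<sigma> ?b"
        using b inj by (auto simp: inj_def)
      then have "\<sigma> ?b = a"
        using * b by blast
      then have "\<sigma> = Transposition.transpose a ?b"
        using * by (auto simp: fun_eq_iff Transposition.transpose_def)
      then have "\<not> evenperm \<sigma>"
        using a evenperm_swap[of a ?b] by simp
      then show False using less.prems by blast
    qed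
    then obtain c where c: "c \<noteq> a" "c \<noteq> ?b" "\<sigma> c \<noteq> c"
      by blast
    have mem: "cyc3 a ?b c \<in> H"
    proof (rule fullD[OF full])
      show "a \<in> X" "?b \<in> X" "c \<in> X"
        using S(1) a b c by auto
    qed (use a c in auto)
    let ?t = "cyc3 c ?b a \<circ> \<sigma>"
    have pX: "cyc3 c ?b a permutes X"
      using S a b c by (intro cyc3_permutes) auto
    have tX: "?t permutes X"
      using less.prems(1) pX by (rule permutes_compose)
    have perm: "permutation \<sigma>" "permutation (cyc3 c ?b a)"
      using less.prems(1) pX finite_X by (auto simp: permutation_permutes)
    have even: "evenperm ?t"
      using evenperm_comp[OF perm(2,1)] evenperm_cyc3[of c ?b a] a c less.prems by auto
    have "{x. ?t x \<noteq> x} \<subseteq> ?S"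
    proof
      fix x assume x: "x \<in> {x. ?t x \<noteq> x}"
      show "x \<in> ?S"
        using x a b c by (auto simp: cyc3_apply split: if_splits)
    qed
    moreover have "?t a = a"
      using a c by (simp add: cyc3_apply)
    ultimately have "{x. ?t x \<noteq> x} \<subset> ?S"
      using a by blast
    then have "card {x. ?t x \<noteq> x} < card ?S"
      by (rule psubset_card_mono[OF S(2)])
    then have "?t \<in> H"
      using less.hyps tX even by blast
    moreover have "cyc3 a ?b c \<circ> ?t = \<sigma>"
      using a c by (auto simp: fun_eq_iff cyc3_apply)
    ultimately show ?thesis
      using comp_mem[OF mem, of ?t] by simp
  qed
qed

end

section \<open>Walks of the empty vertex and ears\<close>

text \<open>The empty vertex moves along the list, so the token at the second vertex moves to the first.\<close>

definition wperm :: "'v list \<Rightarrow> 'v \<Rightarrow> 'v" where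
  "wperm vs = cycle_of_list (rev vs)"

text \<open>\<open>cycle_of_list\<close> multiplies the transpositions of neighbouring entries even
  when entries repeat. Splitting a list at a shared entry therefore splits the product, and
  \<open>wperm\<close> is multiplicative on walks that revisit vertices.\<close>

lemma cycle_of_list_append:
  "cycle_of_list (xs @ y # ys) = cycle_of_list (xs @ [y]) \<circ> cycle_of_list (y # ys)"
proof (induction xs rule: induct_list012)
  case (3 a b zs)
  then show ?case by (simp add: comp_assoc)
qed (simp_all add: comp_assoc)

lemma wperm_append: "wperm (xs @ y # ys) = wperm (y # ys) \<circ> wperm (xs @ [y])"
  using cycle_of_list_append[of "rev ys" y "rev xs"] by (simp add: wperm_def)

lemma wperm_single [simp]: "wperm [x] = id" and wperm_Nil [simp]: "wperm [] = id"
  by (simp_all add: wperm_def)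

lemma wperm_Cons_Cons: "wperm (x # y # vs) = wperm (y # vs) \<circ> Transposition.transpose x y"
  using wperm_append[of "[x]" y vs] by (simp add: wperm_def transpose_commute)

lemma wperm_step:
  "wperm (x # y # vs) i = wperm (y # vs) (if i = x then y else if i = y then x else i)"
  by (simp add: wperm_Cons_Cons Transposition.transpose_def)

lemma wperm_permutes: "set vs \<subseteq> A \<Longrightarrow> wperm vs permutes A"
  unfolding wperm_def using cycle_permutes[of "rev vs"] permutes_subset by fastforce

lemma bij_wperm: "bij (wperm vs)"
  using wperm_permutes[of vs "set vs"] permutes_bij by blast

lemma wperm_hd: "vs \<noteq> [] \<Longrightarrow> wperm vs (hd vs) = last vs"
proof (induction vs rule: induct_list012)
  case (3 x y zs)
  then show ?case by (simp add: wperm_Cons_Cons)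
qed auto

lemma wperm_outside: "x \<notin> set vs \<Longrightarrow> wperm vs x = x"
  unfolding wperm_def by (simp add: id_outside_supp)

lemma wperm_rev: "wperm (rev vs) = inv_into UNIV (wperm vs)"
proof (induction vs rule: induct_list012)
  case (3 x y zs)
  have "wperm (rev (x # y # zs)) = wperm [y, x] \<circ> wperm (rev zs @ [y])"
    using wperm_append[of "rev zs" y "[x]"] by simp
  also have "\<dots> = Transposition.transpose x y \<circ> inv_into UNIV (wperm (y # zs))"
    using 3 by (simp add: wperm_def)
  also have "\<dots> = inv_into UNIV (wperm (y # zs) \<circ> Transposition.transpose x y)"
    by (simp add: o_inv_distrib bij_wperm)
  finally show ?case by (simp only: wperm_Cons_Cons)
qed simp_all

lemma map_wperm:
  assumes "distinct vs"
  shows "map (wperm vs) (rev vs) = rotate1 (rev vs)"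
  using cyclic_rotation[of "rev vs" 1] assms by (simp add: wperm_def)

text \<open>A list of \<open>k\<close> vertices makes \<open>k - 1\<close> moves, each a genuine
  transposition because neighbours differ.\<close>

lemma evenperm_wperm:
  assumes "successively (\<noteq>) vs" "vs \<noteq> []"
  shows "evenperm (wperm vs) \<longleftrightarrow> odd (length vs)"
  using assms
proof (induction vs rule: induct_list012)
  case (3 x y zs)
  have "permutation (wperm (y # zs))"
    unfolding wperm_def by (rule permutation_of_cycle)
  then have "evenperm (wperm (x # y # zs)) = (evenperm (wperm (y # zs)) = (x = y))"
    unfolding wperm_Cons_Cons by (subst evenperm_comp) (simp_all add: permutation_swap_id evenperm_swap)
  then show ?case
    using 3 by simp
qed auto

text \<open>Parallel edges give the same transposition, so for the permutations only adjacency
  matters. The assumption \<open>avoiding_path\<close> expresses 2-connectivity through paths; for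
  \<open>z\<close> outside \<open>V\<close> it amounts to connectivity.\<close>

locale puzzle =
  fixes V :: "'v set" and E :: "'v \<Rightarrow> 'v \<Rightarrow> bool"
  assumes finite_V: "finite V"
    and E_sym: "E x y \<Longrightarrow> E y x"
    and E_irrefl: "\<not> E x x"
    and E_V: "E x y \<Longrightarrow> x \<in> V"
    and card_V: "card V \<ge> 3"
    and avoiding_path: "\<lbrakk>x \<in> V; y \<in> V; z \<noteq> x; z \<noteq> y\<rbrakk> \<Longrightarrow>
      \<exists>vs. vs \<noteq> [] \<and> successively E vs \<and> distinct vs \<and> hd vs = x \<and> last vs = y \<and> z \<notin> set vs"
begin

definition walk :: "'v list \<Rightarrow> bool" where
  "walk vs \<longleftrightarrow> vs \<noteq> [] \<and> set vs \<subseteq> V \<and> successively E vs"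

definition grp :: "'v \<Rightarrow> ('v \<Rightarrow> 'v) set" where
  "grp u = {wperm vs | vs. walk vs \<and> hd vs = u \<and> last vs = u}"

lemma grpI: "walk vs \<Longrightarrow> hd vs = u \<Longrightarrow> last vs = u \<Longrightarrow> wperm vs \<in> grp u"
  by (auto simp: grp_def)

lemma walk_append: "walk (xs @ [y]) \<Longrightarrow> walk (y # ys) \<Longrightarrow> walk (xs @ y # ys)"
  by (auto simp: walk_def successively_append_iff)

lemma walk_rev: "walk vs \<Longrightarrow> walk (rev vs)"
  using E_sym by (auto simp: walk_def intro: successively_mono)

lemma walk_compose:
  assumes "walk vs" "walk ws" "last vs = hd ws"
  obtains us where "walk us" "hd us = hd vs" "last us = last ws" "set us = set vs \<union> set ws"
    "wperm us = wperm ws \<circ> wperm vs"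
proof -
  obtain xs y where xs: "vs = xs @ [y]"
    using assms(1) by (metis append_butlast_last_id walk_def)
  obtain y' ys where ys: "ws = y' # ys"
    using assms(2) by (metis neq_Nil_conv walk_def)
  have y: "y' = y"
    using assms(3) xs ys by simp
  show thesis
    using that[of "xs @ y # ys"] walk_append[of xs y ys] assms xs ys y wperm_append[of xs y ys]
    by (cases xs) auto
qed

lemma perm_group_grp:
  assumes "u \<in> V"
  shows "perm_group (V - {u}) (grp u)"
proof
  show "finite (V - {u})"
    using finite_V by simp
  show "g permutes V - {u}" if mem: "g \<in> grp u" for g
  proof -
    obtain vs where vs: "walk vs" "hd vs = u" "last vs = u" "g = wperm vs"
      using mem by (auto simp: grp_def)
    have "g permutes V"
      using vs wperm_permutes by (auto simp: walk_def)
    moreover have "g u = u"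
      using vs wperm_hd[of vs] by (auto simp: walk_def)
    ultimately show ?thesis
      unfolding permutes_def by auto
  qed
  show "id \<in> grp u"
    using grpI[of "[u]" u] assms by (simp add: walk_def)
  show "g \<circ> h \<in> grp u" if gh: "g \<in> grp u" "h \<in> grp u" for g h
  proof -
    obtain vs ws where *: "walk vs" "hd vs = u" "last vs = u" "h = wperm vs"
      "walk ws" "hd ws = u" "last ws = u" "g = wperm ws"
      using gh by (auto simp: grp_def)
    then obtain us where "walk us" "hd us = u" "last us = u" "wperm us = g \<circ> h"
      using walk_compose[of vs ws] by metis
    then show ?thesis using grpI by metis
  qed
  show "inv_into UNIV g \<in> grp u" if mem: "g \<in> grp u" for g
  proof -
    obtain vs where vs: "walk vs" "hd vs = u" "last vs = u" "g = wperm vs"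
      using mem by (auto simp: grp_def)
    then show ?thesis
      using grpI[of "rev vs" u] walk_rev[of vs] wperm_rev[of vs] by (simp add: walk_def hd_rev last_rev)
  qed
qed

abbreviation full :: "'v \<Rightarrow> 'v set \<Rightarrow> bool" where
  "full u \<equiv> perm_group.full (grp u)"

lemma grp_transport:
  assumes vs: "walk vs" "hd vs = u" "last vs = w" and h: "h \<in> grp u"
  shows "wperm vs \<circ> h \<circ> inv_into UNIV (wperm vs) \<in> grp w"
proof -
  obtain us where us: "walk us" "hd us = u" "last us = u" "h = wperm us"
    using h by (auto simp: grp_def)
  have rev: "walk (rev vs)" "hd (rev vs) = w" "last (rev vs) = u"
    using walk_rev[OF vs(1)] vs by (auto simp: walk_def hd_rev last_rev)
  obtain xs where xs: "walk xs" "hd xs = w" "last xs = u" "wperm xs = h \<circ> wperm (rev vs)"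
    using walk_compose[OF rev(1) us(1)] rev us by metis
  obtain ys where "walk ys" "hd ys = w" "last ys = w" "wperm ys = wperm vs \<circ> wperm xs"
    using walk_compose[OF xs(1) vs(1)] xs vs by metis
  then show ?thesis
    using grpI[of ys w] xs wperm_rev[of vs] by (simp add: comp_assoc)
qed

lemma full_transport:
  assumes vs: "walk vs" "hd vs = u" "last vs = w" and full: "full u B"
  shows "full w (wperm vs ` B)"
proof -
  have V: "u \<in> V" "w \<in> V"
    using vs by (auto simp: walk_def)
  interpret U: perm_group "V - {u}" "grp u" by (rule perm_group_grp[OF V(1)])
  interpret W: perm_group "V - {w}" "grp w" by (rule perm_group_grp[OF V(2)])
  have inj: "inj (wperm vs)"
    using bij_wperm bij_is_inj by blast
  show ?thesis
    unfolding W.full_def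
  proof (intro ballI impI)
    fix a b c
    assume "a \<in> wperm vs ` B" "b \<in> wperm vs ` B" "c \<in> wperm vs ` B" and d: "a \<noteq> b" "a \<noteq> c" "b \<noteq> c"
    then obtain a' b' c' where *: "a' \<in> B" "b' \<in> B" "c' \<in> B"
      "a = wperm vs a'" "b = wperm vs b'" "c = wperm vs c'"
      by blast
    then have "cyc3 a' b' c' \<in> grp u"
      using U.fullD[OF full *(1-3)] d by blast
    from grp_transport[OF vs this] show "cyc3 a b c \<in> grp w"
      using conj_cyc3[OF bij_wperm[of vs], of a' b' c'] * by simp
  qed
qed

text \<open>Connectedness of the subgraph induced on \<open>Z\<close>. It lets the empty vertex
  travel within \<open>Z\<close> without disturbing the tokens outside.\<close>

definition linked :: "'v set \<Rightarrow> bool" where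
  "linked Z \<longleftrightarrow> (\<forall>x \<in> Z. \<forall>y \<in> Z. (\<lambda>x y. E x y \<and> x \<in> Z \<and> y \<in> Z)\<^sup>*\<^sup>* x y)"

lemma rtranclp_walk:
  assumes "(\<lambda>x y. E x y \<and> x \<in> Z \<and> y \<in> Z)\<^sup>*\<^sup>* x y" "x \<in> Z" "Z \<subseteq> V"
  shows "\<exists>vs. walk vs \<and> hd vs = x \<and> last vs = y \<and> set vs \<subseteq> Z"
  using assms(1)
proof (induction rule: rtranclp_induct)
  case base
  then show ?case
    using assms by (intro exI[of _ "[x]"]) (auto simp: walk_def)
next
  case (step y z)
  then obtain vs where "walk vs" "hd vs = x" "last vs = y" "set vs \<subseteq> Z"
    by blast
  then show ?case
    using step assms(3)
    by (intro exI[of _ "vs @ [z]"]) (auto simp: walk_def successively_append_iff)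
qed

lemma linked_walk:
  assumes "linked Z" "Z \<subseteq> V" "x \<in> Z" "y \<in> Z"
  obtains vs where "walk vs" "hd vs = x" "last vs = y" "set vs \<subseteq> Z"
  using rtranclp_walk[of Z x y] assms by (auto simp: linked_def)

lemma successively_rtranclp:
  assumes "successively E vs" "set vs \<subseteq> Z" "x \<in> set vs"
  shows "(\<lambda>x y. E x y \<and> x \<in> Z \<and> y \<in> Z)\<^sup>*\<^sup>* (hd vs) x"
  using assms
proof (induction vs rule: induct_list012)
  case (3 a b zs)
  show ?case
  proof (cases "x = a")
    case False
    then have "(\<lambda>x y. E x y \<and> x \<in> Z \<and> y \<in> Z)\<^sup>*\<^sup>* b x"
      using 3 by auto
    then show ?thesis
      using 3 by (auto intro: converse_rtranclp_into_rtranclp)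
  qed simp
qed auto

lemma linkedI_base:
  assumes "\<And>x. x \<in> Z \<Longrightarrow> (\<lambda>x y. E x y \<and> x \<in> Z \<and> y \<in> Z)\<^sup>*\<^sup>* r x"
  shows "linked Z"
proof -
  let ?R = "\<lambda>x y. E x y \<and> x \<in> Z \<and> y \<in> Z"
  have "symp ?R"
    using E_sym by (auto intro: sympI)
  then have "symp ?R\<^sup>*\<^sup>*"
    by (rule symp_rtranclp)
  then show ?thesis
    unfolding linked_def using assms by (meson rtranclp_trans sympD)
qed

lemma linked_path: "successively E vs \<Longrightarrow> linked (set vs)"
  using linkedI_base[of "set vs" "hd vs"] successively_rtranclp[of vs "set vs"] by blast

lemma linked_Un:
  assumes "linked Z" "successively E (z # vs)" "z \<in> Z"
  shows "linked (Z \<union> set vs)"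
proof (rule linkedI_base)
  let ?R = "\<lambda>Z x y. E x y \<and> x \<in> Z \<and> y \<in> Z"
  fix x assume "x \<in> Z \<union> set vs"
  then consider "x \<in> Z" | "x \<in> set (z # vs)"
    by auto
  then show "(?R (Z \<union> set vs))\<^sup>*\<^sup>* z x"
  proof cases
    case 1
    then have "(?R Z)\<^sup>*\<^sup>* z x"
      using assms by (auto simp: linked_def)
    then show ?thesis
      by (rule rtranclp_mono[THEN predicate2D, rotated]) auto
  next
    case 2
    then show ?thesis
      using successively_rtranclp[of "z # vs" "Z \<union> set vs" x] assms by auto
  qed
qed

text \<open>A walk inside \<open>Z\<close> permutes \<open>Z\<close> and takes its start to its end,
  so conjugation with it carries the tokens on \<open>Z - {u}\<close> to those on
  \<open>Z - {w}\<close>.\<close>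

lemma full_move:
  assumes Z: "linked Z" "Z \<subseteq> V" and u: "u \<in> Z" "full u (Z - {u})" and w: "w \<in> Z"
  shows "full w (Z - {w})"
proof -
  obtain vs where vs: "walk vs" "hd vs = u" "last vs = w" "set vs \<subseteq> Z"
    using linked_walk[OF Z u(1) w] .
  have p: "wperm vs permutes Z"
    using vs(4) by (rule wperm_permutes)
  have "wperm vs u = w"
    using wperm_hd[of vs] vs by (auto simp: walk_def)
  then have "wperm vs ` (Z - {u}) = Z - {w}"
    using permutes_image[OF p] permutes_inj[OF p] by (simp add: image_set_diff)
  then show ?thesis
    using full_transport[OF vs(1-3) u(2)] by simp
qed

text \<open>A path to a vertex outside leaves \<open>Z\<close> at \<open>x\<close>. A second path
  returns from the first outside vertex while avoiding \<open>x\<close>, so the vertex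
  \<open>y\<close> where it enters \<open>Z\<close> again is a different one.\<close>

lemma ear_exists:
  assumes Z: "Z \<subset> V" "card Z \<ge> 2"
  obtains x es y where "x \<in> Z" "y \<in> Z" "x \<noteq> y" "es \<noteq> []" "distinct es" "set es \<subseteq> V - Z"
    "successively E (x # es @ [y])"
proof -
  obtain b where b: "b \<in> V" "b \<notin> Z"
    using Z by blast
  have "\<not> (\<forall>a \<in> Z. \<forall>b \<in> Z. a = b)"
    using Z card_le_Suc0_iff_eq[of Z] finite_V finite_subset[of Z V] by force
  then obtain a c where ac: "a \<in> Z" "c \<in> Z" "a \<noteq> c"
    by blast
  obtain vs where vs: "vs \<noteq> []" "successively E vs" "hd vs = a" "last vs = b"
    using avoiding_path[of a b c] ac b Z by blast
  have "\<exists>x \<in> set vs. x \<notin> Z"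
    using vs b last_in_set by blast
  then obtain ys e zs where ys: "vs = ys @ e # zs" "e \<notin> Z" "\<forall>y \<in> set ys. y \<in> Z"
    using split_list_first_prop[of vs "\<lambda>x. x \<notin> Z"] by blast
  have "ys \<noteq> []"
    using ys vs ac by auto
  then have x: "last ys \<in> Z" "E (last ys) e"
    using ys vs by (auto simp: successively_append_iff)
  let ?x = "last ys"
  obtain y' where y': "y' \<in> Z" "y' \<noteq> ?x"
    using ac by blast
  have "e \<in> V"
    using x E_sym E_V by blast
  then obtain ws where ws: "ws \<noteq> []" "successively E ws" "distinct ws" "hd ws = e" "last ws = y'"
    "?x \<notin> set ws"
    using avoiding_path[of e y' ?x] y' Z x ys(2) by (metis psubsetD)
  have "\<exists>x \<in> set ws. x \<in> Z"
    using ws y' last_in_set by blast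
  then obtain es y us where es: "ws = es @ y # us" "y \<in> Z" "\<forall>x \<in> set es. x \<notin> Z"
    using split_list_first_prop[of ws "\<lambda>x. x \<in> Z"] by blast
  have ne: "es \<noteq> []" "hd es = e"
    using es ws ys by (cases es, auto)+
  have s: "successively E (es @ [y])"
    using ws(2) es(1) by (auto simp: successively_append_iff)
  have "w \<in> V" if w: "w \<in> set es" for w
  proof -
    obtain as bs where "es = as @ w # bs"
      using w by (meson split_list)
    then have "\<exists>v. E w v"
      using s by (cases bs) (auto simp: successively_append_iff)
    then show ?thesis
      using E_V by blast
  qed
  then have "set es \<subseteq> V - Z"
    using es by blast
  moreover have "successively E (?x # es @ [y])"
    using s ne x(2) by (cases es) auto
  ultimately show thesis
    using that[of ?x y es] x es ws ne by auto
qed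

text \<open>A maximal full set \<open>M\<close> containing \<open>Z - {x}\<close> is a block. The
  closed walk along the ear from \<open>x\<close> to \<open>y\<close> and back through
  \<open>Z\<close> keeps some token inside \<open>M\<close>, hence preserves \<open>M\<close>. It
  moves the token at \<open>y\<close> to the neighbouring ear vertex and the ear tokens one place
  further towards \<open>x\<close>, so the whole ear lies in \<open>M\<close>. The bound on
  \<open>card Z\<close> provides three tokens for the block argument.\<close>

lemma full_ear:
  assumes Z: "linked Z" "Z \<subseteq> V" "card Z \<ge> 4"
    and full: "\<And>u. u \<in> Z \<Longrightarrow> full u (Z - {u})"
    and ear: "x \<in> Z" "y \<in> Z" "x \<noteq> y" "es \<noteq> []" "distinct es" "set es \<subseteq> V - Z"
      "successively E (x # es @ [y])"
  shows "linked (Z \<union> set es)" and "u \<in> Z \<union> set es \<Longrightarrow> full u (Z \<union> set es - {u})"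
proof -
  let ?Z = "Z \<union> set es"
  have fin: "finite Z"
    using Z finite_V finite_subset by blast
  have "successively E (x # es)"
    using ear(7) by (auto simp: successively_append_iff simp flip: append_Cons)
  then show linked': "linked ?Z"
    using linked_Un[OF Z(1) _ ear(1)] by blast
  interpret G: perm_group "V - {x}" "grp x"
    using perm_group_grp ear Z by blast
  have "card (Z - {x}) \<ge> 3"
    using Z(3) ear(1) fin by simp
  then obtain M where M: "Z - {x} \<subseteq> M" "M \<subseteq> V - {x}" "full x M"
    "\<forall>g \<in> grp x. g ` M \<inter> M \<noteq> {} \<longrightarrow> g ` M = M"
    by (rule G.full_maximal[OF full[OF ear(1)]]) (use Z(2) in auto)
  obtain ws where ws: "walk ws" "hd ws = y" "last ws = x" "set ws \<subseteq> Z"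
    using linked_walk[OF Z(1,2) ear(2,1)] .
  let ?c = "x # es @ [y]"
  have c: "walk ?c"
    using ear Z by (auto simp: walk_def)
  obtain us where us: "walk us" "hd us = x" "last us = x" "wperm us = wperm ws \<circ> wperm ?c"
    by (rule walk_compose[OF c ws(1)]) (use ws in auto)
  let ?g = "wperm us"
  have g: "?g \<in> grp x"
    using grpI us by blast
  have dc: "distinct ?c"
    using ear by auto
  from map_wperm[OF this] have rot: "wperm ?c y # map (wperm ?c) (rev es) = rev es @ [x]"
    by simp
  have pws: "wperm ws permutes Z"
    using ws(4) by (rule wperm_permutes)
  have "\<not> Z \<subseteq> {x, y}"
    using card_mono[of "{x, y}" Z] Z(3) card_insert_le_m1[of 2 "{y}" x] by auto
  then obtain z where z: "z \<in> Z" "z \<noteq> x" "z \<noteq> y"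
    by blast
  \<comment> \<open>\<open>z\<close> is not on the ear, so only the return path moves it, and that
    path stays inside \<open>Z\<close>.\<close>
  have "wperm ?c z = z"
    using z ear by (intro wperm_outside) auto
  then have gz: "?g z = wperm ws z"
    using us by simp
  moreover have "wperm ws y = x"
    using ws wperm_hd[of ws] by (auto simp: walk_def)
  then have "wperm ws z \<noteq> x"
    using z permutes_inj[OF pws] by (metis injD)
  ultimately have "?g z \<in> Z - {x}"
    using permutes_in_image[OF pws] z by auto
  then have "?g ` M \<inter> M \<noteq> {}"
    using M(1) z by blast
  then have gM: "?g ` M = M"
    using M(4) g by blast
  have gin: "?g m \<in> M" if "m \<in> M" for m
    using imageI[OF that, of ?g] unfolding gM .
  have "rev es ! i \<in> M" if "i < length es" for i
    using that
  proof (induction i)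
    case 0
    have y: "wperm ?c y = rev es ! 0"
      using arg_cong[OF rot, of "\<lambda>l. l ! 0"] ear(4) by (simp add: nth_append)
    moreover have "wperm ws (rev es ! 0) = rev es ! 0"
      using 0 ear(6) ws(4) nth_mem[of 0 "rev es"] by (intro wperm_outside) auto
    ultimately have "?g y = rev es ! 0"
      using us by simp
    moreover have "y \<in> M"
      using M(1) ear(2,3) by auto
    ultimately show ?case
      using gin[of y] by simp
  next
    case (Suc i)
    have "wperm ?c (rev es ! i) = rev es ! Suc i"
      using arg_cong[OF rot, of "\<lambda>l. l ! Suc i"] Suc.prems by (simp add: nth_append)
    moreover have "wperm ws (rev es ! Suc i) = rev es ! Suc i"
      using Suc.prems ear(6) ws(4) nth_mem[of "Suc i" "rev es"] by (intro wperm_outside) auto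
    ultimately have "?g (rev es ! i) = rev es ! Suc i"
      using us by simp
    then show ?case
      using gin[of "rev es ! i"] Suc by simp
  qed
  then have "set (rev es) \<subseteq> M"
    unfolding in_set_conv_nth subset_iff by auto
  then have "set es \<subseteq> M"
    by simp
  then have "?Z - {x} \<subseteq> M"
    using M(1) by blast
  then have fx: "full x (?Z - {x})"
    using G.full_subset[OF M(3)] by blast
  show "full u (?Z - {u})" if "u \<in> ?Z"
    using full_move[OF linked' _ _ fx that] Z(2) ear(1,6) by auto
qed

lemma full_extend:
  assumes "linked Z" "Z \<subseteq> V" "card Z \<ge> 4" "u \<in> Z" "full u (Z - {u})" and w: "w \<in> V"
  shows "full w (V - {w})"
proof -
  have "\<forall>u \<in> V. full u (V - {u})"
    if "linked Z" "Z \<subseteq> V" "card Z \<ge> 4" "\<forall>u \<in> Z. full u (Z - {u})" for Z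
    using that
  proof (induction "card (V - Z)" arbitrary: Z rule: less_induct)
    case less
    show ?case
    proof (cases "Z = V")
      case True
      then show ?thesis using less by blast
    next
      case False
      obtain x es y where ear: "x \<in> Z" "y \<in> Z" "x \<noteq> y" "es \<noteq> []" "distinct es"
        "set es \<subseteq> V - Z" "successively E (x # es @ [y])"
        by (rule ear_exists[of Z]) (use False less.prems in auto)
      have "V - (Z \<union> set es) \<subset> V - Z"
      proof
        show "V - (Z \<union> set es) \<noteq> V - Z"
          using ear(4,6) hd_in_set[OF ear(4)] by (metis DiffE Un_iff subsetD)
      qed blast
      then have "card (V - (Z \<union> set es)) < card (V - Z)"
        using finite_V by (intro psubset_card_mono) auto
      moreover have "card (Z \<union> set es) \<ge> 4"
        using less.prems(2,3) finite_V finite_subset[of Z V] card_mono[of "Z \<union> set es" Z] by auto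
      moreover have "linked (Z \<union> set es)"
        using full_ear(1)[OF less.prems(1-3) _ ear] less.prems(4) by simp
      moreover have "\<forall>u \<in> Z \<union> set es. full u (Z \<union> set es - {u})"
        using full_ear(2)[OF less.prems(1-3) _ ear] less.prems(4) by simp
      moreover have "Z \<union> set es \<subseteq> V"
        using less.prems(2) ear(6) by blast
      ultimately show ?thesis
        using less.hyps[of "Z \<union> set es"] by simp
    qed
  qed
  from this[OF assms(1-3)] show ?thesis
    using full_move[OF assms(1,2,4,5)] w by blast
qed

end

section \<open>Theta graphs\<close>

lemma cycle_of_list_swap_append:
  assumes "distinct (xs @ ys)"
  shows "cycle_of_list (xs @ ys) = cycle_of_list (ys @ xs)"
  using cycle_of_list_rotate_independent[OF assms, of "length xs"] by (simp add: rotate_append)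

text \<open>The final move back to \<open>u\<close> multiplies the long cycle on
  \<open>u # xs\<close> by a transposition that splits off \<open>u\<close> and leaves the rotation
  of the tokens on \<open>xs\<close>.\<close>

lemma wperm_closed:
  assumes "distinct (u # xs)" "xs \<noteq> []"
  shows "wperm (u # xs @ [u]) = cycle_of_list (rev xs)"
proof -
  obtain z zs where z: "rev xs = z # zs"
    using assms(2) by (metis neq_Nil_conv rev_is_Nil_conv)
  have "distinct (u # z # zs)"
    using assms(1) z by (metis distinct.simps(2) distinct_rev set_rev)
  then have "cycle_of_list (z # zs @ [u]) = cycle_of_list (u # z # zs)"
    using cycle_of_list_swap_append[of "z # zs" "[u]"] by auto
  then have "cycle_of_list (u # z # zs @ [u]) = cycle_of_list (z # zs)"
    by (simp add: o_assoc)
  then show ?thesis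
    using z by (simp add: wperm_def)
qed

lemma wperm_map:
  assumes "inj_on f S" "set ws \<subseteq> S" "i \<in> S"
  shows "wperm (map f ws) (f i) = f (wperm ws i)"
  using assms(2,3)
proof (induction ws arbitrary: i rule: induct_list012)
  case (3 x y zs)
  have "Transposition.transpose (f x) (f y) (f i) = f (Transposition.transpose x y i)"
    using assms(1) 3 by (auto simp: Transposition.transpose_def inj_on_def)
  moreover have "Transposition.transpose x y i \<in> S"
    using 3 by (auto simp: Transposition.transpose_def)
  ultimately show ?case
    using 3 by (simp add: wperm_Cons_Cons)
qed auto

text \<open>Lets a 3-cycle found for a concrete list of indices be checked by evaluation on numerals
  and then transferred to the vertices of a graph.\<close>

lemma wperm_nth_cyc3:
  assumes xs: "distinct xs" and ws: "list_all (\<lambda>i. i < length xs) ws"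
    and eq: "map (wperm ws) [0..<length xs] = map (cyc3 a b c) [0..<length xs]"
    and abc: "list_all (\<lambda>i. i < length xs) [a, b, c]" "distinct [a, b, c]"
  shows "wperm (map ((!) xs) ws) = cyc3 (xs ! a) (xs ! b) (xs ! c)"
proof
  fix x
  have inj: "inj_on ((!) xs) {..<length xs}"
    using xs by (auto simp: inj_on_def nth_eq_iff_index_eq)
  have d: "xs ! a \<noteq> xs ! b" "xs ! a \<noteq> xs ! c" "xs ! b \<noteq> xs ! c"
    using abc xs by (auto simp: nth_eq_iff_index_eq)
  show "wperm (map ((!) xs) ws) x = cyc3 (xs ! a) (xs ! b) (xs ! c) x"
  proof (cases "x \<in> set xs")
    case True
    then obtain i where i: "i < length xs" "x = xs ! i"
      by (metis in_set_conv_nth)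
    have "wperm (map ((!) xs) ws) x = xs ! wperm ws i"
      using wperm_map[OF inj, of ws i] ws i by (auto simp: list_all_iff)
    also have "\<dots> = xs ! cyc3 a b c i"
      using arg_cong[OF eq, of "\<lambda>l. l ! i"] i by simp
    also have "\<dots> = cyc3 (xs ! a) (xs ! b) (xs ! c) x"
      using i abc xs d by (auto simp: cyc3_apply nth_eq_iff_index_eq)
    finally show ?thesis .
  next
    case False
    then have "x \<notin> set (map ((!) xs) ws)" "x \<noteq> xs ! a" "x \<noteq> xs ! b" "x \<noteq> xs ! c"
      using ws abc by (auto simp: list_all_iff)
    then show ?thesis
      using d by (simp add: wperm_outside cyc3_apply)
  qed
qed

text \<open>The two involutions share only \<open>c\<close>. The transpositions
  \<open>(x x1)\<close> and \<open>(z z1)\<close> commute with everything else and cancel in the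
  square; the rest is the square of the 3-cycle \<open>(c y)(c y')\<close>.\<close>

lemma double_transpositions_cyc3:
  assumes "distinct [x, x1, y, z, z1, y', c]"
  defines "s \<equiv> Transposition.transpose x x1 \<circ> Transposition.transpose c y"
    and "s' \<equiv> Transposition.transpose z z1 \<circ> Transposition.transpose c y'"
  shows "(s \<circ> s') \<circ> (s \<circ> s') = cyc3 c y y'"
proof -
  let ?r = "s \<circ> s'"
  note d = assms(1)[simplified]
  have r: "?r x = x1" "?r x1 = x" "?r z = z1" "?r z1 = z" "?r c = y'" "?r y' = y" "?r y = c"
    unfolding s_def s'_def o_apply using d by auto
  have r': "?r i = i" if "i \<notin> {x, x1, y, z, z1, y', c}" for i
    unfolding s_def s'_def o_apply using that by auto
  have "cyc3 c y y' i = (if i = c then y else if i = y then y' else if i = y' then c else i)" for i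
    using d by (intro cyc3_apply) auto
  moreover have "?r (?r i) = (if i = c then y else if i = y then y' else if i = y' then c else i)" for i
    using r r'[of i] d by (cases "i \<in> {x, x1, y, z, z1, y', c}") auto
  ultimately show ?thesis
    by (simp add: fun_eq_iff)
qed

text \<open>\<open>q\<close> shifts the common part \<open>w # B\<close> by one place and fixes
  \<open>A\<close>, so conjugation by \<open>q\<close> turns the cycle \<open>p\<close> into the one
  on \<open>B\<close>, \<open>hd C\<close>, \<open>A\<close>. Up to rotation both cycles are a
  transposition times the same cycle on \<open>B @ A\<close>, and this factor cancels in the
  quotient.\<close>

lemma cycle_commutator:
  assumes d: "distinct (w # B @ A @ C)" and ne: "A \<noteq> []" "C \<noteq> []"
  defines "p \<equiv> cycle_of_list (w # B @ A)" and "q \<equiv> cycle_of_list (w # B @ C)"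
  shows "p \<circ> inv_into UNIV (q \<circ> p \<circ> inv_into UNIV q) =
    (if B = [] then cyc3 w (hd A) (hd C)
     else Transposition.transpose w (hd B) \<circ> Transposition.transpose (hd C) (hd A))"
proof -
  obtain a A' c C' where A: "A = a # A'" and C: "C = c # C'"
    using ne by (metis neq_Nil_conv)
  have bij: "bij p" "bij q" "bij (cycle_of_list X)" for X :: "'a list"
    unfolding p_def q_def using cycle_permutes permutes_bij by metis+
  have dp: "distinct (w # B @ A)" and dq: "distinct (w # B @ C)"
    using d by auto
  have "map q (w # B @ C) = rotate1 (w # B @ C)"
    unfolding q_def using cyclic_rotation[OF dq, of 1] by simp
  then have "map q (w # B) @ map q C = B @ [c] @ C' @ [w]"
    by (simp add: C)
  then have qB: "map q (w # B) = B @ [c]"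
    by (subst (asm) append_assoc[symmetric], subst (asm) append_eq_append_conv) auto
  have "q x = x" if "x \<in> set A" for x
    using d that unfolding q_def by (intro id_outside_supp) auto
  then have qA: "map q A = A"
    by (simp add: map_idI)
  have "q \<circ> p \<circ> inv_into UNIV q = cycle_of_list (map q (w # B @ A))"
    unfolding p_def by (rule conjugation_of_cycle[OF dp bij(2)])
  also have "map q (w # B @ A) = B @ c # A"
    using qA qB by simp
  finally have conj: "q \<circ> p \<circ> inv_into UNIV q = cycle_of_list (B @ c # A)" .
  have "cycle_of_list (B @ c # a # A') = cycle_of_list (c # a # A' @ B)"
    using cycle_of_list_swap_append[of B "c # a # A'"] d A C by auto
  also have "\<dots> = Transposition.transpose c a \<circ> cycle_of_list (a # A' @ B)"
    by simp
  also have "cycle_of_list (a # A' @ B) = cycle_of_list (B @ A)"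
    using cycle_of_list_swap_append[of "a # A'" B] d A C by auto
  finally have "cycle_of_list (B @ c # a # A') = Transposition.transpose c a \<circ> cycle_of_list (B @ A)" .
  then have 1: "q \<circ> p \<circ> inv_into UNIV q = Transposition.transpose c a \<circ> cycle_of_list (B @ A)"
    unfolding conj A .
  have 2: "p = Transposition.transpose w (hd (B @ A)) \<circ> cycle_of_list (B @ A)"
    unfolding p_def using A by (cases B) auto
  have 3: "cycle_of_list (B @ A) \<circ> inv_into UNIV (cycle_of_list (B @ A)) = id"
    using bij(3)[of "B @ A"] surj_iff bij_is_surj by blast
  have "p \<circ> inv_into UNIV (q \<circ> p \<circ> inv_into UNIV q) =
    Transposition.transpose w (hd (B @ A)) \<circ>
      (cycle_of_list (B @ A) \<circ> inv_into UNIV (cycle_of_list (B @ A))) \<circ> Transposition.transpose c a"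
    unfolding 1 by (subst 2) (simp add: o_inv_distrib bij(3) comp_assoc)
  also have "\<dots> = Transposition.transpose w (hd (B @ A)) \<circ> Transposition.transpose c a"
    unfolding 3 by simp
  finally show ?thesis
    using A C by (simp add: cyc3_def transpose_commute)
qed

context puzzle
begin

text \<open>By \<open>full_imp_alternating\<close> this says that every \<open>grp w\<close>
  contains the alternating group on \<open>V - {w}\<close>.\<close>

definition wilson :: bool where
  "wilson \<longleftrightarrow> (\<forall>w \<in> V. full w (V - {w}))"

lemma wilsonI:
  assumes "linked Z" "Z \<subseteq> V" "card Z \<ge> 4" "u \<in> Z" "full u (Z - {u})"
  shows wilson
  unfolding wilson_def using full_extend[OF assms] by blast

text \<open>The four vertices meet the size bound of \<open>full_extend\<close>, so a single 3-cycle
  whose support is linked with the empty vertex is enough to start attaching ears.\<close>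

lemma wilson_cyc3:
  assumes c: "cyc3 a b c \<in> grp u" and d: "distinct [u, a, b, c]" and l: "linked {u, a, b, c}"
    and V: "{u, a, b, c} \<subseteq> V"
  shows wilson
proof -
  have u: "u \<in> V"
    using V by simp
  interpret G: perm_group "V - {u}" "grp u"
    by (rule perm_group_grp[OF u])
  have "{u, a, b, c} - {u} = {a, b, c}"
    using d by auto
  moreover have "full u {a, b, c}"
    by (rule G.full_triple[OF c]) (use d in auto)
  moreover have "card {u, a, b, c} \<ge> 4"
    using d by simp
  ultimately show wilson
    using wilsonI[OF l V, of u] by simp
qed

definition cyc :: "'v list \<Rightarrow> bool" where
  "cyc cs \<longleftrightarrow> distinct cs \<and> length cs \<ge> 3 \<and> successively E cs \<and> E (last cs) (hd cs)"

text \<open>Three paths from \<open>x\<close> to \<open>y\<close>, given by their lists of interior vertices.\<close>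

definition theta :: "'v \<Rightarrow> 'v \<Rightarrow> 'v list \<Rightarrow> 'v list \<Rightarrow> 'v list \<Rightarrow> bool" where
  "theta x y A B C \<longleftrightarrow> distinct (x # y # A @ B @ C) \<and> successively E (x # A @ [y]) \<and>
     successively E (x # B @ [y]) \<and> successively E (x # C @ [y])"

lemma theta_commute:
  assumes "theta x y A B C"
  shows "theta x y B A C" "theta x y A C B" "theta x y C B A"
  using assms by (auto simp: theta_def)

lemma successively_E_rev [simp]: "successively E (rev xs) \<longleftrightarrow> successively E xs"
proof -
  have eq: "(\<lambda>x y. E y x) = E"
    using E_sym by blast
  show ?thesis
    using successively_rev[of E xs] unfolding eq .
qed

lemma successively_V: "successively E xs \<Longrightarrow> length xs \<ge> 2 \<Longrightarrow> set xs \<subseteq> V"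
proof (induction xs rule: induct_list012)
  case (3 x y zs)
  then show ?case
    using E_V E_sym by (cases zs) auto
qed auto

lemma theta_V:
  assumes "theta x y A B C"
  shows "set (x # y # A @ B @ C) \<subseteq> V"
  using assms successively_V[of "x # A @ [y]"] successively_V[of "x # B @ [y]"]
    successively_V[of "x # C @ [y]"] by (auto simp: theta_def)

lemma cyc_V: "cyc cs \<Longrightarrow> set cs \<subseteq> V"
  using successively_V[of cs] by (auto simp: cyc_def)

lemma theta_cyc:
  assumes "theta x y A B C" "length A + length B \<ge> 1"
  shows "cyc (x # A @ y # rev B)"
proof -
  have "successively E (y # rev B @ [x])"
    using assms(1) successively_E_rev[of "x # B @ [y]"] by (auto simp: theta_def)
  then have "successively E (y # rev B)" "E (last (y # rev B)) x"
    by (auto simp: successively_append_iff simp flip: append_Cons)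
  then show ?thesis
    using assms by (auto simp: cyc_def theta_def successively_append_iff simp flip: append_Cons)
qed

text \<open>Walking out along \<open>B\<close> and back along \<open>A\<close> rotates the tokens of
  both paths and of \<open>w\<close>. The cycle is written with \<open>w # rev B\<close> in front so
  that two cycles through the same \<open>B\<close> share a prefix, as
  \<open>cycle_commutator\<close> expects.\<close>

lemma theta_cycle_mem_grp:
  assumes t: "theta u w A B C" and ne: "A @ B \<noteq> []"
  shows "cycle_of_list (w # rev B @ A) \<in> grp u"
proof -
  let ?ws = "u # (B @ w # rev A) @ [u]"
  have "successively E (u # B @ [w])" "successively E (w # rev A @ [u])"
    using t successively_E_rev[of "u # A @ [w]"] by (auto simp: theta_def)
  then have "successively E ?ws"
    by (auto simp: successively_append_iff simp flip: append_Cons)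
  then have "walk ?ws"
    using theta_V[OF t] by (auto simp: walk_def)
  then have "wperm ?ws \<in> grp u"
    by (rule grpI) simp_all
  moreover have "wperm ?ws = cycle_of_list (A @ w # rev B)"
    using wperm_closed[of u "B @ w # rev A"] t by (auto simp: theta_def)
  moreover have "cycle_of_list (A @ w # rev B) = cycle_of_list (w # rev B @ A)"
    using cycle_of_list_swap_append[of A "w # rev B"] t by (auto simp: theta_def)
  ultimately show ?thesis by simp
qed

lemma theta_commutator_mem_grp:
  assumes t: "theta u w A B C" and ne: "A \<noteq> []" "C \<noteq> []"
  shows "(if B = [] then cyc3 w (hd A) (hd C)
     else Transposition.transpose w (last B) \<circ> Transposition.transpose (hd C) (hd A)) \<in> grp u"
proof -
  have u: "u \<in> V"
    using theta_V[OF t] by simp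
  interpret G: perm_group "V - {u}" "grp u"
    by (rule perm_group_grp[OF u])
  let ?p = "cycle_of_list (w # rev B @ A)" and ?q = "cycle_of_list (w # rev B @ C)"
  have "?p \<in> grp u"
    using theta_cycle_mem_grp[OF t] ne by simp
  moreover have "?q \<in> grp u"
    using theta_cycle_mem_grp[of u w C B A] theta_commute(3)[OF t] ne by simp
  ultimately have "?p \<circ> inv_into UNIV (?q \<circ> ?p \<circ> inv_into UNIV ?q) \<in> grp u"
    by (intro G.comp_mem G.inv_mem)
  moreover have "distinct (w # rev B @ A @ C)"
    using t by (auto simp: theta_def)
  ultimately show ?thesis
    using cycle_commutator[of w "rev B" A C] ne by (cases "B = []") (simp_all add: hd_rev)
qed

text \<open>With the edge from \<open>u\<close> to \<open>w\<close> as shared path the commutator is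
  a 3-cycle, and its three points are neighbours of \<open>u\<close>, hence linked with it.\<close>

lemma wilson_chord:
  assumes t: "theta u w A [] C" and ne: "A \<noteq> []" "C \<noteq> []"
  shows wilson
proof (rule wilson_cyc3)
  show "cyc3 w (hd A) (hd C) \<in> grp u"
    using theta_commutator_mem_grp[OF t ne] by simp
  obtain a A' c C' where A: "A = a # A'" and C: "C = c # C'"
    using ne by (metis neq_Nil_conv)
  show d: "distinct [u, w, hd A, hd C]" and "{u, w, hd A, hd C} \<subseteq> V"
    using t theta_V[OF t] A C by (auto simp: theta_def)
  have "E u w" "E u a" "E u c"
    using t A C by (auto simp: theta_def)
  then show "linked {u, w, hd A, hd C}"
    using A C by (intro linkedI_base[of _ u]) (auto intro: r_into_rtranclp)
qed

text \<open>Going round a 4-cycle rotates three tokens, which is a 3-cycle without any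
  commutator.\<close>

lemma wilson_square:
  assumes "cyc [u, a, b, c]"
  shows wilson
proof (rule wilson_cyc3)
  have E: "E u a" "E a b" "E b c" "E c u" and d: "distinct [u, a, b, c]"
    using assms by (auto simp: cyc_def)
  have V: "{u, a, b, c} \<subseteq> V"
    using cyc_V[OF assms] by auto
  have "walk [u, a, b, c, u]"
    using E V by (simp add: walk_def)
  then have "wperm [u, a, b, c, u] \<in> grp u"
    by (rule grpI) simp_all
  moreover have "wperm [u, a, b, c, u] = cyc3 c b a"
    using wperm_closed[of u "[a, b, c]"] d by (simp add: cyc3_def)
  ultimately show "cyc3 c b a \<in> grp u" by simp
  show "distinct [u, c, b, a]" "{u, c, b, a} \<subseteq> V"
    using d V by auto
  have "successively E [u, a, b, c]"
    using E by simp
  from linked_path[OF this] show "linked {u, c, b, a}"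
    by (simp add: insert_commute)
qed

text \<open>
  The commutator \<open>t\<close> of the two cycles swaps two tokens of \<open>A \<union> B \<union> {w}\<close> and swaps a third one
  with the first token \<open>c\<close> of \<open>C\<close>. If the conjugate \<open>t'\<close> of \<open>t\<close> by the \<open>i\<close>-th power of the rotation of
  \<open>A \<union> B \<union> {w}\<close> only shares \<open>c\<close> with \<open>t\<close>, then \<open>(t t')\<^sup>2\<close> is a 3-cycle.
\<close>

lemma wilson_shift:
  assumes t: "theta u w A B C" and ne: "A \<noteq> []" "B \<noteq> []" "C \<noteq> []"
  defines "l \<equiv> length A + length B + 1" and "b \<equiv> length B"
  assumes i: "{i, (i + 1) mod l, (i + 1 + b) mod l} \<inter> {0, 1, 1 + b} = {}" and il: "i < l"
  shows wilson
proof -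
  have u: "u \<in> V"
    using theta_V[OF t] by simp
  interpret G: perm_group "V - {u}" "grp u"
    by (rule perm_group_grp[OF u])
  define Y where "Y = w # rev B @ A"
  define p where "p = cycle_of_list Y"
  obtain c C' where C: "C = c # C'"
    using ne by (meson neq_Nil_conv)
  have dY: "distinct Y" and lY: "length Y = l" and c: "c \<notin> set Y" "c \<noteq> u" "u \<notin> set Y"
    using t C by (auto simp: theta_def Y_def l_def)
  have bl: "1 + b < l" "0 < b"
    using ne by (auto simp: b_def l_def)
  have p: "p \<in> grp u"
    using theta_cycle_mem_grp[OF t] ne by (simp add: p_def Y_def)
  have bij: "bij (p ^^ k)" for k
    using G.bij_mem[OF p] by (induction k) (auto intro: bij_comp)
  have pk: "p ^^ k \<in> grp u" for k
    using p G.id_mem by (induction k) (auto intro: G.comp_mem)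
  have pY: "(p ^^ k) (Y ! j) = Y ! ((j + k) mod l)" if "j < l" for j k
  proof -
    have "map (p ^^ k) Y ! j = rotate k Y ! j"
      unfolding p_def using cyclic_rotation[OF dY] by simp
    then show ?thesis
      using that lY by (simp add: nth_rotate add.commute)
  qed
  have pc: "(p ^^ k) c = c" for k
    using c(1) unfolding p_def by (induction k) (simp_all add: id_outside_supp)
  \<comment> \<open>On the list \<open>Y\<close> the commutator swaps positions 0 and 1 and
    exchanges \<open>c\<close> with position \<open>1 + b\<close>, the first vertex of
    \<open>A\<close>.\<close>
  define t0 where "t0 = Transposition.transpose (Y ! 0) (Y ! 1) \<circ> Transposition.transpose c (Y ! (1 + b))"
  have Y: "Y ! 0 = w" "Y ! 1 = last B" "Y ! (1 + b) = hd A"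
    using ne by (auto simp: Y_def b_def nth_append hd_rev[symmetric] hd_conv_nth)
  then have "t0 \<in> grp u"
    using theta_commutator_mem_grp[OF t ne(1,3)] ne(2) C by (simp add: t0_def)
  moreover have "p ^^ i \<circ> t0 \<circ> inv_into UNIV (p ^^ i) =
    Transposition.transpose (Y ! i) (Y ! ((i + 1) mod l)) \<circ>
    Transposition.transpose c (Y ! ((i + 1 + b) mod l))" (is "_ = ?t1")
  proof
    fix x
    have *: "(p ^^ i) (Transposition.transpose x y z) =
      Transposition.transpose ((p ^^ i) x) ((p ^^ i) y) ((p ^^ i) z)" for x y z
      using bij[of i] by (auto simp: Transposition.transpose_def bij_is_inj inj_eq)
    have "(p ^^ i) (inv_into UNIV (p ^^ i) x) = x"
      using bij[of i] by (simp add: bij_is_surj surj_f_inv_f)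
    moreover have "(p ^^ i) (Y ! 0) = Y ! i" "(p ^^ i) (Y ! 1) = Y ! ((i + 1) mod l)"
      "(p ^^ i) (Y ! (1 + b)) = Y ! ((i + 1 + b) mod l)"
      using pY[of 0 i] pY[of 1 i] pY[of "1 + b" i] bl il by (simp_all add: ac_simps)
    ultimately show "(p ^^ i \<circ> t0 \<circ> inv_into UNIV (p ^^ i)) x = ?t1 x"
      by (simp only: o_apply t0_def * pc)
  qed
  ultimately have "(t0 \<circ> ?t1) \<circ> (t0 \<circ> ?t1) \<in> grp u"
    using G.comp_mem G.inv_mem pk by metis
  moreover have "(t0 \<circ> ?t1) \<circ> (t0 \<circ> ?t1) = cyc3 c (Y ! (1 + b)) (Y ! ((i + 1 + b) mod l))"
    unfolding t0_def
  proof (rule double_transpositions_cyc3)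
    let ?js = "[0, 1, 1 + b, i, (i + 1) mod l, (i + 1 + b) mod l]"
    have "(i + 1) mod l = (if i + 1 < l then i + 1 else 0)"
      "(i + 1 + b) mod l = (if i + 1 + b < l then i + 1 + b else i + 1 + b - l)"
      using il bl by (auto simp: mod_if)
    then have "(i + 1) mod l \<noteq> i" "(i + 1 + b) mod l \<noteq> i" "(i + 1) mod l \<noteq> (i + 1 + b) mod l"
      using il bl by (auto split: if_splits)
    then have "distinct ?js"
      using i bl by simp
    moreover have js: "set ?js \<subseteq> {..<l}"
      using il bl by simp
    moreover have inj: "inj_on ((!) Y) {..<l}"
      using dY lY by (auto simp: inj_on_def nth_eq_iff_index_eq)
    ultimately have "distinct (map ((!) Y) ?js)"
      using inj_on_subset[OF inj js] by (simp only: distinct_map)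
    moreover have "Y ! j \<noteq> c" if "j < l" for j
      using c(1) lY nth_mem[of j Y] that by auto
    then have "c \<notin> set (map ((!) Y) ?js)"
      using js by auto
    ultimately show "distinct [Y ! 0, Y ! 1, Y ! (1 + b), Y ! i, Y ! ((i + 1) mod l), Y ! ((i + 1 + b) mod l), c]"
      by auto
  qed
  ultimately have c3: "cyc3 c (Y ! (1 + b)) (Y ! ((i + 1 + b) mod l)) \<in> grp u" (is "cyc3 c ?y ?y' \<in> _")
    by simp
  have yy: "?y \<in> set Y" "?y' \<in> set Y" "?y \<noteq> ?y'"
    using i il bl lY dY by (auto simp: nth_eq_iff_index_eq)
  have cy: "c \<noteq> ?y" "c \<noteq> ?y'"
    using yy c(1) by auto
  have "full u {c, ?y, ?y'}"
    by (rule G.full_triple[OF c3 cy yy(3)])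
  moreover have "card {c, ?y, ?y'} \<ge> 3"
    using yy(3) cy by simp
  moreover have "{c, ?y, ?y'} \<subseteq> V - {u}"
    using yy c theta_V[OF t] C by (auto simp: Y_def)
  ultimately obtain M where M: "{c, ?y, ?y'} \<subseteq> M" "full u M"
    "\<forall>g \<in> grp u. g ` M \<inter> M \<noteq> {} \<longrightarrow> g ` M = M"
    using G.full_maximal[of "{c, ?y, ?y'}"] by metis
  \<comment> \<open>The powers of the rotation fix \<open>c\<close>, which lies in the block
    \<open>M\<close>, so they preserve \<open>M\<close>. The orbit of \<open>?y\<close> under them
    is all of \<open>Y\<close>.\<close>
  have "(p ^^ k) ?y \<in> M" for k
  proof -
    have "c = (p ^^ k) c"
      using pc by simp
    then have "(p ^^ k) ` M \<inter> M \<noteq> {}"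
      using M(1) by blast
    then have "(p ^^ k) ` M = M"
      using M(3) pk by blast
    then show ?thesis
      using M(1) by blast
  qed
  moreover have "\<exists>k. Y ! j = (p ^^ k) ?y" if "j < l" for j
    using pY[of "1 + b" "l - (1 + b) + j"] bl that by (intro exI[of _ "l - (1 + b) + j"]) simp
  ultimately have YM: "set Y \<subseteq> M"
    using lY by (metis in_set_conv_nth subsetI)
  have "successively E (u # B @ [w])" "successively E (w # rev A @ [u])" "E u c"
    using t C successively_E_rev[of "u # A @ [w]"] by (auto simp: theta_def)
  then have path: "successively E (u # B @ w # rev A)" "E u c"
    by (auto simp: successively_append_iff simp flip: append_Cons)
  have l: "linked (insert c (insert u (set Y)))"
  proof -
    have "linked (set (u # B @ w # rev A) \<union> set [c])"
      using linked_Un[OF linked_path[OF path(1)], of u "[c]"] path(2) by simp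
    moreover have "set (u # B @ w # rev A) \<union> set [c] = insert c (insert u (set Y))"
      by (auto simp: Y_def)
    ultimately show ?thesis by simp
  qed
  show wilson
  proof (rule wilsonI[OF l])
    show "insert c (insert u (set Y)) \<subseteq> V"
      using theta_V[OF t] C by (auto simp: Y_def)
    have "card (set Y) = l"
      using dY lY distinct_card by blast
    then show "card (insert c (insert u (set Y))) \<ge> 4"
      using c bl by simp
    have "insert c (insert u (set Y)) - {u} \<subseteq> M"
      using YM M(1) by auto
    then show "full u (insert c (insert u (set Y)) - {u})"
      using G.full_subset[OF M(2)] by blast
  qed simp
qed

text \<open>A shift works exactly when it is no difference of two elements of
  \<open>{0, 1, 1 + b}\<close> modulo \<open>l\<close>, that is, none of 0, 1, \<open>b\<close>,
  \<open>1 + b\<close> and their negatives. These are at most seven residues, so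
  \<open>l \<ge> 8\<close> leaves one. For two paths with three interior vertices they shrink to
  five residues modulo 7, and 2 is free.\<close>

lemma wilson_long:
  assumes t: "theta u w A B C" and ne: "A \<noteq> []" "B \<noteq> []" "C \<noteq> []"
    and len: "length A + length B \<ge> 7 \<or> length A = 3 \<and> length B = 3"
  shows wilson
proof -
  let ?l = "length A + length B + 1" and ?b = "length B"
  have pos: "length A \<ge> 1" "?b \<ge> 1"
    using ne by (auto simp: Suc_le_eq)
  have "\<exists>i < ?l. {i, (i + 1) mod ?l, (i + 1 + ?b) mod ?l} \<inter> {0, 1, 1 + ?b} = {}"
  proof (cases "length A = 3 \<and> length B = 3")
    case True
    then show ?thesis
      by (intro exI[of _ 2]) simp
  next
    case False
    \<comment> \<open>With \<open>a\<close> and \<open>b\<close> interior vertices on the two paths,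
      the excluded residues are 0, 1, \<open>a\<close>, \<open>a + 1\<close>, \<open>b\<close>,
      \<open>b + 1\<close> and \<open>a + b\<close>. The values 3, 4 and 2 avoid them when the
      smaller of \<open>a\<close> and \<open>b\<close> is 1, 2 or larger.\<close>
    define i where "i = (if ?b = 1 \<or> length A = 1 then 3 else if ?b = 2 \<or> length A = 2 then 4 else 2 :: nat)"
    have "{i, (i + 1) mod ?l, (i + 1 + ?b) mod ?l} \<inter> {0, 1, 1 + ?b} = {}" "i < ?l"
      using len False pos by (auto simp: i_def mod_if)
    then show ?thesis by blast
  qed
  then show ?thesis
    using wilson_shift[OF t ne] by blast
qed

text \<open>Here \<open>ws\<close> is a closed walk of the empty vertex, written in indices, and
  \<open>ps\<close> is a walk through exactly the support and the empty vertex, which certifies that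
  they are linked.\<close>

lemma wilson_word:
  assumes t: "theta u w A B C" and xs: "xs = u # w # A @ B @ C"
    and ws: "list_all (\<lambda>i. i < length xs) ws" "successively E (map ((!) xs) ws)"
      "ws \<noteq> []" "hd ws = 0" "last ws = 0"
    and eq: "map (wperm ws) [0..<length xs] = map (cyc3 a b c) [0..<length xs]"
    and abc: "list_all (\<lambda>i. i < length xs) [a, b, c]" "distinct [0, a, b, c]"
    and ps: "successively E (map ((!) xs) ps)" "set ps = {0, a, b, c}"
  shows wilson
proof -
  have d: "distinct xs" and V: "set xs \<subseteq> V"
    using t theta_V[OF t] by (auto simp: theta_def xs)
  have u: "xs ! 0 = u"
    by (simp add: xs)
  have "set (map ((!) xs) ws) \<subseteq> V"
    using ws(1) V by (auto simp: list_all_iff)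
  then have "walk (map ((!) xs) ws)"
    using ws(2,3) by (simp add: walk_def)
  then have "wperm (map ((!) xs) ws) \<in> grp u"
    using ws u by (intro grpI) (simp_all add: hd_map last_map)
  then have c: "cyc3 (xs ! a) (xs ! b) (xs ! c) \<in> grp u"
    using wperm_nth_cyc3[OF d ws(1) eq abc(1)] abc(2) by simp
  have set: "set (map ((!) xs) ps) = {u, xs ! a, xs ! b, xs ! c}"
    using ps(2) u by simp
  have l: "0 < length xs"
    by (simp add: xs)
  show wilson
  proof (rule wilson_cyc3[OF c])
    show "distinct [u, xs ! a, xs ! b, xs ! c]"
      using abc d l unfolding u[symmetric] by (simp add: nth_eq_iff_index_eq)
    show "linked {u, xs ! a, xs ! b, xs ! c}"
      using linked_path[OF ps(1)] set by simp
    show "{u, xs ! a, xs ! b, xs ! c} \<subseteq> V"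
      using abc(1) l V unfolding u[symmetric] by auto
  qed
qed

text \<open>
  The walks in the next five lemmas come from a breadth-first search for a 3-cycle whose support
  together with the empty vertex is connected. The vertices are numbered \<open>u, w\<close>, then \<open>A, B, C\<close>.
\<close>

lemma wilson_222:
  assumes t: "theta u w A B C" and l: "length A = 2" "length B = 2" "length C = 2"
  shows wilson
proof -
  obtain a1 a2 b1 b2 c1 c2 where eq: "A = [a1, a2]" "B = [b1, b2]" "C = [c1, c2]"
    using l by (auto simp: length_Suc_conv numeral_2_eq_2)
  have E: "E u a1" "E a1 a2" "E a2 w" "E u b1" "E b1 b2" "E b2 w" "E u c1" "E c1 c2" "E c2 w"
    using t by (auto simp: theta_def eq)
  show wilson
    by (rule wilson_word[OF t refl, where a = 6 and b = 1 and c = 7 and ps = "[0, 6, 7, 1]"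
        and ws = "[0,2,3,1,5,4,0,2,3,1,5,4,0,2,3,1,7,6,0,2,3,1,5,4,0,2,3,1,5,4,0,2,3,1,7,6,0]"])
      (use E E[THEN E_sym] in \<open>auto simp: eq wperm_step cyc3_apply upt_rec\<close>)
qed

lemma wilson_123:
  assumes t: "theta u w A B C" and l: "length A = 1" "length B = 2" "length C = 3"
  shows wilson
proof -
  obtain a1 b1 b2 c1 c2 c3 where eq: "A = [a1]" "B = [b1, b2]" "C = [c1, c2, c3]"
    using l by (auto simp: length_Suc_conv numeral_2_eq_2 numeral_3_eq_3)
  have E: "E u a1" "E a1 w" "E u b1" "E b1 b2" "E b2 w" "E u c1" "E c1 c2" "E c2 c3" "E c3 w"
    using t by (auto simp: theta_def eq)
  show wilson
    by (rule wilson_word[OF t refl, where a = 4 and b = 3 and c = 5 and ps = "[4, 3, 0, 5]"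
        and ws = "[0,2,1,4,3,0,2,1,7,6,5,0,2,1,4,3,0,2,1,7,6,5,0,2,1,4,3,0,2,1,7,6,5,0,3,4,1,7,6,5,0]"])
      (use E E[THEN E_sym] in \<open>auto simp: eq wperm_step cyc3_apply upt_rec\<close>)
qed

lemma wilson_124:
  assumes t: "theta u w A B C" and l: "length A = 1" "length B = 2" "length C = 4"
  shows wilson
proof -
  obtain a1 b1 b2 c1 c2 c3 c4 where eq: "A = [a1]" "B = [b1, b2]" "C = [c1, c2, c3, c4]"
    using l by (auto simp: length_Suc_conv eval_nat_numeral)
  have E: "E u a1" "E a1 w" "E u b1" "E b1 b2" "E b2 w" "E u c1" "E c1 c2" "E c2 c3" "E c3 c4" "E c4 w"
    using t by (auto simp: theta_def eq)
  show wilson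
    by (rule wilson_word[OF t refl, where a = 6 and b = 2 and c = 5 and ps = "[2, 0, 5, 6]"
        and ws = "[0,2,1,8,7,6,5,0,3,4,1,8,7,6,5,0,3,4,1,8,7,6,5,0,2,1,4,3,0,5,6,7,8,1,4,3,0,5,6,7,8,1,4,3,0]"])
      (use E E[THEN E_sym] in \<open>auto simp: eq wperm_step cyc3_apply upt_rec\<close>)
qed

lemma wilson_223:
  assumes t: "theta u w A B C" and l: "length A = 2" "length B = 2" "length C = 3"
  shows wilson
proof -
  obtain a1 a2 b1 b2 c1 c2 c3 where eq: "A = [a1, a2]" "B = [b1, b2]" "C = [c1, c2, c3]"
    using l by (auto simp: length_Suc_conv eval_nat_numeral)
  have E: "E u a1" "E a1 a2" "E a2 w" "E u b1" "E b1 b2" "E b2 w" "E u c1" "E c1 c2" "E c2 c3" "E c3 w"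
    using t by (auto simp: theta_def eq)
  show wilson
    by (rule wilson_word[OF t refl, where a = 4 and b = 1 and c = 5 and ps = "[0, 4, 5, 1]"
        and ws = "[0,2,3,1,5,4,0,2,3,1,8,7,6,0,2,3,1,8,7,6,0,4,5,1,3,2,0,4,5,1,8,7,6,0,4,5,1,3,2,0,
          4,5,1,8,7,6,0,2,3,1,8,7,6,0,4,5,1,8,7,6,0]"])
      (use E E[THEN E_sym] in \<open>auto simp: eq wperm_step cyc3_apply upt_rec\<close>)
qed

lemma wilson_224:
  assumes t: "theta u w A B C" and l: "length A = 2" "length B = 2" "length C = 4"
  shows wilson
proof -
  obtain a1 a2 b1 b2 c1 c2 c3 c4 where eq: "A = [a1, a2]" "B = [b1, b2]" "C = [c1, c2, c3, c4]"
    using l by (auto simp: length_Suc_conv eval_nat_numeral)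
  have E: "E u a1" "E a1 a2" "E a2 w" "E u b1" "E b1 b2" "E b2 w"
    "E u c1" "E c1 c2" "E c2 c3" "E c3 c4" "E c4 w"
    using t by (auto simp: theta_def eq)
  show wilson
    by (rule wilson_word[OF t refl, where a = 5 and b = 4 and c = 6 and ps = "[5, 4, 0, 6]"
        and ws = "[0,2,3,1,9,8,7,6,0,2,3,1,9,8,7,6,0,2,3,1,9,8,7,6,0,2,3,1,5,4,0,6,7,8,9,1,5,4,0,
          6,7,8,9,1,3,2,0,6,7,8,9,1,3,2,0,6,7,8,9,1,5,4,0,6,7,8,9,1,5,4,0]"])
      (use E E[THEN E_sym] in \<open>auto simp: eq wperm_step cyc3_apply upt_rec\<close>)
qed

section \<open>Longest cycles and Wilson's theorem\<close>

text \<open>Serves chords, with \<open>es = []\<close>, and ears alike. \<open>A\<close> is the arc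
  of the cycle between positions \<open>i\<close> and \<open>j\<close>, and \<open>B\<close> is the
  arc through the closing edge.\<close>

lemma theta_of_path:
  assumes cs: "cyc cs" and ij: "i < j" "j < length cs"
    and es: "distinct es" "set es \<inter> set cs = {}" "successively E (cs ! i # es @ [cs ! j])"
  obtains A B where "theta (cs ! i) (cs ! j) A B es" "length A = j - i - 1"
    "length B = length cs - 1 - (j - i)"
proof -
  define P where "P = take i cs"
  define A where "A = take (j - i - 1) (drop (Suc i) cs)"
  define R where "R = drop (Suc j) cs"
  have "drop (Suc i) cs = A @ drop (j - i - 1) (drop (Suc i) cs)"
    by (simp only: A_def append_take_drop_id)
  also have "drop (j - i - 1) (drop (Suc i) cs) = cs ! j # R"
    using ij by (simp add: R_def Cons_nth_drop_Suc)
  finally have split: "cs = P @ cs ! i # A @ cs ! j # R"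
    using id_take_nth_drop[of i cs] ij by (simp add: P_def)
  let ?x = "cs ! i" and ?y = "cs ! j"
  have len: "length P = i" "length A = j - i - 1" "length R = length cs - Suc j"
    using ij by (simp_all add: P_def A_def R_def)
  have cyc: "distinct (P @ ?x # A @ ?y # R)" "successively E (P @ ?x # A @ ?y # R)"
    "E (last (P @ ?x # A @ ?y # R)) (hd (P @ ?x # A @ ?y # R))"
    using cs split unfolding cyc_def by metis+
  have "successively E (?x # A @ [?y])"
    using cyc(2) by (auto simp: successively_append_iff simp flip: append_Cons)
  moreover have "successively E (?y # R @ P @ [?x])"
    using cyc(2,3) by (cases P; cases R) (auto simp: successively_append_iff simp flip: append_Cons)
  then have "successively E (?x # rev (R @ P) @ [?y])"
    using successively_E_rev[of "?y # R @ P @ [?x]"] by simp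
  moreover have "distinct (?x # ?y # A @ rev (R @ P) @ es)"
  proof -
    have "set cs = insert ?x (insert ?y (set P \<union> set A \<union> set R))"
      by (subst split) auto
    then show ?thesis
      using cyc(1) es by auto
  qed
  ultimately have "theta ?x ?y A (rev (R @ P)) es"
    using es(3) by (simp add: theta_def)
  then show thesis
    using that len ij by simp
qed

definition longest :: "'v list \<Rightarrow> bool" where
  "longest cs \<longleftrightarrow> cyc cs \<and> (\<forall>ds. cyc ds \<longrightarrow> length ds \<le> length cs)"

text \<open>Rerouting the cycle through \<open>C\<close> cannot lengthen it, so \<open>C\<close> is
  at most as long as \<open>A\<close> and \<open>B\<close>. \<open>wilson_long\<close> leaves at
  most six interior vertices on \<open>A\<close> and \<open>B\<close> together and excludes three on
  each. If \<open>A\<close> or \<open>B\<close> had just one, it would form a square with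
  \<open>C\<close>. The remaining triples of lengths have explicit walks, except 2, 2, 1, which is
  the shape of \<open>\<Theta>\<^sub>7\<close>.\<close>

lemma longest_theta:
  assumes cs: "longest cs" and nw: "\<not> wilson" and t: "theta x y A B C"
    and len: "length A + length B + 2 = length cs" and ne: "C \<noteq> []"
  shows "length A = 2 \<and> length B = 2 \<and> length C = 1"
proof -
  let ?a = "length A" and ?b = "length B" and ?c = "length C"
  have c: "?c \<ge> 1"
    using ne by (simp add: Suc_le_eq)
  note tACB = theta_commute(2)[OF t] and tCBA = theta_commute(3)[OF t]
  note tCAB = theta_commute(2)[OF tCBA] and tBCA = theta_commute(2)[OF theta_commute(1)[OF t]]
  have "cyc (x # C @ y # rev A)" "cyc (x # C @ y # rev B)"
    using theta_cyc[OF tCAB] theta_cyc[OF tCBA] c by simp_all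
  then have "length (x # C @ y # rev A) \<le> length cs" "length (x # C @ y # rev B) \<le> length cs"
    using cs unfolding longest_def by blast+
  then have ab: "?c \<le> ?a" "?c \<le> ?b"
    using len by auto
  have ab': "A \<noteq> []" "B \<noteq> []"
    using ab c by auto
  have "\<not> (?a + ?b \<ge> 7 \<or> ?a = 3 \<and> ?b = 3)"
    using wilson_long[OF t ab' ne] nw by blast
  then have le: "?a + ?b \<le> 6" "\<not> (?a = 3 \<and> ?b = 3)"
    by auto
  have sq: "\<not> (length A' = 1 \<and> length C' = 1)" if t': "theta x y A' B' C'" for A' B' C'
  proof
    assume l: "length A' = 1 \<and> length C' = 1"
    then obtain a c where ac: "A' = [a]" "C' = [c]"
      by (auto simp: length_Suc_conv)
    then have "cyc [x, a, y, c]"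
      using theta_cyc[OF theta_commute(2)[OF t']] by simp
    then show False
      using wilson_square nw by blast
  qed
  have "?a \<noteq> 1"
    using sq[OF t] ab(1) c by presburger
  moreover have "?b \<noteq> 1"
    using sq[OF theta_commute(1)[OF t]] ab(2) c by presburger
  ultimately have cases: "?a = 2 \<and> ?b = 2 \<or> ?a = 2 \<and> ?b = 3 \<or> ?a = 3 \<and> ?b = 2 \<or>
      ?a = 2 \<and> ?b = 4 \<or> ?a = 4 \<and> ?b = 2" "?c = 1 \<or> ?c = 2"
    using le ab c by presburger+
  have "?c \<noteq> 2"
    using cases wilson_222[OF t] wilson_223[OF tACB] wilson_223[OF tBCA]
      wilson_224[OF tACB] wilson_224[OF tBCA] nw by metis
  moreover have "?c = 1 \<Longrightarrow> ?a = 2 \<and> ?b = 2"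
    using cases wilson_123[OF tCAB] wilson_123[OF tCBA] wilson_124[OF tCAB] wilson_124[OF tCBA] nw
    by metis
  ultimately show ?thesis
    using cases by blast
qed

text \<open>Both arcs cut out by the ear have two interior vertices, so its ends are opposite
  vertices of a hexagon. The bound \<open>i < 3\<close> lists each opposite pair once.\<close>

lemma longest_ear:
  assumes cs: "longest cs" and nw: "\<not> wilson" and xy: "x \<in> set cs" "y \<in> set cs" "x \<noteq> y"
    and es: "es \<noteq> []" "distinct es" "set es \<inter> set cs = {}" "successively E (x # es @ [y])"
  shows "length cs = 6 \<and> length es = 1 \<and> (\<exists>i < 3. {x, y} = {cs ! i, cs ! (i + 3)})"
proof -
  have c: "cyc cs"
    using cs by (simp add: longest_def)
  obtain i j fs where ij: "i < j" "j < length cs" "{x, y} = {cs ! i, cs ! j}"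
    and fs: "fs \<noteq> []" "length fs = length es" "distinct fs" "set fs \<inter> set cs = {}" "successively E (cs ! i # fs @ [cs ! j])"
  proof -
    obtain i j where *: "i < length cs" "j < length cs" "x = cs ! i" "y = cs ! j"
      using xy by (metis in_set_conv_nth)
    show thesis
    proof (cases "i < j")
      case True
      then show ?thesis using that[of i j es] * es by simp
    next
      case False
      then have "j < i"
        using * xy by (metis linorder_neqE_nat)
      then show ?thesis
        using that[of j i "rev es"] * es successively_E_rev[of "x # es @ [y]"] by auto
    qed
  qed
  obtain A B where t: "theta (cs ! i) (cs ! j) A B fs" "length A = j - i - 1"
    "length B = length cs - 1 - (j - i)"
    using theta_of_path[OF c ij(1,2) fs(3-5)] .
  have l: "length A = 2 \<and> length B = 2 \<and> length fs = 1"
    by (rule longest_theta[OF cs nw t(1) _ fs(1)]) (use t ij in auto)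
  then have "j = i + 3" "length cs = 6"
    using t(2,3) ij by auto
  then show ?thesis
    using l fs(2) ij by (intro conjI exI[of _ i]) auto
qed

text \<open>An ear on the two vertices of an edge closes up to a cycle, because its distinct ends
  must be these two vertices.\<close>

lemma cyc_exists: "\<exists>cs. cyc cs"
proof -
  obtain a b where ab: "a \<in> V" "b \<in> V" "a \<noteq> b"
    using card_V card_le_Suc0_iff_eq[OF finite_V] by fastforce
  have "\<not> V \<subseteq> {a, b}"
    using card_V card_mono[of "{a, b}" V] ab(3) by auto
  then obtain c where c: "c \<noteq> a" "c \<noteq> b"
    by blast
  obtain vs where vs: "vs \<noteq> []" "successively E vs" "hd vs = a" "last vs = b"
    using avoiding_path[OF ab(1,2) c] by blast
  obtain d where d: "E a d"
    using vs ab(3) by (cases vs; cases "tl vs") auto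
  have "a \<noteq> d" "d \<in> V"
    using d E_irrefl E_sym E_V by blast+
  moreover have "{a, d} \<noteq> V"
    using card_V \<open>a \<noteq> d\<close> by auto
  ultimately obtain x es y where ear: "x \<in> {a, d}" "y \<in> {a, d}" "x \<noteq> y" "es \<noteq> []" "distinct es"
    "set es \<subseteq> V - {a, d}" "successively E (x # es @ [y])"
    using ear_exists[of "{a, d}"] ab(1) by (metis card_2_iff insert_subset empty_subsetI order_refl psubsetI)
  have "E y x"
    using ear(1-3) d E_sym by auto
  then have "cyc (x # es @ [y])"
    using ear by (cases es) (auto simp: cyc_def)
  then show ?thesis by blast
qed

lemma longest_exists: "\<exists>cs. longest cs"
proof -
  have "length cs < Suc (card V)" if "cyc cs" for cs
    using that cyc_V[OF that] card_mono[OF finite_V, of "set cs"] distinct_card[of cs] by (simp add: cyc_def)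
  then show ?thesis
    using cyc_exists ex_has_greatest_nat[of cyc _ length "Suc (card V)"] unfolding longest_def by blast
qed

lemma cyc_rotate: "cyc cs \<Longrightarrow> cyc (rotate n cs)"
proof (induction n)
  case (Suc n)
  then have c: "cyc (rotate n cs)"
    by simp
  then obtain x ws where x: "rotate n cs = x # ws" "ws \<noteq> []"
    by (cases "rotate n cs"; cases "tl (rotate n cs)") (auto simp: cyc_def)
  then have "rotate (Suc n) cs = ws @ [x]"
    by simp
  then show ?case
    using c x by (auto simp: cyc_def successively_append_iff successively_Cons)
qed simp

definition chord :: "'v list \<Rightarrow> bool" where
  "chord cs \<longleftrightarrow> (\<exists>i j. i < j \<and> j < length cs \<and> j \<noteq> Suc i \<and> \<not> (i = 0 \<and> Suc j = length cs) \<and> E (cs ! i) (cs ! j))"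

lemma chord_wilson:
  assumes "cyc cs" "chord cs"
  shows wilson
proof -
  obtain i j where ij: "i < j" "j < length cs" "j \<noteq> Suc i" "\<not> (i = 0 \<and> Suc j = length cs)"
    "E (cs ! i) (cs ! j)"
    using assms(2) by (auto simp: chord_def)
  obtain A B where t: "theta (cs ! i) (cs ! j) A B []" "length A = j - i - 1"
    "length B = length cs - 1 - (j - i)"
    using theta_of_path[OF assms(1) ij(1,2), of "[]"] ij(5) by auto
  show wilson
    using wilson_chord[OF theta_commute(2)[OF t(1)]] t ij by fastforce
qed

text \<open>Only a hexagon with a one-vertex ear between opposite vertices survives
  \<open>longest_ear\<close>. A further edge from the ear vertex \<open>m\<close> to the hexagon, or
  a further ear, then yields an ear forbidden by \<open>longest_ear\<close>, a 4-cycle or an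
  8-cycle.\<close>

theorem wilson_theorem:
  assumes not_cycle: "\<And>cs. cyc cs \<Longrightarrow> set cs = V \<Longrightarrow> chord cs"
    and not_theta7: "\<And>cs m. \<lbrakk>cyc cs; length cs = 6; m \<notin> set cs; V = insert m (set cs); E m (cs ! 0); E m (cs ! 3)\<rbrakk>
      \<Longrightarrow> chord cs \<or> (\<exists>i < 6. i \<noteq> 0 \<and> i \<noteq> 3 \<and> E m (cs ! i))"
  shows wilson
proof (rule ccontr)
  assume nw: "\<not> wilson"
  obtain cs0 where cs0: "longest cs0"
    using longest_exists by blast
  then have c0: "cyc cs0"
    by (simp add: longest_def)
  have "set cs0 \<subset> V"
    using not_cycle[OF c0] chord_wilson[OF c0] nw cyc_V[OF c0] by blast
  moreover have "card (set cs0) \<ge> 2"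
    using c0 distinct_card[of cs0] by (simp add: cyc_def)
  ultimately obtain x es y where ear: "x \<in> set cs0" "y \<in> set cs0" "x \<noteq> y" "es \<noteq> []" "distinct es"
    "set es \<subseteq> V - set cs0" "successively E (x # es @ [y])"
    using ear_exists by metis
  obtain k where k: "length cs0 = 6" "length es = 1" "k < 3" "{x, y} = {cs0 ! k, cs0 ! (k + 3)}"
    using longest_ear[OF cs0 nw ear(1-5) _ ear(7)] ear(6) by blast
  obtain m where m: "es = [m]"
    using k(2) by (auto simp: length_Suc_conv)
  \<comment> \<open>Rotation puts the ends of the ear at positions 0 and 3.\<close>
  define cs where "cs = rotate k cs0"
  have cs: "longest cs" and c: "cyc cs" and len: "length cs = 6"
    using cs0 cyc_rotate k by (auto simp: longest_def cs_def)
  have mc: "m \<notin> set cs" "m \<in> V"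
    using ear(6) m by (auto simp: cs_def)
  have "cs ! 0 = cs0 ! k" "cs ! 3 = cs0 ! (k + 3)"
    using k by (auto simp: cs_def nth_rotate)
  then have mE: "E m (cs ! 0)" "E m (cs ! 3)"
    using k(4) ear(7) m E_sym by (auto simp: doubleton_eq_iff)
  have d: "distinct cs"
    using c by (simp add: cyc_def)
  note eq_iff = nth_eq_iff_index_eq[OF d]
  have no_chord: "\<not> chord cs"
    using chord_wilson[OF c] nw by blast
  show False
  proof (cases "V = insert m (set cs)")
    case True
    then obtain i where i: "i < 6" "i \<noteq> 0" "i \<noteq> 3" "E m (cs ! i)"
      using not_theta7[OF c len mc(1) True mE] no_chord by blast
    have "successively E (cs ! 0 # [m] @ [cs ! i])"
      using i(4) mE(1) E_sym by simp
    then obtain k where "k < 3" "{cs ! 0, cs ! i} = {cs ! k, cs ! (k + 3)}"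
      using longest_ear[OF cs nw, of "cs ! 0" "cs ! i" "[m]"] i mc(1) len eq_iff by auto
    then show False
      using i len by (auto simp: doubleton_eq_iff eq_iff)
  next
    case False
    let ?Z = "insert m (set cs)"
    have "?Z \<subset> V" "card ?Z \<ge> 2"
      using False cyc_V[OF c] mc len distinct_card[OF d] by auto
    then obtain p fs q where ear': "p \<in> ?Z" "q \<in> ?Z" "p \<noteq> q" "fs \<noteq> []" "distinct fs"
      "set fs \<subseteq> V - ?Z" "successively E (p # fs @ [q])"
      using ear_exists by metis
    \<comment> \<open>Prolonged by an edge from \<open>m\<close> back to the hexagon, an ear
      starting at \<open>m\<close> becomes an ear of the hexagon with at least two interior
      vertices. The other end \<open>r\<close> is chosen different from \<open>q\<close>.\<close>
    have from_m: False
      if q: "q \<in> set cs" and gs: "distinct gs" "gs \<noteq> []" "set gs \<inter> ?Z = {}" "successively E (m # gs @ [q])" for q gs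
    proof -
      define r where "r = (if q = cs ! 0 then cs ! 3 else cs ! 0)"
      have r: "r \<in> set cs" "r \<noteq> q" "E r m"
        using len mE E_sym by (auto simp: r_def eq_iff)
      have "length (m # gs) = 1"
        using longest_ear[OF cs nw r(1) q r(2), of "m # gs"] gs r(3) mc(1) by auto
      then show False
        using gs(2) by simp
    qed
    consider "p = m" | "q = m" "p \<noteq> m" | "p \<in> set cs" "q \<in> set cs"
      using ear'(1,2) by blast
    then show False
    proof cases
      case 1
      then show False
        using from_m[of q fs] ear' by auto
    next
      case 2
      then show False
        using from_m[of p "rev fs"] ear' successively_E_rev[of "p # fs @ [q]"] by auto
    next
      case 3
      then obtain i where i: "length fs = 1" "i < 3" "{p, q} = {cs ! i, cs ! (i + 3)}"
        using longest_ear[OF cs nw 3 ear'(3-5) _ ear'(7)] ear'(6) by blast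
      obtain m' where m': "fs = [m']"
        using i(1) by (auto simp: length_Suc_conv)
      have m'c: "m' \<notin> set cs" "m' \<noteq> m"
        using ear'(6) m' by auto
      have m'E: "E m' (cs ! i)" "E m' (cs ! (i + 3))"
        using i(3) ear'(7) m' E_sym by (auto simp: doubleton_eq_iff)
      obtain c0 c1 c2 c3 c4 c5 where csl: "cs = [c0, c1, c2, c3, c4, c5]"
        using len by (auto simp: length_Suc_conv eval_nat_numeral)
      have E: "E c0 c1" "E c1 c2" "E c2 c3" "E c3 c4" "E c4 c5" "E c5 c0" "E m c0" "E m c3"
        using c mE by (auto simp: cyc_def csl)
      \<comment> \<open>The hexagon is a longest cycle. Two one-vertex ears at different pairs of
        opposite vertices would give a cycle through all eight vertices; at the same pair they form
        a square.\<close>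
      have short: "\<not> cyc ds" if "length ds = 8" for ds
        using cs that len by (auto simp: longest_def)
      consider "i = 0" | "i = 1" | "i = 2"
        using i(2) by linarith
      then show False
      proof cases
        case 1
        then have "cyc [c0, m, c3, m']"
          using E E[THEN E_sym] m'E m'E[THEN E_sym] m'c mc(1) d by (auto simp: cyc_def csl)
        then show False
          using wilson_square nw by blast
      next
        case 2
        then have "cyc [c0, m, c3, c2, c1, m', c4, c5]"
          using E E[THEN E_sym] m'E m'E[THEN E_sym] m'c mc(1) d by (auto simp: cyc_def csl)
        then show False
          using short by simp
      next
        case 3
        then have "cyc [c0, m, c3, c4, c5, m', c2, c1]"
          using E E[THEN E_sym] m'E m'E[THEN E_sym] m'c mc(1) d by (auto simp: cyc_def csl)
        then show False
          using short by simp
      qed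
    qed
  qed
qed

end

section \<open>Twisted walks\<close>

lemma rtranclp_distinct_path:
  assumes "R\<^sup>*\<^sup>* x y"
  shows "\<exists>vs. vs \<noteq> [] \<and> successively R vs \<and> distinct vs \<and> hd vs = x \<and> last vs = y"
  using assms
proof (induction rule: rtranclp_induct)
  case base
  show ?case by (rule exI[of _ "[x]"]) simp
next
  case (step y z)
  then obtain vs where vs: "vs \<noteq> []" "successively R vs" "distinct vs" "hd vs = x" "last vs = y"
    by blast
  show ?case
  proof (cases "z \<in> set vs")
    case True
    then obtain as bs where "vs = as @ z # bs"
      by (meson split_list)
    then show ?thesis
      using vs by (intro exI[of _ "as @ [z]"]) (auto simp: successively_append_iff hd_append)
  next
    case False
    then show ?thesis
      using vs step.hyps(2) by (intro exI[of _ "vs @ [z]"]) (auto simp: successively_append_iff)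
  qed
qed

lemma rtrancl_on_imp_rtranclp:
  assumes "(x, y) \<in> rtrancl_on S A" "\<And>a b. (a, b) \<in> A \<Longrightarrow> R a b"
  shows "R\<^sup>*\<^sup>* x y"
  using assms(1) by induction (auto intro: assms(2) converse_rtranclp_into_rtranclp)

locale twist = bidirected_digraph G bar + fin_digraph G + loopfree_digraph G
  for G :: "('v, 'e) pre_digraph" and bar :: "'e \<Rightarrow> 'e" +
  fixes m :: nat and \<gamma> :: "'e \<Rightarrow> int"
  assumes m_pos: "m \<ge> 1" and chain: "\<gamma> \<in> chains m G bar" and conn2: "two_vertex_connected G"
begin

definition adj :: "'v \<Rightarrow> 'v \<Rightarrow> bool" where
  "adj x y \<longleftrightarrow> (\<exists>e \<in> arcs G. tail G e = x \<and> head G e = y)"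

lemma adj_arcs_ends: "adj x y \<longleftrightarrow> (x, y) \<in> arcs_ends G"
  by (auto simp: adj_def arcs_ends_conv)

lemma adj_sym: "adj x y \<Longrightarrow> adj y x"
  unfolding adj_def by (metis arev_in_arcs head_arev tail_arev)

sublocale P: puzzle "verts G" adj
proof
  show "finite (verts G)" "card (verts G) \<ge> 3"
    using conn2 by (auto simp: two_vertex_connected_def)
  show "adj y x" if "adj x y" for x y
    using that by (rule adj_sym)
  show "\<not> adj x x" for x
    using no_loops by (metis adj_def)
  show "x \<in> verts G" if "adj x y" for x y
    using that by (auto simp: adj_def)
  fix x y z assume xyz: "x \<in> verts G" "y \<in> verts G" "z \<noteq> x" "z \<noteq> y"
  let ?R = "\<lambda>a b. adj a b \<and> a \<noteq> z \<and> b \<noteq> z"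
  have "\<exists>H :: ('v, 'e) pre_digraph. connected H \<and> x \<in> verts H \<and> y \<in> verts H \<and>
    (\<forall>a b. (a, b) \<in> parcs (mk_symmetric H) \<longrightarrow> ?R a b)"
  proof (cases "z \<in> verts G")
    case True
    let ?H = "pre_digraph.del_vert G z"
    have "connected ?H"
      using conn2 True by (simp add: two_vertex_connected_def)
    moreover have "?R a b" if "(a, b) \<in> parcs (mk_symmetric ?H)" for a b
      using that by (auto simp: parcs_mk_symmetric del_vert_simps adj_def intro: adj_sym[unfolded adj_def])
    ultimately show ?thesis
      using xyz by (intro exI[of _ ?H]) (simp add: del_vert_simps)
  next
    case False
    have "?R a b" if "(a, b) \<in> parcs (mk_symmetric G)" for a b
      using that False by (auto simp: parcs_mk_symmetric adj_def intro: adj_sym[unfolded adj_def])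
    then show ?thesis
      using xyz conn2 by (intro exI[of _ G]) (simp add: two_vertex_connected_def)
  qed
  then obtain H :: "('v, 'e) pre_digraph" where H: "connected H" "x \<in> verts H" "y \<in> verts H"
    "\<forall>a b. (a, b) \<in> parcs (mk_symmetric H) \<longrightarrow> ?R a b"
    by blast
  have "(x, y) \<in> rtrancl_on (verts H) (parcs (mk_symmetric H))"
    using H(1-3) by (auto simp: connected_def strongly_connected_def reachable_def)
  then have "?R\<^sup>*\<^sup>* x y"
    by (rule rtrancl_on_imp_rtranclp) (use H(4) in auto)
  then obtain vs where vs: "vs \<noteq> []" "successively ?R vs" "distinct vs" "hd vs = x" "last vs = y"
    using rtranclp_distinct_path[of ?R x y] by blast
  have "z \<notin> set vs"
  proof
    assume "z \<in> set vs"
    then obtain as bs where "vs = as @ z # bs"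
      by (meson split_list)
    then show False
      using vs xyz by (cases bs) (auto simp: successively_append_iff)
  qed
  moreover have "successively adj vs"
    using vs(2) by (rule successively_mono) auto
  ultimately show "\<exists>vs. vs \<noteq> [] \<and> successively adj vs \<and> distinct vs \<and> hd vs = x \<and> last vs = y \<and> z \<notin> set vs"
    using vs by blast
qed

lemma gamma_bar: "e \<in> arcs G \<Longrightarrow> [\<gamma> (bar e) = - \<gamma> e] (mod int m)"
  using chain by (simp add: chains_def cong_def)

primrec pperm :: "'e list \<Rightarrow> 'v \<Rightarrow> 'v" where
  "pperm [] = id"
| "pperm (e # p) = pperm p \<circ> Transposition.transpose (tail G e) (head G e)"

text \<open>The vector part of a path, with integer entries before reduction modulo \<open>m\<close>.\<close>

primrec raw :: "'e list \<Rightarrow> 'v \<Rightarrow> int" where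
  "raw [] = (\<lambda>x. 0)"
| "raw (e # p) = (\<lambda>x. raw p x + (if inv_into UNIV (pperm p) x = tail G e then \<gamma> e else 0))"

lemma path_elem_eq: "path_elem m G \<gamma> p = (\<lambda>x. raw p x mod int m, pperm p)"
  by (induction p) (auto simp: gen_sym_group_def edge_elem_def fun_eq_iff mod_simps)

lemma bij_pperm: "bij (pperm p)"
proof (induction p)
  case Nil
  show ?case unfolding pperm.simps by (rule bij_id)
next
  case (Cons e p)
  then show ?case unfolding pperm.simps by (intro bij_comp bij_transpose)
qed

lemma inv_pperm: "inv_into UNIV (pperm p) (pperm p x) = x" "pperm p (inv_into UNIV (pperm p) x) = x"
  using bij_pperm[of p] by (simp_all add: bij_is_inj bij_is_surj surj_f_inv_f)

lemma inv_pperm_eq_iff: "inv_into UNIV (pperm p) x = y \<longleftrightarrow> x = pperm p y"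
  using inv_pperm by metis

lemma pperm_append: "pperm (p @ q) = pperm q \<circ> pperm p"
  by (induction p) (simp_all add: comp_assoc)

lemma raw_append: "raw (p @ q) x = raw q x + raw p (inv_into UNIV (pperm q) x)"
proof (induction p)
  case (Cons e p)
  have "inv_into UNIV (pperm (p @ q)) x = tail G e \<longleftrightarrow>
    inv_into UNIV (pperm p) (inv_into UNIV (pperm q) x) = tail G e"
    by (simp only: inv_pperm_eq_iff) (simp only: pperm_append o_apply)
  then show ?case
    using Cons by simp
qed simp

lemma pperm_rev:
  assumes "set p \<subseteq> arcs G"
  shows "pperm (rev (map bar p)) = inv_into UNIV (pperm p)"
  using assms
  by (induction p) (simp_all add: pperm_append o_inv_distrib bij_pperm transpose_commute)

text \<open>This is the vector of the inverse in the semidirect product. It is a congruence because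
  \<gamma> takes values in \<open>{0..<m}\<close>, so that \<open>\<gamma> (bar e)\<close> is
  \<open>m - \<gamma> e\<close> rather than \<open>- \<gamma> e\<close> when the twist is
  non-zero.\<close>

lemma raw_rev:
  assumes "set p \<subseteq> arcs G"
  shows "[raw (rev (map bar p)) x = - raw p (pperm p x)] (mod int m)"
  using assms
proof (induction p arbitrary: x)
  case (Cons e p)
  let ?t = "Transposition.transpose (tail G e) (head G e)"
  have e: "e \<in> arcs G"
    using Cons.prems by simp
  have t: "inv_into UNIV (Transposition.transpose (head G e) (tail G e)) = ?t"
    by (simp add: transpose_commute)
  have iff: "?t x = tail G e \<longleftrightarrow> x = head G e"
    by (auto simp: Transposition.transpose_def)
  have "raw (rev (map bar (e # p))) x =
    (if x = head G e then \<gamma> (bar e) else 0) + raw (rev (map bar p)) (?t x)"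
    using e by (simp add: raw_append t transpose_commute[of "head G e"])
  also have "[\<dots> = (if x = head G e then - \<gamma> e else 0) + - raw p (pperm p (?t x))] (mod int m)"
    using Cons gamma_bar[OF e] by (intro cong_add) auto
  also have "(if x = head G e then - \<gamma> e else 0) + - raw p (pperm p (?t x)) = - raw (e # p) (pperm (e # p) x)"
    using iff by (simp add: inv_pperm)
  finally show ?case .
qed simp

lemma awalk_rev: "awalk u p w \<Longrightarrow> awalk w (rev (map bar p)) u"
proof (induction p arbitrary: u)
  case (Cons e p)
  then have "awalk w (rev (map bar p)) (head G e)" "e \<in> arcs G" "tail G e = u"
    by (auto simp: awalk_Cons_iff)
  then show ?case
    by (auto simp: awalk_Cons_iff awalk_Nil_iff)
qed (simp add: awalk_Nil_iff)

definition wsum :: "'e list \<Rightarrow> int" where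
  "wsum p = sum_list (map \<gamma> p)"

lemma wsum_simps [simp]: "wsum [] = 0" "wsum (e # p) = \<gamma> e + wsum p" "wsum (p @ q) = wsum p + wsum q"
  by (simp_all add: wsum_def)

lemma pperm_permutes: "set p \<subseteq> arcs G \<Longrightarrow> pperm p permutes verts G"
  by (induction p) (auto intro!: permutes_compose permutes_swap_id simp: permutes_id)

lemma pperm_end: "awalk u p w \<Longrightarrow> pperm p u = w"
  by (induction p arbitrary: u) (auto simp: awalk_Cons_iff awalk_Nil_iff)

lemma raw_outside: "set p \<subseteq> arcs G \<Longrightarrow> x \<notin> verts G \<Longrightarrow> raw p x = 0"
proof (induction p)
  case (Cons e p)
  have "pperm p permutes verts G"
    using Cons.prems by (intro pperm_permutes) auto
  then have "x \<noteq> pperm p (tail G e)"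
    using Cons.prems permutes_in_image[of "pperm p" "verts G" "tail G e"] by auto
  then show ?case
    using Cons by (simp add: inv_pperm_eq_iff)
qed simp

text \<open>A move along \<open>e\<close> puts its entry on the token that lands at the tail, while
  the empty vertex goes to the head. Without loops these differ, so the empty vertex never carries
  an entry.\<close>

lemma raw_end: "awalk u p w \<Longrightarrow> raw p w = 0"
proof (induction p arbitrary: u)
  case (Cons e p)
  then have p: "awalk (head G e) p w" "e \<in> arcs G"
    by (auto simp: awalk_Cons_iff)
  have "inv_into UNIV (pperm p) w = head G e"
    using pperm_end[OF p(1)] by (simp add: inv_pperm_eq_iff)
  then show ?case
    using Cons.IH[OF p(1)] no_loops[OF p(2)] by simp
qed simp

text \<open>Later moves only permute the entries, so each arc contributes \<open>\<gamma> e\<close>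
  exactly once. This ties the vectors to the twists of walks.\<close>

lemma sum_raw: "set p \<subseteq> arcs G \<Longrightarrow> (\<Sum>x \<in> verts G. raw p x) = wsum p"
proof (induction p)
  case (Cons e p)
  have "pperm p permutes verts G"
    using Cons.prems by (intro pperm_permutes) auto
  then have "pperm p (tail G e) \<in> verts G"
    using Cons.prems by (simp add: permutes_in_image)
  then show ?case
    using Cons by (simp add: sum.distrib inv_pperm_eq_iff sum.delta)
qed simp

lemma pperm_wperm: "cas u p w \<Longrightarrow> pperm p = wperm (awalk_verts u p)"
proof (induction p arbitrary: u)
  case (Cons e p)
  then have u: "u = tail G e" "cas (head G e) p w"
    by auto
  then obtain ws where ws: "awalk_verts (head G e) p = head G e # ws"
    by (cases p) auto
  show ?case
    unfolding u(1) awalk_verts.simps ws wperm_Cons_Cons pperm.simps Cons.IH[OF u(2)] ..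
qed simp

lemma awalk_imp_walk:
  assumes "awalk u p w"
  shows "P.walk (awalk_verts u p)"
proof -
  have "successively adj (awalk_verts u p)"
    using assms
  proof (induction p arbitrary: u)
    case (Cons e p)
    then show ?case
      by (cases p) (auto simp: awalk_Cons_iff adj_def)
  qed simp
  then show ?thesis
    using assms by (auto simp: P.walk_def)
qed

lemma walk_imp_awalk:
  assumes "P.walk vs"
  shows "\<exists>p. awalk (hd vs) p (last vs) \<and> awalk_verts (hd vs) p = vs"
  using assms
proof (induction vs rule: induct_list012)
  case (2 x)
  then show ?case
    by (intro exI[of _ "[]"]) (simp add: awalk_Nil_iff P.walk_def)
next
  case (3 x y zs)
  then obtain p where p: "awalk y p (last (y # zs))" "awalk_verts y p = y # zs"
    by (auto simp: P.walk_def)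
  have "adj x y"
    using 3 by (simp add: P.walk_def)
  then obtain e where "e \<in> arcs G" "tail G e = x" "head G e = y"
    by (auto simp: adj_def)
  then show ?case
    using p by (intro exI[of _ "e # p"]) (auto simp: awalk_Cons_iff)
qed (simp add: P.walk_def)

lemma evenperm_pperm: "awalk u p w \<Longrightarrow> evenperm (pperm p) \<longleftrightarrow> even (length p)"
proof -
  assume p: "awalk u p w"
  have "successively (\<noteq>) (awalk_verts u p)"
    using awalk_imp_walk[OF p] P.E_irrefl unfolding P.walk_def by (auto elim: successively_mono)
  then show ?thesis
    using evenperm_wperm[of "awalk_verts u p"] pperm_wperm[of u p w] p
    by (simp add: awalk_def length_awalk_verts)
qed

lemma awalk_exists:
  assumes "u \<in> verts G" "w \<in> verts G"
  shows "\<exists>p. awalk u p w"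
proof -
  have "\<not> verts G \<subseteq> {u, w}"
    using P.card_V card_mono[of "{u, w}" "verts G"] card_insert_le_m1[of 2 "{w}" u] by auto
  then obtain z where "z \<noteq> u" "z \<noteq> w"
    by blast
  then obtain vs where vs: "vs \<noteq> []" "successively adj vs" "hd vs = u" "last vs = w"
    using P.avoiding_path[OF assms] by blast
  have "set vs \<subseteq> verts G"
  proof (cases "length vs \<ge> 2")
    case True
    then show ?thesis using P.successively_V vs by blast
  next
    case False
    then show ?thesis using vs assms by (cases vs; cases "tl vs") auto
  qed
  then have "P.walk vs"
    using vs by (simp add: P.walk_def)
  then show ?thesis
    using walk_imp_awalk vs by blast
qed

text \<open>\<open>f\<close> is an integer vector that represents the vector part modulo \<open>m\<close>.\<close>

definition reach :: "'v \<Rightarrow> 'v \<Rightarrow> ('v \<Rightarrow> int) \<Rightarrow> ('v \<Rightarrow> 'v) \<Rightarrow> bool" where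
  "reach u w f \<sigma> \<longleftrightarrow> (\<exists>p. awalk u p w \<and> pperm p = \<sigma> \<and> (\<forall>x. [raw p x = f x] (mod int m)))"

lemma reach_awalk: "awalk u p w \<Longrightarrow> reach u w (raw p) (pperm p)"
  by (auto simp: reach_def)

lemma reach_cong: "reach u w f \<sigma> \<Longrightarrow> (\<And>x. [f x = g x] (mod int m)) \<Longrightarrow> reach u w g \<sigma>"
  unfolding reach_def using cong_trans by blast

lemma reach_id: "u \<in> verts G \<Longrightarrow> reach u u (\<lambda>x. 0) id"
  using reach_awalk[of u "[]" u] by (simp add: awalk_Nil_iff)

lemma reach_comp:
  assumes "reach u w f \<sigma>" "reach w z g \<tau>"
  shows "reach u z (\<lambda>x. g x + f (inv_into UNIV \<tau> x)) (\<tau> \<circ> \<sigma>)"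
proof -
  obtain p q where p: "awalk u p w" "pperm p = \<sigma>" "\<And>x. [raw p x = f x] (mod int m)"
    and q: "awalk w q z" "pperm q = \<tau>" "\<And>x. [raw q x = g x] (mod int m)"
    using assms by (auto simp: reach_def)
  have "awalk u (p @ q) z"
    using p q by auto
  then show ?thesis
    unfolding reach_def using p q
    by (intro exI[of _ "p @ q"]) (auto simp: pperm_append raw_append intro: cong_add)
qed

lemma reach_inv:
  assumes "reach u w f \<sigma>"
  shows "reach w u (\<lambda>x. - f (\<sigma> x)) (inv_into UNIV \<sigma>)"
proof -
  obtain p where p: "awalk u p w" "pperm p = \<sigma>" "\<And>x. [raw p x = f x] (mod int m)"
    using assms by (auto simp: reach_def)
  have "set p \<subseteq> arcs G"
    using p(1) by auto
  then have "[raw (rev (map bar p)) x = - f (\<sigma> x)] (mod int m)" for x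
    using raw_rev[of p x] p(2,3) by (metis cong_minus_minus_iff cong_trans)
  then show ?thesis
    unfolding reach_def using awalk_rev[OF p(1)] pperm_rev[OF \<open>set p \<subseteq> arcs G\<close>] p(2) by blast
qed

lemma reach_bij: "reach u w f \<sigma> \<Longrightarrow> bij \<sigma>"
  using bij_pperm by (auto simp: reach_def)

text \<open>The vector of the conjugating walk enters twice with opposite signs and cancels, because
  the conjugated element has trivial permutation.\<close>

lemma reach_conj:
  assumes "reach u w g \<tau>" "reach u u f id"
  shows "reach w w (\<lambda>x. f (inv_into UNIV \<tau> x)) id"
proof -
  have b: "bij \<tau>"
    using assms(1) by (rule reach_bij)
  then have *: "\<tau> (inv_into UNIV \<tau> x) = x" for x
    by (simp add: bij_is_surj surj_f_inv_f)
  have "reach w u (\<lambda>x. f x + - g (\<tau> x)) (inv_into UNIV \<tau>)"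
    using reach_comp[OF reach_inv[OF assms(1)] assms(2)] by simp
  moreover have "\<tau> \<circ> inv_into UNIV \<tau> = id"
    using * by (auto simp: fun_eq_iff)
  ultimately show ?thesis
    using reach_comp[of w u "\<lambda>x. f x + - g (\<tau> x)" "inv_into UNIV \<tau>" w g \<tau>] assms(1) by (simp add: *)
qed

lemma reach_add:
  assumes "reach u u f id" "reach u u g \<sigma>"
  shows "reach u u (\<lambda>x. f x + g x) \<sigma>"
  using reach_comp[OF assms(2,1)] by simp

lemma reach_neg: "reach u u f id \<Longrightarrow> reach u u (\<lambda>x. - f x) id"
  using reach_inv[of u u f id] by simp

lemma grp_reach:
  assumes "h \<in> P.grp u"
  obtains f where "reach u u f h"
proof -
  obtain vs where vs: "P.walk vs" "hd vs = u" "last vs = u" "h = wperm vs"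
    using assms by (auto simp: P.grp_def)
  obtain p where p: "awalk u p u" "awalk_verts u p = vs"
    using walk_imp_awalk[OF vs(1)] vs by auto
  then have "pperm p = h"
    using pperm_wperm[of u p u] vs(4) by (auto simp: awalk_def)
  then show thesis
    using that reach_awalk[OF p(1)] by metis
qed

lemma reach_grp: "reach u u f h \<Longrightarrow> h \<in> P.grp u"
proof -
  assume "reach u u f h"
  then obtain p where p: "awalk u p u" "pperm p = h"
    by (auto simp: reach_def)
  then show ?thesis
    using awalk_imp_walk[OF p(1)] pperm_wperm[of u p u] P.grpI[of "awalk_verts u p" u] by (auto simp: awalk_def)
qed

end

section \<open>Scalars of pure vectors\<close>

text \<open>A subgroup of the integers modulo \<open>m\<close> is represented by its preimage in the
  integers, hence the recurring condition \<open>int m \<in> D\<close>.\<close>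

definition int_subgroup :: "int set \<Rightarrow> bool" where
  "int_subgroup D \<longleftrightarrow> 0 \<in> D \<and> (\<forall>a \<in> D. \<forall>b \<in> D. a - b \<in> D)"

lemma int_subgroup_diff: "int_subgroup D \<Longrightarrow> a \<in> D \<Longrightarrow> b \<in> D \<Longrightarrow> a - b \<in> D"
  by (simp add: int_subgroup_def)

lemma int_subgroup_uminus: "int_subgroup D \<Longrightarrow> a \<in> D \<Longrightarrow> - a \<in> D"
  using int_subgroup_diff[of D 0 a] by (simp add: int_subgroup_def)

lemma int_subgroup_add: "int_subgroup D \<Longrightarrow> a \<in> D \<Longrightarrow> b \<in> D \<Longrightarrow> a + b \<in> D"
  using int_subgroup_diff[of D a "- b"] int_subgroup_uminus[of D b] by simp

lemma int_subgroup_mult: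
  assumes "int_subgroup D" "a \<in> D"
  shows "k * a \<in> D"
proof -
  have nat: "int n * a \<in> D" for n
    using assms by (induction n) (auto simp: algebra_simps int_subgroup_def[of D] intro: int_subgroup_add)
  show ?thesis
    using nat[of "nat k"] int_subgroup_uminus[OF assms(1) nat[of "nat (- k)"]] by (cases "k \<ge> 0") auto
qed

lemma int_subgroup_sum: "int_subgroup D \<Longrightarrow> (\<And>x. x \<in> A \<Longrightarrow> f x \<in> D) \<Longrightarrow> sum f A \<in> D"
  by (induction A rule: infinite_finite_induct) (auto simp: int_subgroup_def[of D] intro: int_subgroup_add)

lemma int_subgroup_cong:
  assumes "int_subgroup D" "int m \<in> D" "[a = b] (mod int m)" "a \<in> D"
  shows "b \<in> D"
proof -
  obtain k where "b = a + int m * k"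
    using assms(3) by (metis cong_iff_lin)
  then show ?thesis
    using assms int_subgroup_add int_subgroup_mult[of D "int m" k] by (simp add: mult.commute)
qed

context twist
begin

text \<open>The potential at \<open>w\<close> is the sum along a chosen walk from \<open>v\<close>
  to \<open>w\<close>. Walking to the tail of an arc, along the arc and back from its head is
  closed, so the error lies in \<open>D\<close>. Used for \<gamma> itself and, with \<open>D\<close>
  the even integers, for 2-colourings.\<close>

lemma potential_exists:
  fixes g :: "'e \<Rightarrow> int"
  assumes D: "int_subgroup D" and v: "v \<in> verts G"
    and bar: "\<And>e. e \<in> arcs G \<Longrightarrow> g (bar e) + g e \<in> D"
    and closed: "\<And>p. awalk v p v \<Longrightarrow> sum_list (map g p) \<in> D"
  shows "\<exists>f. \<forall>e \<in> arcs G. g e - (f (head G e) - f (tail G e)) \<in> D"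
proof -
  define path where "path w = (SOME p. awalk v p w)" for w
  have path: "awalk v (path w) w" if "w \<in> verts G" for w
    unfolding path_def using awalk_exists[OF v that] by (rule someI_ex)
  define f where "f w = sum_list (map g (path w))" for w
  have rev: "sum_list (map g (rev (map bar p))) + sum_list (map g p) \<in> D" if "set p \<subseteq> arcs G" for p
    using that
  proof (induction p)
    case Nil
    then show ?case using D by (simp add: int_subgroup_def)
  next
    case (Cons e p)
    have "(sum_list (map g (rev (map bar p))) + sum_list (map g p)) + (g (bar e) + g e) \<in> D"
      by (rule int_subgroup_add[OF D]) (use Cons bar[of e] in auto)
    then show ?case
      by (simp add: algebra_simps)
  qed
  have "g e - (f (head G e) - f (tail G e)) \<in> D" if e: "e \<in> arcs G" for e
  proof -
    let ?h = "path (head G e)" and ?t = "path (tail G e)"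
    have h: "awalk v ?h (head G e)" and t: "awalk v ?t (tail G e)"
      using path e by auto
    then have "awalk v (?t @ e # rev (map bar ?h)) v"
      using awalk_rev[OF h] e by (auto simp: awalk_Cons_iff)
    then have "sum_list (map g (?t @ e # rev (map bar ?h))) \<in> D"
      by (rule closed)
    moreover have "sum_list (map g (rev (map bar ?h))) + sum_list (map g ?h) \<in> D"
      using h by (intro rev) auto
    ultimately have "sum_list (map g (?t @ e # rev (map bar ?h))) -
      (sum_list (map g (rev (map bar ?h))) + sum_list (map g ?h)) \<in> D"
      by (rule int_subgroup_diff[OF D])
    then show ?thesis
      by (simp add: f_def algebra_simps)
  qed
  then show ?thesis by blast
qed

text \<open>Summation by parts: pairing the differences of \<open>f\<close> with \<omega> gives the
  sum over the vertices \<open>w\<close> of \<open>f w\<close> times the inflow of \<omega> at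
  \<open>w\<close>, which vanishes modulo \<open>m\<close>. What remains is the pairing of \<omega>
  with values in \<open>D\<close>.\<close>

lemma phi_mem:
  assumes D: "int_subgroup D" "int m \<in> D"
    and f: "\<And>e. e \<in> arcs G \<Longrightarrow> \<gamma> e - (f (head G e) - f (tail G e)) \<in> D"
    and \<omega>: "\<omega> \<in> H1 m G bar"
  shows "phi m G bar \<gamma> \<omega> \<in> D"
proof -
  define r where "r E = (SOME e. e \<in> E)" for E :: "'e set"
  have r: "r E \<in> arcs G" "E = {r E, bar (r E)}" if E: "E \<in> uedges G bar" for E
  proof -
    obtain e where e: "e \<in> arcs G" "E = {e, bar e}"
      using E by (auto simp: uedges_def)
    have "e \<in> E"
      using e(2) by simp
    then have "r E \<in> E"
      unfolding r_def by (rule someI)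
    then show "r E \<in> arcs G" "E = {r E, bar (r E)}"
      using e by auto
  qed
  have \<omega>_bar: "[\<omega> (bar e) = - \<omega> e] (mod int m)" if "e \<in> arcs G" for e
    using \<omega> that by (simp add: H1_def chains_def cong_def)
  have fin: "finite (uedges G bar)"
    by (simp add: uedges_def)
  let ?d = "\<lambda>e. f (head G e) - f (tail G e)"
  have "(\<Sum>E \<in> uedges G bar. ?d (r E) * \<omega> (r E)) =
    (\<Sum>E \<in> uedges G bar. f (head G (r E)) * \<omega> (r E) + f (tail G (r E)) * - \<omega> (r E))"
    by (simp add: algebra_simps)
  also have "[\<dots> = (\<Sum>E \<in> uedges G bar. f (head G (r E)) * \<omega> (r E) + f (head G (bar (r E))) * \<omega> (bar (r E)))]
    (mod int m)"
  proof (intro cong_sum cong_add cong_refl)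
    fix E assume "E \<in> uedges G bar"
    then have rE: "r E \<in> arcs G"
      by (rule r)
    then have head: "head G (bar (r E)) = tail G (r E)"
      by simp
    show "[f (tail G (r E)) * - \<omega> (r E) = f (head G (bar (r E))) * \<omega> (bar (r E))] (mod int m)"
      unfolding head by (rule cong_mult[OF cong_refl cong_sym[OF \<omega>_bar[OF rE]]])
  qed
  also have "(\<Sum>E \<in> uedges G bar. f (head G (r E)) * \<omega> (r E) + f (head G (bar (r E))) * \<omega> (bar (r E))) =
    (\<Sum>E \<in> uedges G bar. \<Sum>e \<in> E. f (head G e) * \<omega> e)"
  proof (intro sum.cong refl)
    fix E assume E: "E \<in> uedges G bar"
    have "r E \<noteq> bar (r E)"
      using r(1)[OF E] arev_dom by metis
    then have "(\<Sum>e \<in> {r E, bar (r E)}. f (head G e) * \<omega> e) =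
      f (head G (r E)) * \<omega> (r E) + f (head G (bar (r E))) * \<omega> (bar (r E))"
      by simp
    then show "f (head G (r E)) * \<omega> (r E) + f (head G (bar (r E))) * \<omega> (bar (r E)) = (\<Sum>e \<in> E. f (head G e) * \<omega> e)"
      using r(2)[OF E] by simp
  qed
  \<comment> \<open>\<open>bar\<close> is an involution, so distinct unoriented edges are disjoint
    and the double sum runs over all arcs.\<close>
  also have "\<dots> = (\<Sum>e \<in> \<Union>(uedges G bar). f (head G e) * \<omega> e)"
  proof (rule sum.Union_disjoint[symmetric, unfolded comp_def])
    show "\<forall>A \<in> uedges G bar. finite A"
      by (auto simp: uedges_def)
    have "bar a = bar b \<longleftrightarrow> a = b" for a b
      by (metis arev_arev)
    then show "\<forall>A \<in> uedges G bar. \<forall>B \<in> uedges G bar. A \<noteq> B \<longrightarrow> A \<inter> B = {}"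
      by (auto simp: uedges_def)
  qed
  also have "\<Union>(uedges G bar) = arcs G"
    by (auto simp: uedges_def)
  also have "(\<Sum>e \<in> arcs G. f (head G e) * \<omega> e) = (\<Sum>w \<in> verts G. \<Sum>e \<in> {e \<in> arcs G. head G e = w}. f (head G e) * \<omega> e)"
    by (rule sum.group[symmetric]) auto
  also have "\<dots> = (\<Sum>w \<in> verts G. f w * (\<Sum>e \<in> in_arcs G w. \<omega> e))"
    by (intro sum.cong refl) (simp add: in_arcs_def sum_distrib_left)
  also have "[\<dots> = (\<Sum>w \<in> verts G. f w * 0)] (mod int m)"
    using \<omega> by (intro cong_sum cong_mult cong_refl) (auto simp: H1_def)
  finally have "[0 = (\<Sum>E \<in> uedges G bar. ?d (r E) * \<omega> (r E))] (mod int m)"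
    by (simp add: cong_sym_eq)
  then have 1: "(\<Sum>E \<in> uedges G bar. ?d (r E) * \<omega> (r E)) \<in> D"
    by (rule int_subgroup_cong[OF D]) (use D in \<open>simp add: int_subgroup_def\<close>)
  have 2: "(\<Sum>E \<in> uedges G bar. (\<gamma> (r E) - ?d (r E)) * \<omega> (r E)) \<in> D"
    using f r(1) D(1) by (intro int_subgroup_sum) (auto simp: mult.commute[of _ "\<omega> _"] intro: int_subgroup_mult)
  have "(\<Sum>E \<in> uedges G bar. \<gamma> (r E) * \<omega> (r E)) =
    (\<Sum>E \<in> uedges G bar. (\<gamma> (r E) - ?d (r E)) * \<omega> (r E)) + (\<Sum>E \<in> uedges G bar. ?d (r E) * \<omega> (r E))"
    by (simp add: sum.distrib[symmetric] algebra_simps)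
  then have "(\<Sum>E \<in> uedges G bar. \<gamma> (r E) * \<omega> (r E)) \<in> D"
    using int_subgroup_add[OF D(1) 2 1] by simp
  moreover have "[(\<Sum>E \<in> uedges G bar. \<gamma> (r E) * \<omega> (r E)) = phi m G bar \<gamma> \<omega>] (mod int m)"
    by (simp add: phi_def r_def Let_def cong_def)
  ultimately show ?thesis
    using int_subgroup_cong[OF D] by blast
qed

lemma one_mem_of_closed_sums:
  assumes surj: "phi m G bar \<gamma> ` H1 m G bar = carrier (integer_mod_group m)"
    and D: "int_subgroup D" "int m \<in> D" and v: "v \<in> verts G"
    and closed: "\<And>p. awalk v p v \<Longrightarrow> wsum p \<in> D"
  shows "1 \<in> D"
proof -
  have "\<gamma> (bar e) + \<gamma> e \<in> D" if "e \<in> arcs G" for e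
  proof -
    have "[0 = \<gamma> (bar e) + \<gamma> e] (mod int m)"
      using cong_add[OF gamma_bar[OF that] cong_refl[of "\<gamma> e"]] by (simp add: cong_sym_eq)
    then show ?thesis
      by (rule int_subgroup_cong[OF D]) (use D in \<open>simp add: int_subgroup_def\<close>)
  qed
  then obtain f where f: "\<forall>e \<in> arcs G. \<gamma> e - (f (head G e) - f (tail G e)) \<in> D"
    using potential_exists[OF D(1) v, of \<gamma>] closed by (auto simp: wsum_def)
  show ?thesis
  \<comment> \<open>For \<open>m = 1\<close> the value 1 is not in the carrier, but then
    \<open>int m\<close> itself is 1.\<close>
  proof (cases "m = 1")
    case True
    then show ?thesis using D by simp
  next
    case False
    then have "1 \<in> phi m G bar \<gamma> ` H1 m G bar"
      using surj by (simp add: integer_mod_group_1)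
    then show ?thesis
      using phi_mem[OF D, of f] f by force
  qed
qed

end

section \<open>Multiples of \<open>e_i - e_j\<close> with trivial permutation\<close>

locale twist_wilson = twist G bar m \<gamma>
  for G :: "('v, 'e) pre_digraph" and bar :: "'e \<Rightarrow> 'e" and m :: nat and \<gamma> :: "'e \<Rightarrow> int" +
  assumes wilson: "P.wilson"
    and hamiltonian_chord: "P.cyc cs \<Longrightarrow> set cs = verts G \<Longrightarrow> P.chord cs"
    and surj: "phi m G bar \<gamma> ` H1 m G bar = carrier (integer_mod_group m)"
begin

text \<open>A graph on three vertices would be a triangle, which has no chord. The fourth vertex
  provides the third token for the 3-cycles used below.\<close>

lemma card_verts: "card (verts G) \<ge> 4"
proof (rule ccontr)
  assume "\<not> ?thesis"
  then have c: "card (verts G) = 3"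
    using P.card_V by simp
  obtain cs where cs: "P.cyc cs"
    using P.cyc_exists by blast
  then have "card (set cs) \<ge> 3"
    using distinct_card[of cs] by (simp add: P.cyc_def)
  then have eq: "set cs = verts G"
    using c P.cyc_V[OF cs] card_seteq[OF P.finite_V] by auto
  then have "length cs = 3"
    using c cs distinct_card[of cs] by (simp add: P.cyc_def)
  moreover have "P.chord cs"
    using hamiltonian_chord[OF cs eq] .
  ultimately show False
    by (auto simp: P.chord_def)
qed

lemma cyc3_reach:
  assumes "u \<in> verts G" "a \<in> verts G - {u}" "b \<in> verts G - {u}" "c \<in> verts G - {u}"
    "a \<noteq> b" "a \<noteq> c" "b \<noteq> c"
  obtains f where "reach u u f (cyc3 a b c)"
proof -
  interpret H: perm_group "verts G - {u}" "P.grp u"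
    by (rule P.perm_group_grp[OF assms(1)])
  have "cyc3 a b c \<in> P.grp u"
    using H.fullD[of "verts G - {u}"] wilson assms by (simp add: P.wilson_def)
  then show thesis
    using that grp_reach by blast
qed

definition dif :: "'v \<Rightarrow> 'v \<Rightarrow> int \<Rightarrow> 'v \<Rightarrow> int" where
  "dif i j s = (\<lambda>x. (if x = i then s else 0) - (if x = j then s else 0))"

lemma dif_conj:
  assumes "reach u w g \<tau>" "reach u u (dif i j s) id"
  shows "reach w w (dif (\<tau> i) (\<tau> j) s) id"
proof -
  have "inv_into UNIV \<tau> x = y \<longleftrightarrow> x = \<tau> y" for x y
    using reach_bij[OF assms(1)] by (metis bij_inv_eq_iff)
  then show ?thesis
    using reach_conj[OF assms] by (simp add: dif_def)
qed

text \<open>Named after the roots \<open>e_i - e_j\<close> of type A. Asking for all pairs at once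
  makes the set independent of the empty vertex, see \<open>root_scalars_move\<close>.\<close>

definition root_scalars :: "'v \<Rightarrow> int set" where
  "root_scalars u = {s. \<forall>i \<in> verts G - {u}. \<forall>j \<in> verts G - {u}. reach u u (dif i j s) id}"

lemma root_scalars_subgroup:
  assumes "u \<in> verts G"
  shows "int_subgroup (root_scalars u)" "int m \<in> root_scalars u"
proof -
  have 0: "dif i j 0 = (\<lambda>x. 0)" for i j
    by (simp add: dif_def fun_eq_iff)
  have "a - b \<in> root_scalars u" if ab: "a \<in> root_scalars u" "b \<in> root_scalars u" for a b
    unfolding root_scalars_def
  proof (intro CollectI ballI)
    fix i j assume "i \<in> verts G - {u}" "j \<in> verts G - {u}"
    then have "reach u u (dif i j a) id" "reach u u (dif i j b) id"
      using ab by (auto simp: root_scalars_def)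
    then have "reach u u (\<lambda>x. - dif i j b x + dif i j a x) id"
      by (intro reach_add reach_neg) auto
    then show "reach u u (dif i j (a - b)) id"
      by (rule reach_cong) (auto simp: dif_def)
  qed
  then show "int_subgroup (root_scalars u)"
    using reach_id[OF assms] 0 by (simp add: int_subgroup_def) (simp add: root_scalars_def 0)
  show "int m \<in> root_scalars u"
    unfolding root_scalars_def
    by (auto intro!: reach_cong[OF reach_id[OF assms]] simp: dif_def cong_def)
qed

lemma root_scalars_move:
  assumes "u \<in> verts G" "w \<in> verts G" "s \<in> root_scalars u"
  shows "s \<in> root_scalars w"
proof -
  obtain p where p: "awalk u p w"
    using awalk_exists assms by blast
  have perm: "pperm p permutes verts G"
    using p by (intro pperm_permutes) auto
  have "\<exists>i'. i' \<in> verts G - {u} \<and> pperm p i' = i" if "i \<in> verts G - {w}" for i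
    using that permutes_image[OF perm] pperm_end[OF p] by (metis DiffD1 DiffD2 DiffI imageE singletonI singletonD)
  then show ?thesis
    using assms(3) dif_conj[OF reach_awalk[OF p]] unfolding root_scalars_def by (smt (verit) mem_Collect_eq)
qed

text \<open>That \<open>s (e_a - e_b)\<close> occurs is an equivalence relation between
  \<open>a\<close> and \<open>b\<close>, and conjugation with the 3-cycle \<open>(i j k)\<close>
  turns the pair \<open>i, j\<close> into \<open>j, k\<close>. So one pair of tokens gives
  all.\<close>

lemma root_scalarsI:
  assumes u: "u \<in> verts G" and ij: "i \<in> verts G - {u}" "j \<in> verts G - {u}" "i \<noteq> j"
    and r: "reach u u (dif i j s) id"
  shows "s \<in> root_scalars u"
proof -
  define R where "R a b \<longleftrightarrow> reach u u (dif a b s) id" for a b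
  have sym: "R b a" if "R a b" for a b
    using reach_neg[OF that[unfolded R_def]] unfolding R_def by (rule reach_cong) (simp add: dif_def)
  have trans: "R a c" if "R a b" "R b c" for a b c
    using reach_add[OF that[unfolded R_def]] unfolding R_def by (rule reach_cong) (auto simp: dif_def)
  have refl: "R a a" for a
    unfolding R_def by (rule reach_cong[OF reach_id[OF u]]) (simp add: dif_def)
  have "R j k" if k: "k \<in> verts G - {u}" for k
  proof -
    consider "k = j" | "k = i" | "k \<noteq> i" "k \<noteq> j"
      by blast
    then show ?thesis
    proof cases
      case 3
      obtain f where f: "reach u u f (cyc3 i j k)"
        by (rule cyc3_reach[OF u ij(1,2) k ij(3)]) (use 3 in auto)
      from dif_conj[OF f r] show ?thesis
        using 3 ij by (simp add: R_def cyc3_apply)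
    qed (use refl sym r R_def in auto)
  qed
  then show ?thesis
    using sym trans unfolding root_scalars_def R_def by blast
qed

text \<open>The 3-cycle \<open>(i j k)\<close> moves \<open>S\<close> to a set with one element
  exchanged for \<open>j\<close>, whether or not \<open>k\<close> is in \<open>S\<close>. The
  difference of the two vectors is \<open>s\<close> at one token and \<open>- s\<close> at
  another.\<close>

lemma root_scalars_of_indicator:
  assumes u: "u \<in> verts G" and S: "S \<subseteq> verts G - {u}" "i \<in> S" "j \<in> verts G - {u}" "j \<notin> S"
    and r: "reach u u (\<lambda>x. if x \<in> S then s else 0) id"
  shows "s \<in> root_scalars u"
proof -
  have i: "i \<in> verts G - {u}" and ij: "i \<noteq> j"
    using S by auto
  have "\<not> verts G \<subseteq> {u, i, j}"
    using card_verts card_mono[of "{u, i, j}" "verts G"] card_insert_le_m1[of 3 "{i, j}" u]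
      card_insert_le_m1[of 2 "{j}" i] by auto
  then obtain k where k: "k \<in> verts G - {u}" "k \<noteq> i" "k \<noteq> j"
    by blast
  obtain f where f: "reach u u f (cyc3 i j k)"
    by (rule cyc3_reach[OF u i S(3) k(1) ij]) (use k in auto)
  have "inv_into UNIV (cyc3 i j k) = cyc3 k j i"
    by (rule inv_cyc3)
  then have "reach u u (\<lambda>x. if cyc3 k j i x \<in> S then s else 0) id"
    using reach_conj[OF f r] by simp
  from reach_add[OF reach_neg[OF this] r]
  have diff: "reach u u (\<lambda>x. - (if cyc3 k j i x \<in> S then s else 0) + (if x \<in> S then s else 0)) id" .
  have c: "cyc3 k j i x = (if x = k then j else if x = j then i else if x = i then k else x)" for x
    using k ij by (auto simp: cyc3_apply)
  show ?thesis
  proof (cases "k \<in> S")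
    case True
    have "reach u u (dif k j s) id"
      by (rule reach_cong[OF diff]) (use True S c ij k in \<open>auto simp: dif_def\<close>)
    then show ?thesis
      using root_scalarsI[OF u k(1) S(3) k(3)] by blast
  next
    case False
    have "reach u u (dif i j s) id"
      by (rule reach_cong[OF diff]) (use False S c ij k in \<open>auto simp: dif_def\<close>)
    then show ?thesis
      using root_scalarsI[OF u i S(3) ij] by blast
  qed
qed

lemma reach_power:
  assumes "reach u u f \<sigma>"
  shows "reach u u (\<lambda>x. \<Sum>i<k. f ((inv_into UNIV \<sigma> ^^ i) x)) (\<sigma> ^^ k)"
proof (induction k)
  case 0
  have "u \<in> verts G"
    using assms by (auto simp: reach_def)
  then show ?case
    using reach_id by (simp only: funpow.simps lessThan_0 sum.empty)
next
  case (Suc k)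
  have eq: "(\<lambda>x. \<Sum>i<Suc k. f ((inv_into UNIV \<sigma> ^^ i) x)) =
    (\<lambda>x. f x + (\<Sum>i<k. f ((inv_into UNIV \<sigma> ^^ i) (inv_into UNIV \<sigma> x))))"
    by (rule ext, subst sum.lessThan_Suc_shift) (simp only: funpow_Suc_right o_apply funpow_0)
  show ?case
    using reach_comp[OF Suc assms] by (simp only: eq funpow.simps)
qed

text \<open>The walk rotates the tokens on \<open>xs\<close>. In the power with exponent
  \<open>length xs\<close> the permutation is trivial and each of these tokens has collected every
  entry once, so the vector is constant on \<open>xs\<close>. The length bound leaves a token off
  the cycle for \<open>root_scalars_of_indicator\<close>.\<close>

lemma simple_cycle_scalar:
  assumes p: "awalk u p u" and d: "distinct (map (tail G) p)" and len: "length p < card (verts G)"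
  shows "wsum p \<in> root_scalars u"
proof -
  have u: "u \<in> verts G" and arcs: "set p \<subseteq> arcs G"
    using p by auto
  consider "p = []" | e where "p = [e]" | e e' q where "p = e # e' # q"
    by (metis neq_Nil_conv)
  then show ?thesis
  proof cases
    case 1
    then show ?thesis
      using root_scalars_subgroup(1)[OF u] by (simp add: int_subgroup_def)
  next
    case 2
    then show ?thesis
      using p no_loops[of e] by (auto simp: awalk_Cons_iff awalk_Nil_iff)
  next
    case 3
    define xs where "xs = map (tail G) (e' # q)"
    have verts: "awalk_verts u p = u # xs @ [u]"
      using p 3 by (auto simp: awalk_verts_conv xs_def awalk_Cons_iff dest: awlast_of_awalk)
    have "set (awalk_verts u p) \<subseteq> verts G"
      using p by blast
    then have vsub: "set xs \<subseteq> verts G"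
      using verts by auto
    have dx: "distinct (u # xs)" and ne: "xs \<noteq> []"
      using d 3 p by (auto simp: xs_def awalk_Cons_iff)
    have pp: "pperm p = cycle_of_list (rev xs)"
      using pperm_wperm[of u p u] p verts wperm_closed[OF dx ne] by (simp add: awalk_def)
    have "rev (awalk_verts u p) = u # rev xs @ [u]"
      using verts by simp
    then have inv: "inv_into UNIV (pperm p) = cycle_of_list xs"
      using pperm_wperm[of u p u] p wperm_rev[of "awalk_verts u p"] wperm_closed[of u "rev xs"] dx ne
      by (simp add: awalk_def)
    have dr: "distinct (rev xs)" and dxs: "distinct xs"
      using dx by auto
    let ?r = "length xs"
    have id: "pperm p ^^ ?r = id"
      using cycle_is_id_root[OF dr] pp by simp
    from reach_power[OF reach_awalk[OF p], of ?r]
    have pow: "reach u u (\<lambda>x. \<Sum>i<?r. raw p ((cycle_of_list xs ^^ i) x)) id"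
      unfolding id inv .
    have x0: "raw p x = 0" if "x \<notin> set xs" for x
    proof (cases "x = u \<or> x \<notin> verts G")
      case True
      then show ?thesis
        using raw_end[OF p] raw_outside[OF arcs] by auto
    next
      case False
      have *: "raw q y = 0" if "awalk w q z" "y \<notin> set (awalk_verts w q)" for w q z y
        using that
      proof (induction q arbitrary: w)
        case (Cons a q)
        then have a: "awalk (head G a) q z" "y \<notin> set (awalk_verts (head G a) q)" "y \<noteq> tail G a"
          by (auto simp: awalk_Cons_iff)
        have "pperm q y = y"
          using pperm_wperm[of "head G a" q z] a(1) wperm_outside[OF a(2)] by (simp add: awalk_def)
        then have "inv_into UNIV (pperm q) y = y"
          by (simp add: inv_pperm_eq_iff)
        then show ?case
          using Cons.IH[OF a(1,2)] a(3) by simp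
      qed simp
      show ?thesis
        by (rule *[OF p]) (use verts False that in auto)
    qed
    \<comment> \<open>The orbit of \<open>x\<close> under the rotation runs once through
      \<open>xs\<close>, and the entries vanish elsewhere.\<close>
    have total: "(\<Sum>i<?r. raw p ((cycle_of_list xs ^^ i) x)) = wsum p" if x: "x \<in> set xs" for x
    proof -
      obtain k where k: "k < ?r" "x = xs ! k"
        using x by (metis in_set_conv_nth)
      have "(cycle_of_list xs ^^ i) x = rotate k xs ! i" if "i < ?r" for i
      proof -
        have "(cycle_of_list xs ^^ i) x = rotate i xs ! k"
          using cyclic_rotation[OF dxs, of i] k by (metis length_map nth_map)
        then show ?thesis
          using k that by (simp add: nth_rotate add.commute)
      qed
      then have "(\<Sum>i<?r. raw p ((cycle_of_list xs ^^ i) x)) = (\<Sum>i<?r. map (raw p) (rotate k xs) ! i)"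
        by simp
      also have "\<dots> = sum_list (map (raw p) (rotate k xs))"
        by (simp add: sum_list_sum_nth atLeast0LessThan)
      also have "\<dots> = sum (raw p) (set (rotate k xs))"
        using dxs by (intro sum_list_distinct_conv_sum_set) simp
      also have "\<dots> = sum (raw p) (set xs)"
        by simp
      also have "\<dots> = sum (raw p) (verts G)"
        using x0 vsub by (intro sum.mono_neutral_left) auto
      finally show ?thesis
        using sum_raw[OF arcs] by simp
    qed
    have "reach u u (\<lambda>x. if x \<in> set xs then wsum p else 0) id"
    proof (rule reach_cong[OF pow])
      fix x
      have "(cycle_of_list xs ^^ i) x = x" if "x \<notin> set xs" for i
        using that by (induction i) (simp_all add: id_outside_supp)
      then show "[(\<Sum>i<?r. raw p ((cycle_of_list xs ^^ i) x)) = (if x \<in> set xs then wsum p else 0)] (mod int m)"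
        using total x0 by auto
    qed
    moreover have sub: "set xs \<subseteq> verts G - {u}"
      using dx vsub by auto
    moreover have "\<exists>j. j \<in> verts G - {u} \<and> j \<notin> set xs"
    proof (rule ccontr)
      assume "\<not> ?thesis"
      then have "verts G \<subseteq> set (u # xs)"
        by auto
      then have "card (verts G) \<le> length (u # xs)"
        by (meson card_length card_mono finite_set le_trans)
      then show False
        using len 3 by (simp add: xs_def)
    qed
    ultimately show ?thesis
      using root_scalars_of_indicator[OF u sub hd_in_set[OF ne]] by blast
  qed
qed

text \<open>The induction covers all base vertices at once, because the pieces of a walk start
  elsewhere and \<open>root_scalars_move\<close> brings their scalars back. A repeated vertex splits
  the walk into two shorter closed ones; without repetition only the Hamiltonian case
  remains.\<close>

lemma closed_walk_scalar:
  assumes "awalk u p u"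
  shows "wsum p \<in> root_scalars u"
  using assms
proof (induction "length p" arbitrary: u p rule: less_induct)
  case less
  note p = less.prems
  have u: "u \<in> verts G" and arcs: "set p \<subseteq> arcs G"
    using p by auto
  have IH: "wsum q \<in> root_scalars u" if "length q < length p" "awalk w q w" for q w
    using root_scalars_move[OF _ u less.hyps[OF that]] that(2) by auto
  note sub = root_scalars_subgroup[OF u]
  show ?case
  proof (cases "distinct (map (tail G) p)")
    case False
    then obtain as bs cs y where "map (tail G) p = as @ y # bs @ y # cs"
      using not_distinct_decomp by (metis append_Cons append_Nil)
    then obtain p1 q where q: "p = p1 @ q" "y # bs @ y # cs = map (tail G) q"
      using map_eq_append_conv by metis
    then obtain e q' where q': "q = e # q'" "tail G e = y" "map (tail G) q' = bs @ y # cs"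
      by (cases q) auto
    then obtain p2 q'' where q'': "q' = p2 @ q''" "y # cs = map (tail G) q''"
      using map_eq_append_conv by metis
    then obtain e' p3 where e': "q'' = e' # p3" "tail G e' = y"
      by (cases q'') auto
    note split = q(1)[unfolded q'(1) q''(1) e'(1)] q'(2) e'(2)
    have "awalk u (p1 @ e' # p3) u" "awalk y (e # p2) y"
      using p split by (auto simp: awalk_Cons_iff)
    then have "wsum (p1 @ e' # p3) \<in> root_scalars u" "wsum (e # p2) \<in> root_scalars u"
      using IH[of "p1 @ e' # p3" u] IH[of "e # p2" y] split by auto
    then show ?thesis
      using int_subgroup_add[OF sub(1)] split(1) by (fastforce simp: algebra_simps)
  next
    case d: True
    show ?thesis
    proof (cases "length p < card (verts G)")
      case True
      then show ?thesis
        using simple_cycle_scalar[OF p d] by blast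
    next
      case False
      let ?cs = "map (tail G) p"
      have ne: "p \<noteq> []"
        using False card_verts by auto
      have "set ?cs \<subseteq> verts G"
        using arcs by auto
      moreover have "card (set ?cs) = length p"
        using distinct_card[OF d] by simp
      ultimately have set: "set ?cs = verts G"
        using False card_seteq[OF P.finite_V, of "set ?cs"] by auto
      then have k: "length p = card (verts G)"
        using \<open>card (set ?cs) = length p\<close> by simp
      have "awalk_verts u p = ?cs @ [u]"
        using p ne by (auto simp: awalk_verts_conv dest: awlast_of_awalk)
      then have "successively adj (?cs @ [u])"
        using awalk_imp_walk[OF p] by (simp add: P.walk_def)
      moreover have "hd ?cs = u"
        using p ne by (cases p) (auto simp: awalk_Cons_iff)
      ultimately have cyc: "P.cyc ?cs"
        using d k card_verts ne by (auto simp: P.cyc_def successively_append_iff)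
      obtain i j where ij: "i < j" "j < length p" "j \<noteq> Suc i" "\<not> (i = 0 \<and> Suc j = length p)"
        "adj (?cs ! i) (?cs ! j)"
        using hamiltonian_chord[OF cyc set] by (auto simp: P.chord_def)
      then obtain a where a: "a \<in> arcs G" "tail G a = ?cs ! i" "head G a = ?cs ! j"
        by (auto simp: adj_def)
      define p1 where "p1 = take i p"
      define p2 where "p2 = take (j - i) (drop i p)"
      define p3 where "p3 = drop j p"
      have len: "length p1 = i" "length p2 = j - i" "length p3 = length p - j"
        using ij by (simp_all add: p1_def p2_def p3_def)
      have split: "p = p1 @ p2 @ p3"
        using ij by (simp add: p1_def p2_def p3_def) (metis append_take_drop_id drop_drop le_add_diff_inverse2 less_imp_le)
      obtain x y where xy: "awalk u p1 x" "awalk x p2 y" "awalk y p3 u"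
        using p split by auto
      have "p2 \<noteq> []" "p3 \<noteq> []"
        using len ij by auto
      moreover have "hd p2 = p ! i" "hd p3 = p ! j"
        using ij by (simp_all add: p2_def p3_def hd_drop_conv_nth)
      ultimately have "x = ?cs ! i" "y = ?cs ! j"
        using xy(2,3) ij by (cases p2; cases p3; auto simp: awalk_Cons_iff)+
      then have closed: "awalk u (p1 @ a # p3) u" "awalk y (bar a # p2) y"
        using xy a by (auto simp: awalk_Cons_iff)
      \<comment> \<open>The chord skips at least one vertex on either side:
        \<open>j \<noteq> Suc i\<close> shortens the first walk, and the exclusion of the closing
        edge the second.\<close>
      have "length (p1 @ a # p3) < length p" "length (bar a # p2) < length p"
        using ij(1-4) by (auto simp: len)
      from IH[OF this(1) closed(1)] IH[OF this(2) closed(2)]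
      have "wsum (p1 @ a # p3) \<in> root_scalars u" "wsum (bar a # p2) \<in> root_scalars u" .
      from int_subgroup_add[OF sub(1) this]
      have "wsum p + (\<gamma> (bar a) + \<gamma> a) \<in> root_scalars u"
        using split by (simp add: algebra_simps)
      \<comment> \<open>The chord is traversed once in each direction, and its twists cancel modulo
        \<open>m\<close>.\<close>
      moreover have "[wsum p + (\<gamma> (bar a) + \<gamma> a) = wsum p + (- \<gamma> a + \<gamma> a)] (mod int m)"
        by (intro cong_add cong_refl gamma_bar a)
      ultimately show ?thesis
        using int_subgroup_cong[OF sub] by simp
    qed
  qed
qed

lemma root_scalars_UNIV:
  assumes "v \<in> verts G"
  shows "s \<in> root_scalars v"
proof -
  have "1 \<in> root_scalars v"
    using one_mem_of_closed_sums[OF surj root_scalars_subgroup[OF assms] assms] closed_walk_scalar by blast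
  then show ?thesis
    using int_subgroup_mult[OF root_scalars_subgroup(1)[OF assms], of 1 s] by simp
qed

end

section \<open>Small bipartite graphs\<close>

context puzzle
begin

text \<open>On at most five vertices a 2-coloured graph can only have 4-cycles. A chord would join
  vertices of equal colour, so there is a fifth vertex, joined to two opposite vertices. This is
  \<open>K_{2,3}\<close>, and any extra edge is monochromatic again. Six vertices mean five tokens,
  as \<open>even_reach_total\<close> requires.\<close>

lemma bipartite_card:
  assumes c: "\<And>x y. E x y \<Longrightarrow> c x \<noteq> (c y :: bool)"
    and not_cycle: "\<And>cs. cyc cs \<Longrightarrow> set cs = V \<Longrightarrow> chord cs"
    and not_k23: "\<And>u w a b d. \<lbrakk>distinct [u, w, a, b, d]; V = {u, w, a, b, d};
        E u a; E u b; E u d; E w a; E w b; E w d\<rbrakk> \<Longrightarrow> E u w \<or> E a b \<or> E a d \<or> E b d"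
  shows "card V \<ge> 6"
proof (rule ccontr)
  assume small: "\<not> ?thesis"
  obtain cs where cs: "cyc cs"
    using cyc_exists by blast
  have d: "distinct cs"
    using cs by (simp add: cyc_def)
  have sub: "set cs \<subseteq> V"
    using cyc_V[OF cs] .
  then have "length cs \<le> 5"
    using small card_mono[OF finite_V sub] distinct_card[OF d] by simp
  then have "length cs = 3 \<or> length cs = 4 \<or> length cs = 5"
    using cs by (auto simp: cyc_def)
  then obtain a b x y where csl: "cs = [a, b, x, y]"
  proof (elim disjE)
    assume "length cs = 3"
    then obtain a b x where "cs = [a, b, x]"
      by (auto simp: length_Suc_conv eval_nat_numeral)
    then have "E a b" "E b x" "E x a"
      using cs by (auto simp: cyc_def)
    then show thesis
      using c by blast
  next
    assume "length cs = 5"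
    then obtain a b x y z where "cs = [a, b, x, y, z]"
      by (auto simp: length_Suc_conv eval_nat_numeral)
    then have "E a b" "E b x" "E x y" "E y z" "E z a"
      using cs by (auto simp: cyc_def)
    then show thesis
      using c by blast
  qed (auto simp: length_Suc_conv eval_nat_numeral)
  have E: "E a b" "E b x" "E x y" "E y a" and dd: "distinct [a, b, x, y]"
    using cs by (auto simp: cyc_def csl)
  have col: "c a = c x" "c b = c y"
    using c[OF E(1)] c[OF E(2)] c[OF E(3)] by auto
  have "set cs \<noteq> V"
  proof
    assume "set cs = V"
    from not_cycle[OF cs this] obtain i j where ij: "i < j" "j < 4" "j \<noteq> Suc i"
      "\<not> (i = 0 \<and> Suc j = 4)" "E (cs ! i) (cs ! j)"
      by (auto simp: chord_def csl)
    then have "i = 0 \<and> j = 2 \<or> i = 1 \<and> j = 3"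
      by presburger
    then have "E a x \<or> E b y"
      using ij(5) by (auto simp: csl)
    then show False
      using c col by blast
  qed
  then have psub: "set cs \<subset> V"
    using sub by blast
  have card4: "card (set cs) = 4"
    using distinct_card[OF d] by (simp add: csl)
  obtain p es q where ear: "p \<in> set cs" "q \<in> set cs" "p \<noteq> q" "es \<noteq> []" "distinct es"
    "set es \<subseteq> V - set cs" "successively E (p # es @ [q])"
    by (rule ear_exists[OF psub]) (use card4 in auto)
  have "card (V - set cs) \<le> Suc 0"
    using small card_Diff_subset[OF _ sub] card4 by simp
  then have uniq: "\<forall>a \<in> V - set cs. \<forall>b \<in> V - set cs. a = b"
    using finite_V by (simp add: card_le_Suc0_iff_eq)
  define m where "m = hd es"
  have m: "m \<in> set es"
    using ear(4) by (simp add: m_def)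
  then have mV: "m \<in> V - set cs"
    using ear(6) by blast
  then have one: "V - set cs = {m}"
    using uniq by blast
  have es: "set es = {m}"
    using ear(6) m unfolding one by blast
  then have "length es = 1"
    using distinct_card[OF ear(5)] by simp
  then have "es = [m]"
    by (cases es) (simp_all add: m_def)
  then have mE: "E p m" "E m q"
    using ear(7) by auto
  then have "c p = c q"
    using c by blast
  then have pq: "{p, q} = {a, x} \<or> {p, q} = {b, y}"
    using ear(1-3) col c[OF E(1)] by (auto simp: csl)
  have V: "V = {a, x, b, y, m}" "m \<notin> set cs"
    using one sub mV by (auto simp: csl)
  from pq show False
  proof
    assume "{p, q} = {a, x}"
    then have "E a m" "E x m"
      using mE E_sym by (auto simp: doubleton_eq_iff)
    moreover from this have "c m \<noteq> c a"
      using c by blast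
    ultimately have "E a x \<or> E b y \<or> E b m \<or> E y m"
      by (intro not_k23) (use V E E[THEN E_sym] dd in \<open>auto simp: csl\<close>)
    then show False
      using c[of a x] c[of b y] c[of b m] c[of y m] col \<open>c m \<noteq> c a\<close> c[OF E(1)] by argo
  next
    assume "{p, q} = {b, y}"
    then have "E b m" "E y m"
      using mE E_sym by (auto simp: doubleton_eq_iff)
    moreover from this have "c m \<noteq> c b"
      using c by blast
    ultimately have "E b y \<or> E a x \<or> E a m \<or> E x m"
      by (intro not_k23) (use V E E[THEN E_sym] dd in \<open>auto simp: csl\<close>)
    then show False
      using c[of a x] c[of b y] c[of a m] c[of x m] col \<open>c m \<noteq> c b\<close> c[OF E(1)] by argo
  qed
qed

end

section \<open>Coordinate sums and parities of closed walks\<close>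

context twist
begin

lemma reach_permutes:
  assumes "reach u w f \<sigma>"
  shows "\<sigma> permutes verts G"
  using assms pperm_permutes by (auto simp: reach_def)

lemma reach_zero:
  assumes "reach u u f \<sigma>" "x \<notin> verts G - {u}"
  shows "[f x = 0] (mod int m)"
proof -
  obtain p where p: "awalk u p u" "[raw p x = f x] (mod int m)"
    using assms(1) by (auto simp: reach_def)
  moreover have "raw p x = 0"
    using raw_end[OF p(1)] raw_outside[of p x] p(1) assms(2) by auto
  ultimately show ?thesis
    by (simp add: cong_sym_eq)
qed

text \<open>The vector \<open>f\<close> may be changed by multiples of \<open>m\<close>, so only the
  class of \<open>s\<close> modulo \<open>m\<close> matters. With integer representatives the sums
  add up without reduction.\<close>

definition reach_total :: "'v \<Rightarrow> int \<Rightarrow> ('v \<Rightarrow> 'v) \<Rightarrow> bool" where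
  "reach_total u s \<sigma> \<longleftrightarrow> (\<exists>f. reach u u f \<sigma> \<and> (\<Sum>x \<in> verts G. f x) = s)"

lemma reach_total_comp:
  assumes "reach_total u s \<sigma>" "reach_total u t \<tau>"
  shows "reach_total u (s + t) (\<tau> \<circ> \<sigma>)"
proof -
  obtain f g where f: "reach u u f \<sigma>" "(\<Sum>x \<in> verts G. f x) = s"
    and g: "reach u u g \<tau>" "(\<Sum>x \<in> verts G. g x) = t"
    using assms by (auto simp: reach_total_def)
  have "(\<Sum>x \<in> verts G. f (inv_into UNIV \<tau> x)) = s"
    using sum.permute[OF permutes_inv[OF reach_permutes[OF g(1)]], of f] f(2) by (simp add: comp_def)
  then have "(\<Sum>x \<in> verts G. g x + f (inv_into UNIV \<tau> x)) = s + t"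
    using g(2) by (simp add: sum.distrib)
  then show ?thesis
    using reach_comp[OF f(1) g(1)] unfolding reach_total_def by blast
qed

lemma reach_total_inv:
  assumes "reach_total u s \<sigma>"
  shows "reach_total u (- s) (inv_into UNIV \<sigma>)"
proof -
  obtain f where f: "reach u u f \<sigma>" "(\<Sum>x \<in> verts G. f x) = s"
    using assms by (auto simp: reach_total_def)
  have "(\<Sum>x \<in> verts G. f (\<sigma> x)) = s"
    using sum.permute[OF reach_permutes[OF f(1)], of f] f(2) by (simp add: comp_def)
  then have "(\<Sum>x \<in> verts G. - f (\<sigma> x)) = - s"
    by (simp add: sum_negf)
  then show ?thesis
    using reach_inv[OF f(1)] unfolding reach_total_def by blast
qed

text \<open>Sums are additive and unchanged by permuting entries, so a commutator has sum 0 whatever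
  vectors accompany \<open>p\<close> and \<open>q\<close>.\<close>

lemma reach_total_commutator:
  assumes "p \<in> P.grp u" "q \<in> P.grp u"
  shows "reach_total u 0 (p \<circ> inv_into UNIV (q \<circ> p \<circ> inv_into UNIV q))"
proof -
  obtain s t where p: "reach_total u s p" and q: "reach_total u t q"
    using assms grp_reach unfolding reach_total_def by metis
  have "reach_total u ((- t + s) + t) (q \<circ> (p \<circ> inv_into UNIV q))"
    by (intro reach_total_comp reach_total_inv p q)
  then have "reach_total u s (q \<circ> p \<circ> inv_into UNIV q)"
    by (simp add: comp_assoc)
  from reach_total_comp[OF reach_total_inv[OF this] p] show ?thesis
    by simp
qed

lemma perm_group_reach_total:
  assumes "u \<in> verts G"
  shows "perm_group (verts G - {u}) {\<sigma>. reach_total u 0 \<sigma>}"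
proof
  interpret H: perm_group "verts G - {u}" "P.grp u"
    by (rule P.perm_group_grp[OF assms])
  show "finite (verts G - {u})"
    by simp
  show "g permutes verts G - {u}" if "g \<in> {\<sigma>. reach_total u 0 \<sigma>}" for g
    using that reach_grp H.permutes by (auto simp: reach_total_def)
  show "id \<in> {\<sigma>. reach_total u 0 \<sigma>}"
    using reach_id[OF assms] by (force simp: reach_total_def)
  show "g \<circ> h \<in> {\<sigma>. reach_total u 0 \<sigma>}" if "g \<in> {\<sigma>. reach_total u 0 \<sigma>}" "h \<in> {\<sigma>. reach_total u 0 \<sigma>}" for g h
    using reach_total_comp[of u 0 h 0 g] that by simp
  show "inv_into UNIV g \<in> {\<sigma>. reach_total u 0 \<sigma>}" if "g \<in> {\<sigma>. reach_total u 0 \<sigma>}" for g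
    using reach_total_inv[of u 0 g] that by simp
qed

lemma parity_colouring:
  assumes "\<And>e. e \<in> arcs G \<Longrightarrow> c (tail G e) = c (head G e) \<longleftrightarrow> even (g e :: int)" "awalk u p w"
  shows "c u = (c w :: bool) \<longleftrightarrow> even (sum_list (map g p))"
  using assms(2)
proof (induction p arbitrary: u)
  case (Cons e p)
  then have e: "e \<in> arcs G" "tail G e = u" "awalk (head G e) p w"
    by (auto simp: awalk_Cons_iff)
  show ?case
    using Cons.IH[OF e(3)] assms(1)[OF e(1)] e(2) by auto
qed (simp add: awalk_Nil_iff)

text \<open>The colouring is the parity of a potential modulo the even integers.\<close>

lemma colouring_exists:
  fixes g :: "'e \<Rightarrow> int"
  assumes v: "v \<in> verts G" and bar: "\<And>e. e \<in> arcs G \<Longrightarrow> even (g (bar e) + g e)"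
    and closed: "\<And>p. awalk v p v \<Longrightarrow> even (sum_list (map g p))"
  shows "\<exists>c :: 'v \<Rightarrow> bool. \<forall>e \<in> arcs G. c (tail G e) = c (head G e) \<longleftrightarrow> even (g e)"
proof -
  have "int_subgroup {a. even a}"
    by (simp add: int_subgroup_def)
  then obtain f where f: "\<forall>e \<in> arcs G. g e - (f (head G e) - f (tail G e)) \<in> {a. even a}"
    using potential_exists[OF _ v, of "{a. even a}" g] bar closed by auto
  show ?thesis
    by (rule exI[of _ "\<lambda>x. even (f x)"]) (use f in auto)
qed

lemma gamma_parity_bar: "even m \<Longrightarrow> e \<in> arcs G \<Longrightarrow> even (\<gamma> (bar e) + \<gamma> e)"
proof -
  assume "even m" "e \<in> arcs G"
  then have "[\<gamma> (bar e) = - \<gamma> e] (mod 2)"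
    using gamma_bar cong_dvd_modulus[of "\<gamma> (bar e)" "- \<gamma> e" "int m" 2] by auto
  then show ?thesis
    by (simp add: cong_iff_dvd_diff)
qed

lemma bipartite_iff:
  assumes v: "v \<in> verts G"
  shows "bipartite G \<longleftrightarrow> (\<forall>p. awalk v p v \<longrightarrow> even (length p))"
proof
  assume "bipartite G"
  then obtain c :: "'v \<Rightarrow> bool" where "\<And>e. e \<in> arcs G \<Longrightarrow> c (tail G e) \<noteq> c (head G e)"
    by (auto simp: bipartite_def)
  then have "\<And>e. e \<in> arcs G \<Longrightarrow> c (tail G e) = c (head G e) \<longleftrightarrow> even (1 :: int)"
    by simp
  from parity_colouring[OF this] show "\<forall>p. awalk v p v \<longrightarrow> even (length p)"
    by (force simp: sum_list_triv)
next
  assume *: "\<forall>p. awalk v p v \<longrightarrow> even (length p)"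
  have "\<exists>c :: 'v \<Rightarrow> bool. \<forall>e \<in> arcs G. c (tail G e) = c (head G e) \<longleftrightarrow> even (1 :: int)"
    by (rule colouring_exists[OF v]) (use * in \<open>auto simp: sum_list_triv\<close>)
  then show "bipartite G"
    by (auto simp: bipartite_def)
qed

lemma sum_list_succ_gamma: "sum_list (map (\<lambda>e. \<gamma> e + 1) p) = wsum p + int (length p)"
  by (induction p) simp_all

text \<open>The endpoints have equal colour exactly when \<open>\<gamma> e + 1\<close> is even. So
  the colouring is a potential for \<open>\<gamma> + 1\<close>, whose sum along a walk is twist plus
  length.\<close>

lemma twist_bipartite_iff:
  assumes v: "v \<in> verts G"
  shows "twist_bipartite m G \<gamma> \<longleftrightarrow> even m \<and> (\<forall>p. awalk v p v \<longrightarrow> even (wsum p + int (length p)))"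
proof
  assume t: "twist_bipartite m G \<gamma>"
  then obtain c :: "'v \<Rightarrow> bool" where c: "\<forall>e \<in> arcs G.
        (even (\<gamma> e) \<longrightarrow> c (tail G e) \<noteq> c (head G e)) \<and> (odd (\<gamma> e) \<longrightarrow> c (tail G e) = c (head G e))"
    unfolding twist_bipartite_def by blast
  have c': "c (tail G e) = c (head G e) \<longleftrightarrow> even (\<gamma> e + 1)" if "e \<in> arcs G" for e
    using bspec[OF c that] by (cases "even (\<gamma> e)") simp_all
  have "even (wsum p + int (length p))" if "awalk v p v" for p
    using parity_colouring[OF c' that] unfolding sum_list_succ_gamma by simp
  then show "even m \<and> (\<forall>p. awalk v p v \<longrightarrow> even (wsum p + int (length p)))"
    using t unfolding twist_bipartite_def by blast
next
  assume *: "even m \<and> (\<forall>p. awalk v p v \<longrightarrow> even (wsum p + int (length p)))"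
  have "\<exists>c :: 'v \<Rightarrow> bool. \<forall>e \<in> arcs G. c (tail G e) = c (head G e) \<longleftrightarrow> even (\<gamma> e + 1)"
  proof (rule colouring_exists[OF v])
    show "even (\<gamma> (bar e) + 1 + (\<gamma> e + 1))" if "e \<in> arcs G" for e
      using gamma_parity_bar[of e] * that by auto
    show "even (sum_list (map (\<lambda>e. \<gamma> e + 1) p))" if "awalk v p v" for p
      unfolding sum_list_succ_gamma using * that by blast
  qed
  then obtain c :: "'v \<Rightarrow> bool" where c: "\<forall>e \<in> arcs G. c (tail G e) = c (head G e) \<longleftrightarrow> even (\<gamma> e + 1)"
    by blast
  have "(even (\<gamma> e) \<longrightarrow> c (tail G e) \<noteq> c (head G e)) \<and> (odd (\<gamma> e) \<longrightarrow> c (tail G e) = c (head G e))"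
    if "e \<in> arcs G" for e
    using bspec[OF c that] by simp
  then show "twist_bipartite m G \<gamma>"
    using * unfolding twist_bipartite_def by blast
qed

lemma solvable_pairs_iff:
  "(x, \<sigma>) \<in> solvable_pairs m G \<gamma> v \<longleftrightarrow> (\<exists>p. awalk v p v \<and> x = (\<lambda>w. raw p w mod int m) \<and> \<sigma> = pperm p)"
  by (auto simp: solvable_pairs_def path_elem_eq)

lemma carrier_gen_sym_group:
  "(x, \<sigma>) \<in> carrier (gen_sym_group m X) \<longleftrightarrow>
    (\<forall>w \<in> X. 0 \<le> x w \<and> x w < int m) \<and> (\<forall>w. w \<notin> X \<longrightarrow> x w = 0) \<and> \<sigma> permutes X"
  using m_pos by (auto simp: gen_sym_group_def carrier_integer_mod_group)

lemma solvable_carrier: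
  assumes p: "awalk v p v"
  shows "(\<lambda>w. raw p w mod int m, pperm p) \<in> carrier (gen_sym_group m (verts G - {v}))"
proof -
  have v: "v \<in> verts G"
    using p by auto
  interpret H: perm_group "verts G - {v}" "P.grp v"
    by (rule P.perm_group_grp[OF v])
  have "pperm p permutes verts G - {v}"
    using reach_grp[OF reach_awalk[OF p]] by (rule H.permutes)
  moreover have "raw p w mod int m = 0" if "w \<notin> verts G - {v}" for w
    using reach_zero[OF reach_awalk[OF p] that] by (simp add: cong_def)
  ultimately show ?thesis
    using m_pos by (simp add: carrier_gen_sym_group)
qed

lemma solvable_total:
  assumes p: "awalk v p v"
  shows "[(\<Sum>w \<in> verts G - {v}. raw p w mod int m) = wsum p] (mod int m)"
proof -
  have "[(\<Sum>w \<in> verts G - {v}. raw p w mod int m) = (\<Sum>w \<in> verts G - {v}. raw p w)] (mod int m)"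
    by (intro cong_sum) (simp add: cong_def)
  also have "(\<Sum>w \<in> verts G - {v}. raw p w) = (\<Sum>w \<in> verts G. raw p w)"
    using raw_end[OF p] by (intro sum.mono_neutral_left) auto
  also have "\<dots> = wsum p"
    using p by (intro sum_raw) auto
  finally show ?thesis .
qed

end

section \<open>Reduction of a pair to its sum and sign\<close>

context twist_wilson
begin

text \<open>For a fixed token \<open>r\<close>, adding up the vectors \<open>z i (e_i - e_r)\<close>
  gives \<open>z\<close> except for an error at \<open>r\<close>, which is the total of
  \<open>z\<close> and vanishes modulo \<open>m\<close>.\<close>

lemma reach_sum_zero:
  assumes v: "v \<in> verts G" and z: "\<And>x. x \<notin> verts G - {v} \<Longrightarrow> [z x = 0] (mod int m)"
    and sum: "[(\<Sum>x \<in> verts G. z x) = 0] (mod int m)"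
  shows "reach v v z id"
proof -
  let ?X = "verts G - {v}"
  have "?X \<noteq> {}"
    using card_verts card_mono[of "{v}" "verts G"] by auto
  then obtain r where r: "r \<in> ?X"
    by blast
  have S: "reach v v (\<lambda>x. \<Sum>i \<in> S. dif i r (z i) x) id" if "finite S" "S \<subseteq> ?X" for S
    using that
  proof (induction S)
    case empty
    show ?case using reach_id[OF v] by (simp only: sum.empty)
  next
    case (insert i S)
    have "reach v v (dif i r (z i)) id"
      using root_scalars_UNIV[OF v, of "z i"] r insert.prems by (auto simp: root_scalars_def)
    from reach_add[OF this insert.IH] show ?case
      using insert by (simp only: sum.insert insert_subset simp_thms)
  qed
  have sX: "(\<Sum>x \<in> verts G. z x) = z v + (\<Sum>x \<in> ?X. z x)"
    using v by (simp add: sum.remove)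
  have "[(\<Sum>x \<in> ?X. z x) = 0] (mod int m)"
    using cong_diff[OF sum z[of v]] by (simp add: sX)
  then have X0: "[- (\<Sum>x \<in> ?X. z x) = 0] (mod int m)"
    using cong_minus_minus_iff by fastforce
  show ?thesis
  proof (rule reach_cong[OF S])
    fix x
    have eq: "(\<Sum>i \<in> ?X. dif i r (z i) x) = (if x \<in> ?X then z x else 0) + (if x = r then - (\<Sum>i \<in> ?X. z i) else 0)"
      by (simp add: dif_def sum_subtractf sum.delta)
    have "[\<dots> = z x + 0] (mod int m)"
    proof (rule cong_add)
      show "[(if x \<in> ?X then z x else 0) = z x] (mod int m)"
        using z[of x] by (auto simp: cong_sym_eq)
      show "[(if x = r then - (\<Sum>i \<in> ?X. z i) else 0) = 0] (mod int m)"
        using X0 by auto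
    qed
    then show "[(\<Sum>i \<in> ?X. dif i r (z i) x) = z x] (mod int m)"
      unfolding eq by simp
  qed auto
qed

text \<open>It suffices to write each 3-cycle as a commutator. If an odd permutation occurs,
  transpositions are available, and \<open>(a c)\<close> and \<open>(c b)\<close> serve. Otherwise
  two further tokens \<open>e\<close> and \<open>f\<close> are taken, and the commutator of
  \<open>(a b e)\<close> and \<open>(a c f)\<close> is \<open>(a b c)\<close>.\<close>

lemma even_reach_total:
  assumes v: "v \<in> verts G" and big: "(\<exists>\<tau> \<in> P.grp v. \<not> evenperm \<tau>) \<or> card (verts G) \<ge> 6"
    and \<sigma>: "\<sigma> permutes verts G - {v}" "evenperm \<sigma>"
  shows "reach_total v 0 \<sigma>"
proof -
  let ?X = "verts G - {v}"
  interpret H: perm_group ?X "P.grp v"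
    by (rule P.perm_group_grp[OF v])
  interpret K: perm_group ?X "{\<sigma>. reach_total v 0 \<sigma>}"
    by (rule perm_group_reach_total[OF v])
  have full: "H.full ?X"
    using wilson v by (simp add: P.wilson_def)
  have "K.full ?X"
    unfolding K.full_def
  proof (intro ballI impI)
    fix a b c
    assume m: "a \<in> ?X" "b \<in> ?X" "c \<in> ?X" and d: "a \<noteq> b" "a \<noteq> c" "b \<noteq> c"
    from big have "reach_total v 0 (cyc3 a b c)"
    proof
      assume "\<exists>\<tau> \<in> P.grp v. \<not> evenperm \<tau>"
      then obtain \<tau> where \<tau>: "\<tau> \<in> P.grp v" "\<not> evenperm \<tau>"
        by blast
      have perm: "permutation \<tau>"
        using H.permutes[OF \<tau>(1)] H.finite_X unfolding permutation_permutes by blast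
      \<comment> \<open>Composed with the odd \<tau>, the transposition is even and hence in the
        group; the inverse of \<tau> then removes \<tau>.\<close>
      have swap: "Transposition.transpose i j \<in> P.grp v" if ij: "i \<in> ?X" "j \<in> ?X" "i \<noteq> j" for i j
      proof -
        let ?t = "Transposition.transpose i j"
        have "?t \<circ> \<tau> \<in> P.grp v"
        proof (rule H.full_imp_alternating[OF full])
          show "?t \<circ> \<tau> permutes ?X"
            using ij by (intro permutes_compose H.permutes[OF \<tau>(1)] permutes_swap_id)
          show "evenperm (?t \<circ> \<tau>)"
            using \<tau>(2) ij(3) perm by (simp only: evenperm_comp permutation_swap_id evenperm_swap simp_thms)
        qed
        from H.comp_mem[OF this H.inv_mem[OF \<tau>(1)]] have "?t \<circ> (\<tau> \<circ> inv_into UNIV \<tau>) \<in> P.grp v"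
          by (simp only: comp_assoc)
        moreover have "\<tau> \<circ> inv_into UNIV \<tau> = id"
          using H.bij_mem[OF \<tau>(1)] by (simp only: surj_iff[symmetric] bij_is_surj)
        ultimately show ?thesis
          by (simp only: comp_id)
      qed
      let ?x = "Transposition.transpose a c" and ?y = "Transposition.transpose c b"
      have "reach_total v 0 (?x \<circ> inv_into UNIV (?y \<circ> ?x \<circ> inv_into UNIV ?y))"
        using swap m d by (intro reach_total_commutator) auto
      moreover have "?x \<circ> inv_into UNIV (?y \<circ> ?x \<circ> inv_into UNIV ?y) = cyc3 a c b \<circ> cyc3 a c b"
        by (simp add: cyc3_def o_inv_distrib bij_comp comp_assoc)
      moreover have "cyc3 a c b \<circ> cyc3 a c b = cyc3 a b c"
        using d by (auto simp: fun_eq_iff cyc3_apply)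
      ultimately show ?thesis by simp
    next
      assume six: "card (verts G) \<ge> 6"
      have "\<not> verts G \<subseteq> {v, a, b, c}"
        using six card_mono[of "{v, a, b, c}" "verts G"] card_length[of "[v, a, b, c]"] by auto
      then obtain e where e: "e \<in> ?X" "e \<notin> {a, b, c}"
        by blast
      have "\<not> verts G \<subseteq> {v, a, b, c, e}"
        using six card_mono[of "{v, a, b, c, e}" "verts G"] card_length[of "[v, a, b, c, e]"] by auto
      then obtain f where f: "f \<in> ?X" "f \<notin> {a, b, c, e}"
        by blast
      have "cyc3 a b e \<in> P.grp v" "cyc3 a c f \<in> P.grp v"
        using H.fullD[OF full m(1,2) e(1)] H.fullD[OF full m(1,3) f(1)] d e f by auto
      then have "reach_total v 0 (cyc3 a b e \<circ> inv_into UNIV (cyc3 a c f \<circ> cyc3 a b e \<circ> inv_into UNIV (cyc3 a c f)))"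
        by (rule reach_total_commutator)
      moreover have "distinct (a # [] @ [b, e] @ [c, f])"
        using d e f by auto
      \<comment> \<open>The two cycles share only the vertex \<open>a\<close>, the case of an empty
        common path.\<close>
      from cycle_commutator[OF this] have
        "cyc3 a b e \<circ> inv_into UNIV (cyc3 a c f \<circ> cyc3 a b e \<circ> inv_into UNIV (cyc3 a c f)) = cyc3 a b c"
        by (simp add: cyc3_def)
      ultimately show ?thesis by simp
    qed
    then show "cyc3 a b c \<in> {\<sigma>. reach_total v 0 \<sigma>}"
      by simp
  qed
  then show ?thesis
    using K.full_imp_alternating \<sigma> by simp
qed

text \<open>The walk \<open>p\<close> already has the sum and the parity of the pair. Its
  permutation is corrected by an even one that carries a vector of sum 0, and the remaining
  difference of vectors falls under \<open>reach_sum_zero\<close>.\<close>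

lemma solvableI:
  assumes v: "v \<in> verts G" and big: "(\<exists>\<tau> \<in> P.grp v. \<not> evenperm \<tau>) \<or> card (verts G) \<ge> 6"
    and x: "(x, \<sigma>) \<in> carrier (gen_sym_group m (verts G - {v}))"
    and p: "awalk v p v" "[wsum p = (\<Sum>w \<in> verts G - {v}. x w)] (mod int m)"
      "even (length p) \<longleftrightarrow> evenperm \<sigma>"
  shows "(x, \<sigma>) \<in> solvable_pairs m G \<gamma> v"
proof -
  let ?X = "verts G - {v}"
  interpret H: perm_group ?X "P.grp v"
    by (rule P.perm_group_grp[OF v])
  have \<sigma>: "\<sigma> permutes ?X" and xX: "\<And>w. w \<notin> ?X \<Longrightarrow> x w = 0" and xm: "\<And>w. w \<in> ?X \<Longrightarrow> 0 \<le> x w \<and> x w < int m"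
    using x by (auto simp: carrier_gen_sym_group)
  let ?\<pi> = "pperm p"
  have \<pi>: "?\<pi> \<in> P.grp v"
    by (rule reach_grp[OF reach_awalk[OF p(1)]])
  have \<pi>X: "inv_into UNIV ?\<pi> permutes ?X"
    using H.permutes[OF H.inv_mem[OF \<pi>]] .
  define \<tau> where "\<tau> = \<sigma> \<circ> inv_into UNIV ?\<pi>"
  have \<tau>X: "\<tau> permutes ?X"
    unfolding \<tau>_def using \<pi>X \<sigma> by (rule permutes_compose)
  have perm: "permutation \<sigma>" "permutation (inv_into UNIV ?\<pi>)" "permutation ?\<pi>"
    using \<sigma> \<pi>X H.permutes[OF \<pi>] H.finite_X unfolding permutation_permutes by blast+
  have "evenperm \<tau>"
    unfolding \<tau>_def using evenperm_comp[OF perm(1,2)] evenperm_inv[OF perm(3)] evenperm_pperm[OF p(1)] p(3) by simp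
  then obtain y where y: "reach v v y \<tau>" "(\<Sum>w \<in> verts G. y w) = 0"
    using even_reach_total[OF v big \<tau>X] by (auto simp: reach_total_def)
  define h where "h = (\<lambda>w. y w + raw p (inv_into UNIV \<tau> w))"
  have "\<tau> \<circ> ?\<pi> = \<sigma>"
    by (simp add: \<tau>_def fun_eq_iff inv_pperm)
  then have h: "reach v v h \<sigma>"
    using reach_comp[OF reach_awalk[OF p(1)] y(1)] by (simp only: h_def)
  have "(\<Sum>w \<in> verts G. raw p (inv_into UNIV \<tau> w)) = wsum p"
    using sum.permute[OF permutes_inv[OF reach_permutes[OF y(1)]], of "raw p"] sum_raw[of p] p(1)
    by (auto simp: comp_def)
  then have hs: "(\<Sum>w \<in> verts G. h w) = wsum p"
    using y(2) by (simp add: h_def sum.distrib)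
  have xs: "(\<Sum>w \<in> verts G. x w) = (\<Sum>w \<in> ?X. x w)"
    using xX by (intro sum.mono_neutral_right) auto
  have "reach v v (\<lambda>w. x w - h w) id"
  proof (rule reach_sum_zero[OF v])
    show "[x w - h w = 0] (mod int m)" if "w \<notin> ?X" for w
      using reach_zero[OF h that] xX[OF that] by (simp add: cong_iff_dvd_diff)
    have "[(\<Sum>w \<in> ?X. x w) - wsum p = wsum p - wsum p] (mod int m)"
      using p(2) by (intro cong_diff cong_refl) (rule cong_sym)
    then show "[(\<Sum>w \<in> verts G. x w - h w) = 0] (mod int m)"
      by (simp add: sum_subtractf hs xs)
  qed
  from reach_add[OF this h] have "reach v v x \<sigma>"
    by simp
  then obtain q where q: "awalk v q v" "pperm q = \<sigma>" "\<And>w. [raw q w = x w] (mod int m)"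
    by (auto simp: reach_def)
  have "x w = raw q w mod int m" for w
  proof -
    have "x w mod int m = x w"
      using xX[of w] xm[of w] by (cases "w \<in> ?X") auto
    then show ?thesis
      using q(3)[of w] by (simp add: cong_def)
  qed
  then show ?thesis
    using q unfolding solvable_pairs_iff by blast
qed

text \<open>The integers congruent to sums of closed walks form a subgroup, which contains 1 by
  surjectivity of \<phi>_\<gamma>.\<close>

lemma closed_sum_exists:
  assumes v: "v \<in> verts G"
  shows "\<exists>p. awalk v p v \<and> [wsum p = s] (mod int m)"
proof -
  let ?S = "{s. \<exists>p. awalk v p v \<and> [wsum p = s] (mod int m)}"
  have "a - b \<in> ?S" if ab: "a \<in> ?S" "b \<in> ?S" for a b
  proof -
    obtain p q where p: "awalk v p v" "[wsum p = a] (mod int m)" and q: "awalk v q v" "[wsum q = b] (mod int m)"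
      using ab by blast
    have "wsum (rev (map bar q)) = sum_list (map (\<lambda>e. \<gamma> (bar e)) q)"
      by (induction q) simp_all
    moreover have "[sum_list (map (\<lambda>e. \<gamma> (bar e)) q) = - wsum q] (mod int m)" if "set q \<subseteq> arcs G"
      using that
    proof (induction q)
      case (Cons e q)
      then have "[\<gamma> (bar e) + sum_list (map (\<lambda>e. \<gamma> (bar e)) q) = - \<gamma> e + - wsum q] (mod int m)"
        by (intro cong_add gamma_bar) auto
      then show ?case by simp
    qed simp
    ultimately have "[wsum (rev (map bar q)) = - wsum q] (mod int m)"
      using q(1) by auto
    then have "[wsum p + wsum (rev (map bar q)) = a + - b] (mod int m)"
      using p(2) q(2) by (intro cong_add) (auto intro: cong_trans simp: cong_minus_minus_iff)
    then show ?thesis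
      using p(1) awalk_rev[OF q(1)] by (auto intro!: exI[of _ "p @ rev (map bar q)"])
  qed
  moreover have "0 \<in> ?S"
    using v by (auto intro!: exI[of _ "[]"] simp: awalk_Nil_iff)
  ultimately have S: "int_subgroup ?S"
    by (simp add: int_subgroup_def)
  have "int m \<in> ?S"
    using v by (auto intro!: exI[of _ "[]"] simp: awalk_Nil_iff cong_def)
  then have "1 \<in> ?S"
    by (rule one_mem_of_closed_sums[OF surj S _ v]) (auto intro: cong_refl)
  from int_subgroup_mult[OF S this, of s] show ?thesis
    by simp
qed

section \<open>The three cases\<close>

lemma solvable_bipartite:
  assumes v: "v \<in> verts G" and b: "bipartite G" and six: "card (verts G) \<ge> 6"
  shows "solvable_pairs m G \<gamma> v = {(x, \<sigma>) \<in> carrier (gen_sym_group m (verts G - {v})). evenperm \<sigma>}"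
proof -
  have even: "even (length p)" if "awalk v p v" for p
    using b bipartite_iff[OF v] that by blast
  have fwd: "(x, \<sigma>) \<in> carrier (gen_sym_group m (verts G - {v})) \<and> evenperm \<sigma>"
    if "(x, \<sigma>) \<in> solvable_pairs m G \<gamma> v" for x \<sigma>
    using that solvable_carrier even evenperm_pperm unfolding solvable_pairs_iff by blast
  have bwd: "(x, \<sigma>) \<in> solvable_pairs m G \<gamma> v"
    if x: "(x, \<sigma>) \<in> carrier (gen_sym_group m (verts G - {v}))" and "evenperm \<sigma>" for x \<sigma>
  proof -
    obtain p where "awalk v p v" "[wsum p = (\<Sum>w \<in> verts G - {v}. x w)] (mod int m)"
      using closed_sum_exists[OF v] by blast
    then show ?thesis
      using solvableI[OF v _ x] six even \<open>evenperm \<sigma>\<close> by blast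
  qed
  show ?thesis
    using fwd bwd by auto
qed

lemma odd_perm:
  assumes "awalk v p v" "odd (length p)"
  shows "\<exists>\<tau> \<in> P.grp v. \<not> evenperm \<tau>"
  using reach_grp[OF reach_awalk[OF assms(1)]] evenperm_pperm[OF assms(1)] assms(2) by blast

text \<open>The sum of a closed walk has the parity of its length, so matching the sum modulo
  \<open>m\<close> already matches the sign. A walk of sum 1 has odd length and provides the odd
  permutation for \<open>even_reach_total\<close>.\<close>

lemma solvable_twist_bipartite:
  assumes v: "v \<in> verts G" and t: "twist_bipartite m G \<gamma>"
  shows "solvable_pairs m G \<gamma> v = {(x, \<sigma>) \<in> carrier (gen_sym_group m (verts G - {v})).
    [(\<Sum>w \<in> verts G - {v}. x w) = perm_sign \<sigma>] (mod 2)}"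
proof -
  have em: "even m" and even: "\<And>p. awalk v p v \<Longrightarrow> even (wsum p + int (length p))"
    using t twist_bipartite_iff[OF v] by blast+
  have mod2: "[a = b] (mod 2)" if "[a = b] (mod int m)" for a b
    using cong_dvd_modulus[OF that, of 2] em by simp
  have fwd: "(x, \<sigma>) \<in> carrier (gen_sym_group m (verts G - {v})) \<and>
      [(\<Sum>w \<in> verts G - {v}. x w) = perm_sign \<sigma>] (mod 2)"
    if "(x, \<sigma>) \<in> solvable_pairs m G \<gamma> v" for x \<sigma>
  proof -
    obtain p where p: "awalk v p v" "x = (\<lambda>w. raw p w mod int m)" "\<sigma> = pperm p"
      using \<open>(x, \<sigma>) \<in> solvable_pairs m G \<gamma> v\<close> by (auto simp: solvable_pairs_iff)
    have "[wsum p = perm_sign \<sigma>] (mod 2)"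
      using even[OF p(1)] evenperm_pperm[OF p(1)] p(3) by (auto simp: perm_sign_def cong_iff_dvd_diff)
    then show ?thesis
      using solvable_carrier[OF p(1)] mod2[OF solvable_total[OF p(1)]] p(2,3) cong_trans by blast
  qed
  have bwd: "(x, \<sigma>) \<in> solvable_pairs m G \<gamma> v"
    if x: "(x, \<sigma>) \<in> carrier (gen_sym_group m (verts G - {v}))"
      and s: "[(\<Sum>w \<in> verts G - {v}. x w) = perm_sign \<sigma>] (mod 2)" for x \<sigma>
  proof -
    obtain p where p: "awalk v p v" "[wsum p = (\<Sum>w \<in> verts G - {v}. x w)] (mod int m)"
      using closed_sum_exists[OF v] by blast
    obtain q where q: "awalk v q v" "[wsum q = 1] (mod int m)"
      using closed_sum_exists[OF v] by blast
    have "odd (wsum q)"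
      using mod2[OF q(2)] by (simp add: cong_iff_dvd_diff)
    then have "odd (length q)"
      using even[OF q(1)] by simp
    from odd_perm[OF q(1) this] have big: "(\<exists>\<tau> \<in> P.grp v. \<not> evenperm \<tau>) \<or> card (verts G) \<ge> 6" ..
    have "[wsum p = perm_sign \<sigma>] (mod 2)"
      using cong_trans[OF mod2[OF p(2)] s] .
    then have "even (length p) \<longleftrightarrow> evenperm \<sigma>"
      using even[OF p(1)] by (auto simp: perm_sign_def cong_iff_dvd_diff split: if_splits)
    then show ?thesis
      by (rule solvableI[OF v big x p])
  qed
  show ?thesis
    using fwd bwd by auto
qed

text \<open>The sums of even closed walks form a subgroup containing 2, by running twice through a
  walk of sum 1. If they were all even, then \<open>m\<close> and the sum plus length of every
  closed walk would be even, which makes the graph twist bipartite. So an odd sum occurs, and with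
  it 1.\<close>

lemma even_closed_sum_exists:
  assumes v: "v \<in> verts G" and nt: "\<not> twist_bipartite m G \<gamma>"
    and r: "awalk v r v" "odd (length r)"
  shows "\<exists>p. awalk v p v \<and> even (length p) \<and> [wsum p = s] (mod int m)"
proof -
  let ?S = "{s. \<exists>p. awalk v p v \<and> even (length p) \<and> [wsum p = s] (mod int m)}"
  have add: "a + b \<in> ?S" if ab: "a \<in> ?S" "b \<in> ?S" for a b
  proof -
    obtain p q where "awalk v p v" "even (length p)" "[wsum p = a] (mod int m)"
      "awalk v q v" "even (length q)" "[wsum q = b] (mod int m)"
      using ab by blast
    then have "awalk v (p @ q) v" "even (length (p @ q))" "[wsum (p @ q) = a + b] (mod int m)"
      by (auto intro: cong_add)
    then show ?thesis by blast
  qed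
  have mul: "int m * k \<in> ?S" for k
    using v by (auto intro!: exI[of _ "[]"] simp: awalk_Nil_iff cong_def)
  have neg: "- a \<in> ?S" if "a \<in> ?S" for a
  proof -
    have "int n * a \<in> ?S" for n
    proof (induction n)
      case 0
      then show ?case using mul[of 0] by simp
    next
      case (Suc n)
      then show ?case using add[OF that, of "int n * a"] by (simp add: algebra_simps)
    qed
    \<comment> \<open>Negatives come from repetition: \<open>- a\<close> is
      \<open>(m - 1) a - m a\<close>, and multiples of \<open>m\<close> are represented by the empty
      walk.\<close>
    from add[OF this[of "m - 1"] mul[of "- a"]] show ?thesis
      using m_pos by (simp add: of_nat_diff algebra_simps)
  qed
  have S: "int_subgroup ?S"
    unfolding int_subgroup_def
  proof (intro conjI ballI)
    show "0 \<in> ?S"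
      using mul[of 0] by simp
    show "a - b \<in> ?S" if "a \<in> ?S" "b \<in> ?S" for a b
      using add[OF that(1) neg[OF that(2)]] by simp
  qed
  obtain q where q: "awalk v q v" "[wsum q = 1] (mod int m)"
    using closed_sum_exists[OF v] by blast
  have "[wsum (q @ q) = 1 + 1] (mod int m)"
    using cong_add[OF q(2) q(2)] by simp
  then have two: "2 \<in> ?S"
    using q(1) by (auto intro!: exI[of _ "q @ q"])
  have evens: "2 * k \<in> ?S" for k
    using int_subgroup_mult[OF S two, of k] by (simp add: mult.commute)
  have "\<exists>a \<in> ?S. odd a"
  proof (rule ccontr)
    assume no: "\<not> ?thesis"
    have em: "even m"
      using no mul[of 1] by auto
    have ev: "even (wsum p)" if "awalk v p v" "even (length p)" for p
      using no that by (auto intro: cong_refl)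
    have "even (wsum p + int (length p))" if p: "awalk v p v" for p
    proof (cases "even (length p)")
      case True
      then show ?thesis using ev[OF p] by simp
    next
      case False
      have qo: "odd (wsum q)"
        using cong_dvd_modulus[OF q(2), of 2] em by (simp add: cong_iff_dvd_diff)
      then have "odd (length q)"
        using ev[OF q(1)] by blast
      then have "even (wsum (q @ p))"
        using False q(1) p by (intro ev) auto
      then show ?thesis
        using qo False by simp
    qed
    then show False
      using nt em twist_bipartite_iff[OF v] by blast
  qed
  then obtain a where a: "a \<in> ?S" "odd a"
    by blast
  obtain k where "a = 2 * k + 1"
    using a(2) by (elim oddE)
  then have "1 \<in> ?S"
    using add[OF a(1) evens[of "- k"]] by simp
  from int_subgroup_mult[OF S this, of s] show ?thesis
    by simp
qed

lemma solvable_generic: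
  assumes v: "v \<in> verts G" and nb: "\<not> bipartite G" and nt: "\<not> twist_bipartite m G \<gamma>"
  shows "solvable_pairs m G \<gamma> v = carrier (gen_sym_group m (verts G - {v}))"
proof -
  have fwd: "(x, \<sigma>) \<in> carrier (gen_sym_group m (verts G - {v}))"
    if "(x, \<sigma>) \<in> solvable_pairs m G \<gamma> v" for x \<sigma>
    using that solvable_carrier unfolding solvable_pairs_iff by blast
  have bwd: "(x, \<sigma>) \<in> solvable_pairs m G \<gamma> v"
    if x: "(x, \<sigma>) \<in> carrier (gen_sym_group m (verts G - {v}))" for x \<sigma>
  proof -
    obtain r where r: "awalk v r v" "odd (length r)"
      using nb bipartite_iff[OF v] by blast
    from odd_perm[OF r] have big: "(\<exists>\<tau> \<in> P.grp v. \<not> evenperm \<tau>) \<or> card (verts G) \<ge> 6" ..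
    let ?s = "\<Sum>w \<in> verts G - {v}. x w"
    show ?thesis
    proof (cases "evenperm \<sigma>")
      case True
      then show ?thesis
        using even_closed_sum_exists[OF v nt r, of ?s] solvableI[OF v big x] by blast
    next
      case False
      \<comment> \<open>For an odd permutation the odd walk \<open>r\<close> is appended, and
        \<open>p\<close> makes up for its sum.\<close>
      obtain p where p: "awalk v p v" "even (length p)" "[wsum p = ?s - wsum r] (mod int m)"
        using even_closed_sum_exists[OF v nt r] by blast
      have "awalk v (p @ r) v" "odd (length (p @ r))"
        using p r by auto
      moreover have "[wsum (p @ r) = ?s] (mod int m)"
        using cong_add[OF p(3) cong_refl[of "wsum r"]] by simp
      ultimately show ?thesis
        using solvableI[OF v big x] False by blast
    qed
  qed
  show ?thesis
    using fwd bwd by auto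
qed

end

section \<open>Recognizing the excluded graphs\<close>

context twist
begin

lemma is_multi_ofI:
  assumes xs: "distinct xs" "set xs = verts G" and H: "pverts H = {..<length xs}"
    "parcs H \<subseteq> {..<length xs} \<times> {..<length xs}"
    and adj: "\<And>i j. i < length xs \<Longrightarrow> j < length xs \<Longrightarrow> adj (xs ! i) (xs ! j) \<longleftrightarrow> (i, j) \<in> parcs H"
  shows "is_multi_of G H"
  unfolding is_multi_of_def
proof (intro exI[of _ "(!) xs"] conjI)
  show "bij_betw ((!) xs) (pverts H) (verts G)"
    using bij_betw_nth[OF xs(1) H(1) xs(2)[symmetric]] .
  have eq: "(a, b) \<in> arcs_ends G \<longleftrightarrow> (\<exists>i j. (i, j) \<in> parcs H \<and> a = xs ! i \<and> b = xs ! j)" for a b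
  proof
    assume "(a, b) \<in> arcs_ends G"
    then have ab: "adj a b"
      by (simp add: adj_arcs_ends)
    have "a \<in> set xs" "b \<in> set xs"
      using P.E_V[OF ab] P.E_V[OF adj_sym[OF ab]] xs(2) by simp_all
    then obtain i j where "i < length xs" "a = xs ! i" "j < length xs" "b = xs ! j"
      by (metis in_set_conv_nth)
    then show "\<exists>i j. (i, j) \<in> parcs H \<and> a = xs ! i \<and> b = xs ! j"
      using adj[of i j] ab by blast
  next
    assume "\<exists>i j. (i, j) \<in> parcs H \<and> a = xs ! i \<and> b = xs ! j"
    then obtain i j where ij: "(i, j) \<in> parcs H" "a = xs ! i" "b = xs ! j"
      by blast
    moreover have "i < length xs" "j < length xs"
      using ij(1) H(2) by auto
    ultimately show "(a, b) \<in> arcs_ends G"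
      using adj[of i j] by (simp add: adj_arcs_ends)
  qed
  show "arcs_ends G = map_prod ((!) xs) ((!) xs) ` parcs H"
  proof (rule Set.set_eqI)
    fix e :: "'v \<times> 'v"
    obtain a b where e: "e = (a, b)"
      by fastforce
    show "e \<in> arcs_ends G \<longleftrightarrow> e \<in> map_prod ((!) xs) ((!) xs) ` parcs H"
      unfolding e eq image_iff Bex_def split_paired_Ex by (simp only: map_prod_simp prod.inject)
  qed
qed

text \<open>A Hamiltonian cycle without chords lists all adjacencies, so its positions identify the
  graph with \<open>cycle_graph\<close> up to parallel edges.\<close>

lemma chord_of_not_cycle:
  assumes nc: "\<forall>k\<ge>3. \<not> is_multi_of G (cycle_graph k)" and cs: "P.cyc cs" "set cs = verts G"
  shows "P.chord cs"
proof (rule ccontr)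
  assume no: "\<not> P.chord cs"
  let ?k = "length cs"
  have k: "?k \<ge> 3" and d: "distinct cs" and succ: "successively adj cs" "adj (last cs) (hd cs)"
    using cs by (auto simp: P.cyc_def)
  have parcs: "(i, j) \<in> parcs (cycle_graph ?k) \<longleftrightarrow> i < ?k \<and> j = Suc i mod ?k \<or> j < ?k \<and> i = Suc j mod ?k" for i j
    by (auto simp: cycle_graph_def parcs_mk_symmetric)
  have step: "adj (cs ! i) (cs ! (Suc i mod ?k))" if "i < ?k" for i
  proof (cases "Suc i = ?k")
    case True
    moreover have "cs \<noteq> []"
      using k by auto
    moreover have "length cs - 1 = i"
      using True by simp
    ultimately show ?thesis
      using succ(2) by (simp add: last_conv_nth hd_conv_nth)
  next
    case False
    then have "Suc i < ?k"
      using that by simp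
    then show ?thesis
      using succ(1) by (simp add: successively_conv_nth)
  qed
  have less: "j = Suc i mod ?k \<or> i = Suc j mod ?k" if "i < j" "j < ?k" "adj (cs ! i) (cs ! j)" for i j
  proof -
    have "j = Suc i \<or> i = 0 \<and> Suc j = ?k"
      using no that unfolding P.chord_def by blast
    then show ?thesis
      using that by auto
  qed
  have mod_lt: "a mod ?k < ?k" for a
    using k by (intro mod_less_divisor) linarith
  have "is_multi_of G (cycle_graph ?k)"
  proof (rule is_multi_ofI[OF d cs(2)])
    show "pverts (cycle_graph ?k) = {..<?k}"
      by (simp add: cycle_graph_def)
    show "parcs (cycle_graph ?k) \<subseteq> {..<?k} \<times> {..<?k}"
      using mod_lt by (auto simp: parcs)
    fix i j assume ij: "i < ?k" "j < ?k"
    have "i \<noteq> j" if "adj (cs ! i) (cs ! j)"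
      using that P.E_irrefl by auto
    then show "adj (cs ! i) (cs ! j) \<longleftrightarrow> (i, j) \<in> parcs (cycle_graph ?k)"
      unfolding parcs using less[of i j] less[of j i] step[of i] step[of j] ij adj_sym
      by (metis linorder_neqE_nat)
  qed
  then show False
    using nc k by blast
qed

lemma theta5_extra_edge:
  assumes n5: "\<not> is_multi_of G theta5"
    and d: "distinct [u, w, a, b, c]" and V: "verts G = {u, w, a, b, c}"
    and E: "adj u a" "adj u b" "adj u c" "adj w a" "adj w b" "adj w c"
  shows "adj u w \<or> adj a b \<or> adj a c \<or> adj b c"
proof (rule ccontr)
  assume no: "\<not> ?thesis"
  then have N: "\<not> adj u w" "\<not> adj a b" "\<not> adj a c" "\<not> adj b c"
    by blast+
  have N': "\<not> adj y x" if "\<not> adj x y" for x y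
    using that adj_sym by blast
  let ?xs = "[u, w, a, b, c]"
  have "is_multi_of G theta5"
  proof (rule is_multi_ofI[OF d])
    show "set ?xs = verts G"
      by (simp add: V)
    show "pverts theta5 = {..<length ?xs}"
      by (simp add: theta5_def)
    have parcs: "parcs theta5 = {(0,2), (2,1), (0,3), (3,1), (0,4), (4,1), (2,0), (1,2), (3,0), (1,3), (4,0), (1,4)}"
      by (auto simp: theta5_def parcs_mk_symmetric)
    show "parcs theta5 \<subseteq> {..<length ?xs} \<times> {..<length ?xs}"
      by (simp add: parcs)
    fix i j :: nat assume "i < length ?xs" "j < length ?xs"
    then have "i \<in> {0, 1, 2, 3, 4}" "j \<in> {0, 1, 2, 3, 4}"
      by auto
    then show "adj (?xs ! i) (?xs ! j) \<longleftrightarrow> (i, j) \<in> parcs theta5"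
      unfolding parcs using E E[THEN adj_sym] N N[THEN N'] P.E_irrefl by (elim insertE emptyE) simp_all
  qed
  then show False
    using n5 by blast
qed

lemma theta7_extra_edge:
  assumes n7: "\<not> is_multi_of G theta7"
    and cs: "P.cyc cs" "length cs = 6" "x \<notin> set cs" "verts G = insert x (set cs)" "adj x (cs ! 0)" "adj x (cs ! 3)"
  shows "P.chord cs \<or> (\<exists>i < 6. i \<noteq> 0 \<and> i \<noteq> 3 \<and> adj x (cs ! i))"
proof (rule ccontr)
  assume no: "\<not> ?thesis"
  obtain c0 c1 c2 c3 c4 c5 where csl: "cs = [c0, c1, c2, c3, c4, c5]"
    using cs(2) by (auto simp: length_Suc_conv eval_nat_numeral)
  have E: "adj c0 c1" "adj c1 c2" "adj c2 c3" "adj c3 c4" "adj c4 c5" "adj c5 c0" "adj x c0" "adj x c3"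
    and d: "distinct cs"
    using cs by (auto simp: P.cyc_def csl)
  have nadj: "\<not> adj (cs ! i) (cs ! j)" if "i < j" "j < 6" "j \<noteq> Suc i" "\<not> (i = 0 \<and> j = 5)" for i j
  proof -
    have "\<not> (i = 0 \<and> Suc j = length cs)" "j < length cs"
      using that cs(2) by auto
    then show ?thesis
      using no that(1,3) unfolding P.chord_def by blast
  qed
  have "\<not> adj c0 c2" "\<not> adj c0 c3" "\<not> adj c0 c4" "\<not> adj c1 c3" "\<not> adj c1 c4" "\<not> adj c1 c5"
    "\<not> adj c2 c4" "\<not> adj c2 c5" "\<not> adj c3 c5"
    using nadj[of 0 2] nadj[of 0 3] nadj[of 0 4] nadj[of 1 3] nadj[of 1 4] nadj[of 1 5] nadj[of 2 4]
      nadj[of 2 5] nadj[of 3 5] by (simp_all add: csl)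
  moreover have "\<not> adj x c1" "\<not> adj x c2" "\<not> adj x c4" "\<not> adj x c5"
    using no by (auto simp: csl dest: spec[of _ 1] spec[of _ 2] spec[of _ 4] spec[of _ 5])
  ultimately have N: "\<not> adj c0 c2" "\<not> adj c0 c3" "\<not> adj c0 c4" "\<not> adj c1 c3" "\<not> adj c1 c4" "\<not> adj c1 c5"
    "\<not> adj c2 c4" "\<not> adj c2 c5" "\<not> adj c3 c5" "\<not> adj x c1" "\<not> adj x c2" "\<not> adj x c4" "\<not> adj x c5"
    by blast+
  have N': "\<not> adj b a" if "\<not> adj a b" for a b
    using that adj_sym by blast
  \<comment> \<open>The order follows the numbering of \<open>theta7\<close>: 0 and 1 are the branch
    vertices \<open>c0\<close> and \<open>c3\<close>, then come the interiors \<open>c1, c2\<close>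
    and \<open>c5, c4\<close> of the two arcs from \<open>c0\<close> to \<open>c3\<close>, and
    finally \<open>x\<close>.\<close>
  let ?xs = "[c0, c3, c1, c2, c5, c4, x]"
  have "is_multi_of G theta7"
  proof (rule is_multi_ofI)
    show "distinct ?xs" "set ?xs = verts G"
      using d cs(3,4) by (auto simp: csl)
    show "pverts theta7 = {..<length ?xs}"
      by (simp add: theta7_def)
    have parcs: "parcs theta7 = {(0,2), (2,3), (3,1), (0,4), (4,5), (5,1), (0,6), (6,1),
      (2,0), (3,2), (1,3), (4,0), (5,4), (1,5), (6,0), (1,6)}"
      by (auto simp: theta7_def parcs_mk_symmetric)
    show "parcs theta7 \<subseteq> {..<length ?xs} \<times> {..<length ?xs}"
      by (simp add: parcs)
    fix i j :: nat assume "i < length ?xs" "j < length ?xs"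
    then have "i \<in> {0, 1, 2, 3, 4, 5, 6}" "j \<in> {0, 1, 2, 3, 4, 5, 6}"
      by auto
    then show "adj (?xs ! i) (?xs ! j) \<longleftrightarrow> (i, j) \<in> parcs theta7"
      unfolding parcs using E E[THEN adj_sym] N N[THEN N'] P.E_irrefl by (elim insertE emptyE) simp_all
  qed
  then show False
    using n7 by blast
qed

end

theorem theorem2:
  fixes \<Gamma> :: "('v, 'e) pre_digraph" and bar :: "'e \<Rightarrow> 'e" and \<gamma> :: "'e \<Rightarrow> int"
    and m n :: nat and v :: 'v
  assumes "m \<ge> 1"
    and "twist_graph m \<Gamma> bar \<gamma>"
    and "two_vertex_connected \<Gamma>"
    and "card (verts \<Gamma>) = n + 1"
    and "loopfree_digraph \<Gamma>"
    and "phi m \<Gamma> bar \<gamma> ` H1 m \<Gamma> bar = carrier (integer_mod_group m)"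
    and "\<forall>k\<ge>3. \<not> is_multi_of \<Gamma> (cycle_graph k)"
    and "\<not> is_multi_of \<Gamma> theta5"
    and "\<not> is_multi_of \<Gamma> theta7"
    and "v \<in> verts \<Gamma>"
  shows "(bipartite \<Gamma> \<longrightarrow>
            solvable_pairs m \<Gamma> \<gamma> v =
              {(x, \<sigma>) \<in> carrier (gen_sym_group m (verts \<Gamma> - {v})). evenperm \<sigma>}) \<and>
         (twist_bipartite m \<Gamma> \<gamma> \<longrightarrow>
            solvable_pairs m \<Gamma> \<gamma> v =
              {(x, \<sigma>) \<in> carrier (gen_sym_group m (verts \<Gamma> - {v})).
                 [(\<Sum>w \<in> verts \<Gamma> - {v}. x w) = perm_sign \<sigma>] (mod 2)}) \<and>
         (\<not> bipartite \<Gamma> \<and> \<not> twist_bipartite m \<Gamma> \<gamma> \<longrightarrow>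
            solvable_pairs m \<Gamma> \<gamma> v = carrier (gen_sym_group m (verts \<Gamma> - {v})))"
proof -
  interpret bidirected_digraph \<Gamma> bar
    using assms(2) by (simp add: twist_graph_def)
  interpret fin_digraph \<Gamma>
    using assms(2) by (simp add: twist_graph_def)
  interpret loopfree_digraph \<Gamma>
    by (rule assms(5))
  interpret T: twist \<Gamma> bar m \<gamma>
    by unfold_locales (use assms(1-3) in \<open>auto simp: twist_graph_def\<close>)
  have chord: "T.P.chord cs" if "T.P.cyc cs" "set cs = verts \<Gamma>" for cs
    by (rule T.chord_of_not_cycle[OF assms(7) that])
  have wilson: "T.P.wilson"
    using T.P.wilson_theorem[OF chord T.theta7_extra_edge[OF assms(9)]] .
  interpret W: twist_wilson \<Gamma> bar m \<gamma>
    by unfold_locales (fact wilson chord assms(6))+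
  have six: "card (verts \<Gamma>) \<ge> 6" if b: "bipartite \<Gamma>"
  proof -
    obtain c :: "'v \<Rightarrow> bool" where c: "\<forall>e \<in> arcs \<Gamma>. c (tail \<Gamma> e) \<noteq> c (head \<Gamma> e)"
      using b unfolding bipartite_def by blast
    then have "c x \<noteq> c y" if "T.adj x y" for x y
      using that by (auto simp: T.adj_def)
    then show ?thesis
      by (rule T.P.bipartite_card[OF _ chord T.theta5_extra_edge[OF assms(8)]])
  qed
  show ?thesis
    using W.solvable_bipartite[OF assms(10) _ six] W.solvable_twist_bipartite[OF assms(10)]
      W.solvable_generic[OF assms(10)] by blast
qed

end
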